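(* Let ${}_{\mathcal C}\mathcal L_{\mathcal D}$ be a pivotal bimodule category over pivotal fusion categories $\mathcal C$ and $\mathcal D$ over an algebraically closed field $k$. (i) The left traces $\mathrm{tr}^{\mathcal L}_{{\rm l};x}$ and the right traces $\mathrm{tr}^{\mathcal L}_{{\rm r};x}$ ($x\in\mathcal L$), formed with the standard trivializations of the distinguished invertible objects of $\mathcal C$ and $\mathcal D$, endow the semisimple category $\mathcal L$ with two Calabi-Yau structures. (ii) If $\mathcal L$ is a spherical bimodule category over spherical fusion categories $\mathcal C$ and $\mathcal D$, then the two Calabi-Yau structures in (i) coincide.
   Context: $k$ is algebraically closed; all categories are finite $k$-linear abelian. A fusion category is a semisimple finite rigid monoidal category with bilinear tensor product and simple unit $\mathbf 1$. A right dual $a^\vee$ has $a^\vee\otimes a\to\mathbf 1$, $\mathbf 1\to a\otimes a^\vee$; a left dual ${}^\vee a$ has $a\otimes{}^\vee a\to\mathbf 1$, $\mathbf 1\to{}^\vee a\otimes a$. (Bi)module categories have exact action functors $\triangleright,\triangleleft$; $\overline{\mathcal D}$ is $\mathcal D$ with reversed tensor product; a right $\mathcal D$-module category is a left $\overline{\mathcal D}$-module category. Pivotal module categories are exact, so over fusion categories they are semisimple and all objects are projective. **Calabi-Yau structure.** A Calabi-Yau structure on a finite $k$-linear category $\mathcal X$ is a family of linear maps $\mathrm{tr}_x:\mathrm{Hom}(x,x)\to k$, $x\in\mathcal X$, with $\mathrm{tr}_y(f\circ g)=\mathrm{tr}_x(g\circ f)$ for $f:x\to y$, $g:y\to x$,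 and such that the pairings $\mathrm{Hom}(x,y)\otimes_k\mathrm{Hom}(y,x)\to k$, $f\otimes g\mapsto\mathrm{tr}_x(g\circ f)$, are non-degenerate. **Twisted trace.** $\mathbb N^r_{\mathcal X}=\int^{x\in\mathcal X}\mathrm{Hom}_{\mathcal X}(-,x)^*\otimes x$ is the Nakayama functor. For $p$ projective there is a canonical natural isomorphism $\mathfrak n_{p;x}:\mathrm{Hom}(p,x)\to\mathrm{Hom}(x,\mathbb N^r(p))^*$, and $\mathbf t^{\mathcal X}_p=\mathfrak n_{p;p}(\mathrm{id}_p):\mathrm{Hom}(p,\mathbb N^r(p))\to k$. There are canonical isomorphisms $\mathbb N^r\circ F\cong F^{\rm rra}\circ\mathbb N^r$ (rra: double right adjoint). **Distinguished object, standard trivialization, sphericality.** $\mathbb D_{\mathcal C}^{-1}:=\mathbb N^r_{\mathcal C}(\mathbf 1)$ is invertible, and isomorphic to $\mathbf 1$ for $\mathcal C$ fusion. The standard trivialization is the isomorphism $\mathbf s_{\mathcal C}:\mathbf 1\to\mathbb D_{\mathcal C}^{-1}$ with $\mathbf t^{\mathcal C}_{\mathbf 1}(\mathbf s_{\mathcal C})=1$. The isomorphisms ${}^{\vee\vee}c\otimes\mathbb D_{\mathcal C}^{-1}\cong\mathbb N^r_{\mathcal C}(c)\cong\mathbb D_{\mathcal C}^{-1}\otimes c^{\vee\vee}$ yield a canonical $\overline r_{\mathcal C}:\mathrm{id}\Rightarrow(-)^{\vee\vee\vee\vee}$; a pivotal fusion category with pivotal structure $\mathrm p$ is spherical if $\mathrm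 p^{\vee\vee}\circ\mathrm p=\overline r_{\mathcal C}$. **Relative Serre functors, pivotal and spherical bimodules.** For an exact left $\mathcal C$-module category, $\mathbb S^{\mathcal C}_{\mathcal L}$ is the endofunctor with $\underline{\mathrm{Hom}}(y,z)^\vee\cong\underline{\mathrm{Hom}}(z,\mathbb S^{\mathcal C}_{\mathcal L}(y))$ ($\underline{\mathrm{Hom}}$: internal Hom). There are canonical isomorphisms $\mathbb D_{\mathcal C}^{-1}\triangleright\mathbb S^{\mathcal C}_{\mathcal L}\cong\mathbb N^r_{\mathcal L}\cong\mathbb S^{\overline{\mathcal D}}_{\mathcal L}\triangleleft\mathbb D_{\mathcal D}^{-1}$ (the first from $\mathbb N^r_{\mathcal L}\circ(-\triangleright y)\cong(-\triangleright y)^{\rm rra}\circ\mathbb N^r_{\mathcal C}$ at $\mathbf 1$; the second analogously); their composite is the Radford isomorphism $\mathcal R_{\mathcal L}$. For pivotal $\mathcal C,\mathcal D$, a pivotal bimodule category is an exact one with bimodule natural isomorphisms $\tilde{\mathrm p}:\mathrm{id}_{\mathcal L}\Rightarrow\mathbb S^{\mathcal C}_{\mathcal L}$ and $\tilde{\mathrm q}:\mathrm{id}_{\mathcal L}\Rightarrow\mathbb S^{\overline{\mathcal D}}_{\mathcal L}$ (the double-dual-twisted bimodule structures of the Serre functors being untwisted by the pivotal structures of $\mathcal C$ and $\mathcal D$). It is spherical (over spherical fusion $\mathcal C,\mathcal D$) if $\overline{\mathcal R}_{\mathcal L}\circ\tilde{\mathrm p}=\tilde{\mathrm q}$ with $\overline{\mathcal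 R}_{\mathcal L}=(\mathrm{id}\triangleleft\mathbf s_{\mathcal D}^{-1})\circ\mathcal R_{\mathcal L}\circ(\mathbf s_{\mathcal C}\triangleright\mathrm{id})$. **Left and right traces.** For $f\in\mathrm{Hom}_{\mathcal L}(x,x)$: $\mathrm{tr}^{\mathcal L}_{{\rm l};x}(f)$ is $\mathbf t^{\mathcal L}_x$ applied to $x\xrightarrow{f}x\xrightarrow{\mathbf s_{\mathcal C}\triangleright\tilde{\mathrm p}_x}\mathbb D_{\mathcal C}^{-1}\triangleright\mathbb S^{\mathcal C}_{\mathcal L}(x)\cong\mathbb N^r_{\mathcal L}(x)$, and $\mathrm{tr}^{\mathcal L}_{{\rm r};x}(f)$ is $\mathbf t^{\mathcal L}_x$ applied to $x\xrightarrow{f}x\xrightarrow{\tilde{\mathrm q}_x\triangleleft\mathbf s_{\mathcal D}}\mathbb S^{\overline{\mathcal D}}_{\mathcal L}(x)\triangleleft\mathbb D_{\mathcal D}^{-1}\cong\mathbb N^r_{\mathcal L}(x)$. *)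

theory Defs
  imports "HOL-Computational_Algebra.Polynomial"
begin

section \<open>Finite linear categories\<close>

text \<open>
  All hom spaces of a \<open>k\<close>-linear category are realised as subspaces of one ambient vector
  space, and composition is one operation on that space. This is no loss of generality: replace
  each hom space by its copy in the direct sum of all hom spaces. Hom spaces need not be
  disjoint (they share \<open>0\<close>), so notions that depend on source and target take
  these objects as arguments. Composition is written in the usual order: \<open>g \<cdot> f\<close> is
  \<open>g\<close> after \<open>f\<close>.
\<close>

record ('o, 'm, 'k) lincat =
  obj :: "'o set"
  hom :: "'o \<Rightarrow> 'o \<Rightarrow> 'm set"
  ide :: "'o \<Rightarrow> 'm"
  cmp :: "'m \<Rightarrow> 'm \<Rightarrow> 'm"  (infixl "\<cdot>\<index>" 70)
  scl :: "'k \<Rightarrow> 'm \<Rightarrow> 'm"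

locale linear_category =
  fixes X :: "('o, 'm::ab_group_add, 'k::field, 'z) lincat_scheme" (structure)
  assumes vector_space: "vector_space (scl X)"
    and hom_subspace:
      "x \<in> obj X \<Longrightarrow> y \<in> obj X \<Longrightarrow> module.subspace (scl X) (hom X x y)"
    and ide_in_hom: "x \<in> obj X \<Longrightarrow> ide X x \<in> hom X x x"
    and cmp_in_hom:
      "\<lbrakk>x \<in> obj X; y \<in> obj X; z \<in> obj X; f \<in> hom X x y; g \<in> hom X y z\<rbrakk> \<Longrightarrow> g \<cdot> f \<in> hom X x z"
    and cmp_ide: "\<lbrakk>x \<in> obj X; y \<in> obj X; f \<in> hom X x y\<rbrakk> \<Longrightarrow> f \<cdot> ide X x = f"
    and ide_cmp: "\<lbrakk>x \<in> obj X; y \<in> obj X; f \<in> hom X x y\<rbrakk> \<Longrightarrow> ide X y \<cdot> f = f"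
    and cmp_assoc:
      "\<lbrakk>w \<in> obj X; x \<in> obj X; y \<in> obj X; z \<in> obj X;
        f \<in> hom X w x; g \<in> hom X x y; h \<in> hom X y z\<rbrakk> \<Longrightarrow> (h \<cdot> g) \<cdot> f = h \<cdot> (g \<cdot> f)"
    and cmp_add_right:
      "\<lbrakk>x \<in> obj X; y \<in> obj X; z \<in> obj X; f \<in> hom X x y; f' \<in> hom X x y; g \<in> hom X y z\<rbrakk>
        \<Longrightarrow> g \<cdot> (f + f') = g \<cdot> f + g \<cdot> f'"
    and cmp_add_left:
      "\<lbrakk>x \<in> obj X; y \<in> obj X; z \<in> obj X; f \<in> hom X x y; g \<in> hom X y z; g' \<in> hom X y z\<rbrakk>
        \<Longrightarrow> (g + g') \<cdot> f = g \<cdot> f + g' \<cdot> f"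
    and cmp_scl_right:
      "\<lbrakk>x \<in> obj X; y \<in> obj X; z \<in> obj X; f \<in> hom X x y; g \<in> hom X y z\<rbrakk>
        \<Longrightarrow> g \<cdot> scl X a f = scl X a (g \<cdot> f)"
    and cmp_scl_left:
      "\<lbrakk>x \<in> obj X; y \<in> obj X; z \<in> obj X; f \<in> hom X x y; g \<in> hom X y z\<rbrakk>
        \<Longrightarrow> scl X a g \<cdot> f = scl X a (g \<cdot> f)"

definition is_iso :: "('o, 'm, 'k, 'z) lincat_scheme \<Rightarrow> 'o \<Rightarrow> 'o \<Rightarrow> 'm \<Rightarrow> bool" where
  "is_iso X x y f \<longleftrightarrow> f \<in> hom X x y \<and>
     (\<exists>g\<in>hom X y x. g \<cdot>\<^bsub>X\<^esub> f = ide X x \<and> f \<cdot>\<^bsub>X\<^esub> g = ide X y)"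

definition inv_arr :: "('o, 'm, 'k, 'z) lincat_scheme \<Rightarrow> 'o \<Rightarrow> 'o \<Rightarrow> 'm \<Rightarrow> 'm" where
  "inv_arr X x y f =
     (THE g. g \<in> hom X y x \<and> g \<cdot>\<^bsub>X\<^esub> f = ide X x \<and> f \<cdot>\<^bsub>X\<^esub> g = ide X y)"

definition is_mono :: "('o, 'm, 'k, 'z) lincat_scheme \<Rightarrow> 'o \<Rightarrow> 'o \<Rightarrow> 'm \<Rightarrow> bool" where
  "is_mono X x y f \<longleftrightarrow> f \<in> hom X x y \<and>
     (\<forall>w\<in>obj X. \<forall>g\<in>hom X w x. \<forall>h\<in>hom X w x. f \<cdot>\<^bsub>X\<^esub> g = f \<cdot>\<^bsub>X\<^esub> h \<longrightarrow> g = h)"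

definition is_epi :: "('o, 'm, 'k, 'z) lincat_scheme \<Rightarrow> 'o \<Rightarrow> 'o \<Rightarrow> 'm \<Rightarrow> bool" where
  "is_epi X x y f \<longleftrightarrow> f \<in> hom X x y \<and>
     (\<forall>z\<in>obj X. \<forall>g\<in>hom X y z. \<forall>h\<in>hom X y z. g \<cdot>\<^bsub>X\<^esub> f = h \<cdot>\<^bsub>X\<^esub> f \<longrightarrow> g = h)"

definition is_zero :: "('o, 'm::ab_group_add, 'k, 'z) lincat_scheme \<Rightarrow> 'o \<Rightarrow> bool" where
  "is_zero X z \<longleftrightarrow> z \<in> obj X \<and> (\<forall>x\<in>obj X. hom X x z = {0} \<and> hom X z x = {0})"

definition is_biproduct ::
  "('o, 'm::ab_group_add, 'k, 'z) lincat_scheme \<Rightarrow> 'o \<Rightarrow> 'o \<Rightarrow> 'o \<Rightarrow> bool" where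
  "is_biproduct X a b s \<longleftrightarrow> s \<in> obj X \<and>
     (\<exists>i\<in>hom X a s. \<exists>j\<in>hom X b s. \<exists>p\<in>hom X s a. \<exists>q\<in>hom X s b.
        p \<cdot>\<^bsub>X\<^esub> i = ide X a \<and> q \<cdot>\<^bsub>X\<^esub> j = ide X b \<and> p \<cdot>\<^bsub>X\<^esub> j = 0 \<and> q \<cdot>\<^bsub>X\<^esub> i = 0 \<and>
        i \<cdot>\<^bsub>X\<^esub> p + j \<cdot>\<^bsub>X\<^esub> q = ide X s)"

text \<open>\<open>is_kernel X a b c k f\<close>: the morphism \<open>k : a \<rightarrow> b\<close> is a kernel of \<open>f : b \<rightarrow> c\<close>.\<close>

definition is_kernel ::
  "('o, 'm::ab_group_add, 'k, 'z) lincat_scheme \<Rightarrow> 'o \<Rightarrow> 'o \<Rightarrow> 'o \<Rightarrow> 'm \<Rightarrow> 'm \<Rightarrow> bool" where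
  "is_kernel X a b c k f \<longleftrightarrow> k \<in> hom X a b \<and> f \<in> hom X b c \<and> f \<cdot>\<^bsub>X\<^esub> k = 0 \<and>
     (\<forall>w\<in>obj X. \<forall>g\<in>hom X w b. f \<cdot>\<^bsub>X\<^esub> g = 0 \<longrightarrow> (\<exists>!h. h \<in> hom X w a \<and> k \<cdot>\<^bsub>X\<^esub> h = g))"

text \<open>\<open>is_cokernel X a b c f q\<close>: the morphism \<open>q : b \<rightarrow> c\<close> is a cokernel of \<open>f : a \<rightarrow> b\<close>.\<close>

definition is_cokernel ::
  "('o, 'm::ab_group_add, 'k, 'z) lincat_scheme \<Rightarrow> 'o \<Rightarrow> 'o \<Rightarrow> 'o \<Rightarrow> 'm \<Rightarrow> 'm \<Rightarrow> bool" where
  "is_cokernel X a b c f q \<longleftrightarrow> f \<in> hom X a b \<and> q \<in> hom X b c \<and> q \<cdot>\<^bsub>X\<^esub> f = 0 \<and>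
     (\<forall>w\<in>obj X. \<forall>g\<in>hom X b w. g \<cdot>\<^bsub>X\<^esub> f = 0 \<longrightarrow> (\<exists>!h. h \<in> hom X c w \<and> h \<cdot>\<^bsub>X\<^esub> q = g))"

definition short_exact ::
  "('o, 'm::ab_group_add, 'k, 'z) lincat_scheme \<Rightarrow> 'o \<Rightarrow> 'o \<Rightarrow> 'o \<Rightarrow> 'm \<Rightarrow> 'm \<Rightarrow> bool" where
  "short_exact X a b c f g \<longleftrightarrow> is_kernel X a b c f g \<and> is_cokernel X a b c f g"

locale abelian_category = linear_category X
  for X :: "('o, 'm::ab_group_add, 'k::field, 'z) lincat_scheme" (structure) +
  assumes ex_zero: "\<exists>z. is_zero X z"
    and ex_biproduct: "a \<in> obj X \<Longrightarrow> b \<in> obj X \<Longrightarrow> \<exists>s. is_biproduct X a b s"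
    and ex_kernel:
      "\<lbrakk>b \<in> obj X; c \<in> obj X; f \<in> hom X b c\<rbrakk> \<Longrightarrow> \<exists>a\<in>obj X. \<exists>k. is_kernel X a b c k f"
    and ex_cokernel:
      "\<lbrakk>a \<in> obj X; b \<in> obj X; f \<in> hom X a b\<rbrakk> \<Longrightarrow> \<exists>c\<in>obj X. \<exists>q. is_cokernel X a b c f q"
    and mono_is_kernel:
      "\<lbrakk>a \<in> obj X; b \<in> obj X; is_mono X a b k\<rbrakk> \<Longrightarrow> \<exists>c\<in>obj X. \<exists>f. is_kernel X a b c k f"
    and epi_is_cokernel:
      "\<lbrakk>b \<in> obj X; c \<in> obj X; is_epi X b c q\<rbrakk> \<Longrightarrow> \<exists>a\<in>obj X. \<exists>f. is_cokernel X a b c f q"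

definition is_projective :: "('o, 'm, 'k, 'z) lincat_scheme \<Rightarrow> 'o \<Rightarrow> bool" where
  "is_projective X p \<longleftrightarrow> p \<in> obj X \<and>
     (\<forall>x\<in>obj X. \<forall>y\<in>obj X. \<forall>e. is_epi X x y e \<longrightarrow>
        (\<forall>f\<in>hom X p y. \<exists>g\<in>hom X p x. e \<cdot>\<^bsub>X\<^esub> g = f))"

definition is_simple :: "('o, 'm::ab_group_add, 'k, 'z) lincat_scheme \<Rightarrow> 'o \<Rightarrow> bool" where
  "is_simple X s \<longleftrightarrow> s \<in> obj X \<and> \<not> is_zero X s \<and>
     (\<forall>a\<in>obj X. \<forall>f. is_mono X a s f \<longrightarrow> is_zero X a \<or> is_iso X a s f)"

inductive finite_length :: "('o, 'm::ab_group_add, 'k, 'z) lincat_scheme \<Rightarrow> 'o \<Rightarrow> bool"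
  for X where
  zero: "is_zero X z \<Longrightarrow> finite_length X z"
| extension: "\<lbrakk>finite_length X a; b \<in> obj X; is_simple X c; short_exact X a b c f g\<rbrakk>
    \<Longrightarrow> finite_length X b"

text \<open>Finite direct sums of simple objects.\<close>

inductive semisimple_obj :: "('o, 'm::ab_group_add, 'k, 'z) lincat_scheme \<Rightarrow> 'o \<Rightarrow> bool"
  for X where
  zero: "is_zero X z \<Longrightarrow> semisimple_obj X z"
| sum: "\<lbrakk>semisimple_obj X a; is_simple X s; is_biproduct X a s b\<rbrakk> \<Longrightarrow> semisimple_obj X b"

definition semisimple_category :: "('o, 'm::ab_group_add, 'k, 'z) lincat_scheme \<Rightarrow> bool" where
  "semisimple_category X \<longleftrightarrow> (\<forall>x\<in>obj X. semisimple_obj X x)"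

locale finite_category = abelian_category X
  for X :: "('o, 'm::ab_group_add, 'k::field, 'z) lincat_scheme" (structure) +
  assumes hom_finite_dim:
      "x \<in> obj X \<Longrightarrow> y \<in> obj X \<Longrightarrow> \<exists>B. finite B \<and> hom X x y = module.span (scl X) B"
    and finite_length: "x \<in> obj X \<Longrightarrow> finite_length X x"
    and enough_projectives: "x \<in> obj X \<Longrightarrow> \<exists>p e. is_projective X p \<and> is_epi X p x e"
    and finitely_many_simples:
      "\<exists>T. finite T \<and> (\<forall>s. is_simple X s \<longrightarrow> (\<exists>t\<in>T. t \<in> obj X \<and> (\<exists>f. is_iso X s t f)))"

record ('o, 'm, 'p, 'n) fctr =
  fob :: "'o \<Rightarrow> 'p"
  far :: "'m \<Rightarrow> 'n"

definition linear_functor ::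
  "('o, 'm::ab_group_add, 'k::field, 'y) lincat_scheme \<Rightarrow>
   ('p, 'n::ab_group_add, 'k, 'z) lincat_scheme \<Rightarrow> ('o, 'm, 'p, 'n) fctr \<Rightarrow> bool" where
  "linear_functor X Y F \<longleftrightarrow>
     (\<forall>x\<in>obj X. fob F x \<in> obj Y \<and> far F (ide X x) = ide Y (fob F x)) \<and>
     (\<forall>x\<in>obj X. \<forall>y\<in>obj X. \<forall>f\<in>hom X x y. far F f \<in> hom Y (fob F x) (fob F y) \<and>
        (\<forall>z\<in>obj X. \<forall>g\<in>hom X y z. far F (g \<cdot>\<^bsub>X\<^esub> f) = far F g \<cdot>\<^bsub>Y\<^esub> far F f) \<and>
        (\<forall>f'\<in>hom X x y. far F (f + f') = far F f + far F f') \<and>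
        (\<forall>a. far F (scl X a f) = scl Y a (far F f)))"

definition exact_functor ::
  "('o, 'm::ab_group_add, 'k::field, 'y) lincat_scheme \<Rightarrow>
   ('p, 'n::ab_group_add, 'k, 'z) lincat_scheme \<Rightarrow> ('o, 'm, 'p, 'n) fctr \<Rightarrow> bool" where
  "exact_functor X Y F \<longleftrightarrow> linear_functor X Y F \<and>
     (\<forall>a\<in>obj X. \<forall>b\<in>obj X. \<forall>c\<in>obj X. \<forall>f g. short_exact X a b c f g \<longrightarrow>
        short_exact Y (fob F a) (fob F b) (fob F c) (far F f) (far F g))"

text \<open>\<open>functional X V \<psi>\<close> says that \<open>\<psi>\<close> represents an element of \<open>V\<^sup>*\<close>; its values outside of
  \<open>V\<close> are irrelevant.\<close>

definition functional ::
  "('o, 'm::ab_group_add, 'k::field, 'z) lincat_scheme \<Rightarrow> 'm set \<Rightarrow> ('m \<Rightarrow> 'k) \<Rightarrow> bool" where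
  "functional X V \<psi> \<longleftrightarrow>
     (\<forall>u\<in>V. \<forall>v\<in>V. \<psi> (u + v) = \<psi> u + \<psi> v) \<and> (\<forall>a. \<forall>v\<in>V. \<psi> (scl X a v) = a * \<psi> v)"

definition calabi_yau ::
  "('o, 'm::ab_group_add, 'k::field, 'z) lincat_scheme \<Rightarrow> ('o \<Rightarrow> 'm \<Rightarrow> 'k) \<Rightarrow> bool" where
  "calabi_yau X tr \<longleftrightarrow>
     (\<forall>x\<in>obj X. functional X (hom X x x) (tr x)) \<and>
     (\<forall>x\<in>obj X. \<forall>y\<in>obj X. \<forall>f\<in>hom X x y. \<forall>g\<in>hom X y x.
        tr y (f \<cdot>\<^bsub>X\<^esub> g) = tr x (g \<cdot>\<^bsub>X\<^esub> f)) \<and>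
     (\<forall>x\<in>obj X. \<forall>y\<in>obj X.
        (\<forall>f\<in>hom X x y. (\<forall>g\<in>hom X y x. tr x (g \<cdot>\<^bsub>X\<^esub> f) = 0) \<longrightarrow> f = 0) \<and>
        (\<forall>g\<in>hom X y x. (\<forall>f\<in>hom X x y. tr x (g \<cdot>\<^bsub>X\<^esub> f) = 0) \<longrightarrow> g = 0))"

section \<open>The Nakayama functor and the twisted trace\<close>

text \<open>
  The copower \<open>V \<otimes> x\<close> by a finite-dimensional space \<open>V\<close> represents \<open>z \<mapsto> Hom\<^sub>k(V, Hom(x, z))\<close>.
  Hence a dinatural family \<open>Hom(y, x)\<^sup>* \<otimes> x \<rightarrow> z\<close>, with \<open>x\<close> running over all objects, is the
  same as a family of linear maps \<open>j\<^sub>x : Hom(y, x)\<^sup>* \<rightarrow> Hom(x, z)\<close> with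
  \<open>j\<^sub>x'(\<psi>) \<cdot> f = j\<^sub>x(\<psi> \<circ> (f \<cdot> -))\<close> for \<open>f : x \<rightarrow> x'\<close>.
\<close>

definition dinatural_family ::
  "('o, 'm::ab_group_add, 'k::field, 'z) lincat_scheme \<Rightarrow> 'o \<Rightarrow> 'o \<Rightarrow>
   ('o \<Rightarrow> ('m \<Rightarrow> 'k) \<Rightarrow> 'm) \<Rightarrow> bool" where
  "dinatural_family X y z j \<longleftrightarrow>
     (\<forall>x\<in>obj X. \<forall>\<psi>. functional X (hom X y x) \<psi> \<longrightarrow> j x \<psi> \<in> hom X x z \<and>
        (\<forall>a. j x (\<lambda>v. a * \<psi> v) = scl X a (j x \<psi>)) \<and>
        (\<forall>\<psi>'. functional X (hom X y x) \<psi>' \<longrightarrow>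
           j x (\<lambda>v. \<psi> v + \<psi>' v) = j x \<psi> + j x \<psi>' \<and>
           ((\<forall>v\<in>hom X y x. \<psi> v = \<psi>' v) \<longrightarrow> j x \<psi> = j x \<psi>'))) \<and>
     (\<forall>x\<in>obj X. \<forall>x'\<in>obj X. \<forall>f\<in>hom X x x'. \<forall>\<psi>. functional X (hom X y x') \<psi> \<longrightarrow>
        j x' \<psi> \<cdot>\<^bsub>X\<^esub> f = j x (\<lambda>v. \<psi> (f \<cdot>\<^bsub>X\<^esub> v)))"

text \<open>A Nakayama functor is an endofunctor \<open>nfn N\<close> together with the structure morphisms
  \<open>nin N y x\<close> that exhibit its value at \<open>y\<close> as the coend of \<open>Hom(y, x)\<^sup>* \<otimes> x\<close>.\<close>

record ('o, 'm, 'k) nak =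
  nfn :: "('o, 'm, 'o, 'm) fctr"
  nin :: "'o \<Rightarrow> 'o \<Rightarrow> ('m \<Rightarrow> 'k) \<Rightarrow> 'm"

definition nakayama ::
  "('o, 'm::ab_group_add, 'k::field, 'z) lincat_scheme \<Rightarrow> ('o, 'm, 'k) nak \<Rightarrow> bool" where
  "nakayama X N \<longleftrightarrow> linear_functor X X (nfn N) \<and>
     (\<forall>y\<in>obj X. dinatural_family X y (fob (nfn N) y) (nin N y) \<and>
        (\<forall>z\<in>obj X. \<forall>j. dinatural_family X y z j \<longrightarrow>
           (\<exists>!h. h \<in> hom X (fob (nfn N) y) z \<and>
              (\<forall>x\<in>obj X. \<forall>\<psi>. functional X (hom X y x) \<psi> \<longrightarrow> h \<cdot>\<^bsub>X\<^esub> nin N y x \<psi> = j x \<psi>)))) \<and>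
     (\<forall>y\<in>obj X. \<forall>y'\<in>obj X. \<forall>f\<in>hom X y y'. \<forall>x\<in>obj X. \<forall>\<psi>. functional X (hom X y x) \<psi> \<longrightarrow>
        far (nfn N) f \<cdot>\<^bsub>X\<^esub> nin N y x \<psi> = nin N y' x (\<lambda>v. \<psi> (v \<cdot>\<^bsub>X\<^esub> f)))"

text \<open>For projective \<open>p\<close> the structure map \<open>\<iota> = nin N p x : Hom(p, x)\<^sup>* \<rightarrow> Hom(x, N p)\<close> is bijective;
  its transpose inverse is the canonical isomorphism \<open>n : Hom(p, x) \<rightarrow> Hom(x, N p)\<^sup>*\<close>, that is
  \<open>n(f)(\<iota>(\<psi>)) = \<psi>(f)\<close>.\<close>

definition nak_pairing ::
  "('o, 'm::ab_group_add, 'k::field, 'z) lincat_scheme \<Rightarrow> ('o, 'm, 'k) nak \<Rightarrow>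
   'o \<Rightarrow> 'o \<Rightarrow> 'm \<Rightarrow> 'm \<Rightarrow> 'k" where
  "nak_pairing X N p x f g = (THE a. \<exists>\<psi>. functional X (hom X p x) \<psi> \<and> nin N p x \<psi> = g \<and> a = \<psi> f)"

definition twisted_trace ::
  "('o, 'm::ab_group_add, 'k::field, 'z) lincat_scheme \<Rightarrow> ('o, 'm, 'k) nak \<Rightarrow> 'o \<Rightarrow> 'm \<Rightarrow> 'k" where
  "twisted_trace X N p g = nak_pairing X N p p (ide X p) g"

text \<open>
  The canonical isomorphism \<open>N\<^sub>Y(F y) \<rightarrow> H(N\<^sub>X y)\<close> for adjunctions \<open>F \<stileturn> G \<stileturn> H\<close>, given the counit
  \<open>\<epsilon>\<close> of \<open>F \<stileturn> G\<close> and the unit \<open>\<eta>\<close> of \<open>G \<stileturn> H\<close> (so \<open>H\<close> is the double right adjoint of \<open>F\<close>;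
  only the object map of \<open>G\<close> is needed).
  It is the composite of
  \<open>\<integral>\<^sup>z Hom(F y, z)\<^sup>* \<otimes> z \<cong> \<integral>\<^sup>z Hom(y, G z)\<^sup>* \<otimes> z \<cong> \<integral>\<^sup>x Hom(y, x)\<^sup>* \<otimes> H x \<cong> H(\<integral>\<^sup>x Hom(y, x)\<^sup>* \<otimes> x)\<close>,
  described by its restriction to the components of the first coend.
\<close>

definition nak_rra ::
  "('o, 'm::ab_group_add, 'k::field, 'y) lincat_scheme \<Rightarrow> ('o, 'm, 'k) nak \<Rightarrow>
   ('p, 'n::ab_group_add, 'k, 'z) lincat_scheme \<Rightarrow> ('p, 'n, 'k) nak \<Rightarrow>
   ('o, 'm, 'p, 'n) fctr \<Rightarrow> ('p \<Rightarrow> 'o) \<Rightarrow> ('o, 'm, 'p, 'n) fctr \<Rightarrow>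
   ('p \<Rightarrow> 'n) \<Rightarrow> ('p \<Rightarrow> 'n) \<Rightarrow> 'o \<Rightarrow> 'n" where
  "nak_rra X NX Y NY F G H \<epsilon> \<eta> y =
     (THE l. l \<in> hom Y (fob (nfn NY) (fob F y)) (fob H (fob (nfn NX) y)) \<and>
        (\<forall>z\<in>obj Y. \<forall>\<psi>. functional Y (hom Y (fob F y) z) \<psi> \<longrightarrow>
           l \<cdot>\<^bsub>Y\<^esub> nin NY (fob F y) z \<psi> =
             far H (nin NX y (G z) (\<lambda>g. \<psi> (\<epsilon> z \<cdot>\<^bsub>Y\<^esub> far F g))) \<cdot>\<^bsub>Y\<^esub> \<eta> z))"

section \<open>Fusion categories\<close>

text \<open>
  Fields: \<open>asc a b c : (a \<otimes> b) \<otimes> c \<rightarrow> a \<otimes> (b \<otimes> c)\<close>, \<open>lun a : 1 \<otimes> a \<rightarrow> a\<close>, \<open>run a : a \<otimes> 1 \<rightarrow> a\<close>;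
  the tensor product of morphisms is written \<open>\<boxtimes>\<close>.
  Right dual \<open>rd a\<close>: \<open>rdev a : rd a \<otimes> a \<rightarrow> 1\<close> and \<open>rdco a : 1 \<rightarrow> a \<otimes> rd a\<close>.
  Left dual \<open>ld a\<close>: \<open>ldev a : a \<otimes> ld a \<rightarrow> 1\<close> and \<open>ldco a : 1 \<rightarrow> ld a \<otimes> a\<close>.
\<close>

record ('o, 'm, 'k) moncat = "('o, 'm, 'k) lincat" +
  one :: "'o"
  tob :: "'o \<Rightarrow> 'o \<Rightarrow> 'o"  (infixr "\<otimes>\<index>" 75)
  tar :: "'m \<Rightarrow> 'm \<Rightarrow> 'm"  (infixr "\<boxtimes>\<index>" 75)
  asc :: "'o \<Rightarrow> 'o \<Rightarrow> 'o \<Rightarrow> 'm"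
  lun :: "'o \<Rightarrow> 'm"
  run :: "'o \<Rightarrow> 'm"

record ('o, 'm, 'k) rigcat = "('o, 'm, 'k) moncat" +
  rd :: "'o \<Rightarrow> 'o"
  rdev :: "'o \<Rightarrow> 'm"
  rdco :: "'o \<Rightarrow> 'm"
  ld :: "'o \<Rightarrow> 'o"
  ldev :: "'o \<Rightarrow> 'm"
  ldco :: "'o \<Rightarrow> 'm"

locale monoidal_category = linear_category C
  for C :: "('o, 'm::ab_group_add, 'k::field, 'z) moncat_scheme" (structure) +
  assumes one_obj: "one C \<in> obj C"
    and tob_obj: "\<lbrakk>a \<in> obj C; b \<in> obj C\<rbrakk> \<Longrightarrow> a \<otimes> b \<in> obj C"
    and tar_in_hom:
      "\<lbrakk>a \<in> obj C; a' \<in> obj C; b \<in> obj C; b' \<in> obj C; f \<in> hom C a a'; g \<in> hom C b b'\<rbrakk>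
        \<Longrightarrow> f \<boxtimes> g \<in> hom C (a \<otimes> b) (a' \<otimes> b')"
    and tar_ide: "\<lbrakk>a \<in> obj C; b \<in> obj C\<rbrakk> \<Longrightarrow> ide C a \<boxtimes> ide C b = ide C (a \<otimes> b)"
    and interchange:
      "\<lbrakk>a \<in> obj C; a' \<in> obj C; a'' \<in> obj C; b \<in> obj C; b' \<in> obj C; b'' \<in> obj C;
        f \<in> hom C a a'; f' \<in> hom C a' a''; g \<in> hom C b b'; g' \<in> hom C b' b''\<rbrakk>
        \<Longrightarrow> (f' \<cdot> f) \<boxtimes> (g' \<cdot> g) = (f' \<boxtimes> g') \<cdot> (f \<boxtimes> g)"
    and tar_add_left:
      "\<lbrakk>a \<in> obj C; a' \<in> obj C; b \<in> obj C; b' \<in> obj C;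
        f \<in> hom C a a'; f' \<in> hom C a a'; g \<in> hom C b b'\<rbrakk>
        \<Longrightarrow> (f + f') \<boxtimes> g = f \<boxtimes> g + f' \<boxtimes> g"
    and tar_add_right:
      "\<lbrakk>a \<in> obj C; a' \<in> obj C; b \<in> obj C; b' \<in> obj C;
        f \<in> hom C a a'; g \<in> hom C b b'; g' \<in> hom C b b'\<rbrakk>
        \<Longrightarrow> f \<boxtimes> (g + g') = f \<boxtimes> g + f \<boxtimes> g'"
    and tar_scl_left:
      "\<lbrakk>a \<in> obj C; a' \<in> obj C; b \<in> obj C; b' \<in> obj C; f \<in> hom C a a'; g \<in> hom C b b'\<rbrakk>
        \<Longrightarrow> scl C s f \<boxtimes> g = scl C s (f \<boxtimes> g)"
    and tar_scl_right:
      "\<lbrakk>a \<in> obj C; a' \<in> obj C; b \<in> obj C; b' \<in> obj C; f \<in> hom C a a'; g \<in> hom C b b'\<rbrakk>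
        \<Longrightarrow> f \<boxtimes> scl C s g = scl C s (f \<boxtimes> g)"
    and asc_iso:
      "\<lbrakk>a \<in> obj C; b \<in> obj C; c \<in> obj C\<rbrakk>
        \<Longrightarrow> is_iso C ((a \<otimes> b) \<otimes> c) (a \<otimes> (b \<otimes> c)) (asc C a b c)"
    and lun_iso: "a \<in> obj C \<Longrightarrow> is_iso C (one C \<otimes> a) a (lun C a)"
    and run_iso: "a \<in> obj C \<Longrightarrow> is_iso C (a \<otimes> one C) a (run C a)"
    and asc_natural:
      "\<lbrakk>a \<in> obj C; a' \<in> obj C; b \<in> obj C; b' \<in> obj C; c \<in> obj C; c' \<in> obj C;
        f \<in> hom C a a'; g \<in> hom C b b'; h \<in> hom C c c'\<rbrakk>
        \<Longrightarrow> asc C a' b' c' \<cdot> ((f \<boxtimes> g) \<boxtimes> h) = (f \<boxtimes> (g \<boxtimes> h)) \<cdot> asc C a b c"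
    and lun_natural:
      "\<lbrakk>a \<in> obj C; a' \<in> obj C; f \<in> hom C a a'\<rbrakk>
        \<Longrightarrow> lun C a' \<cdot> (ide C (one C) \<boxtimes> f) = f \<cdot> lun C a"
    and run_natural:
      "\<lbrakk>a \<in> obj C; a' \<in> obj C; f \<in> hom C a a'\<rbrakk>
        \<Longrightarrow> run C a' \<cdot> (f \<boxtimes> ide C (one C)) = f \<cdot> run C a"
    and pentagon:
      "\<lbrakk>a \<in> obj C; b \<in> obj C; c \<in> obj C; d \<in> obj C\<rbrakk>
        \<Longrightarrow> (ide C a \<boxtimes> asc C b c d) \<cdot> asc C a (b \<otimes> c) d \<cdot> (asc C a b c \<boxtimes> ide C d)
          = asc C a b (c \<otimes> d) \<cdot> asc C (a \<otimes> b) c d"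
    and triangle:
      "\<lbrakk>a \<in> obj C; b \<in> obj C\<rbrakk>
        \<Longrightarrow> (ide C a \<boxtimes> lun C b) \<cdot> asc C a (one C) b = run C a \<boxtimes> ide C b"

definition iasc :: "('o, 'm, 'k, 'z) moncat_scheme \<Rightarrow> 'o \<Rightarrow> 'o \<Rightarrow> 'o \<Rightarrow> 'm" where
  "iasc C a b c = inv_arr C ((a \<otimes>\<^bsub>C\<^esub> b) \<otimes>\<^bsub>C\<^esub> c) (a \<otimes>\<^bsub>C\<^esub> (b \<otimes>\<^bsub>C\<^esub> c)) (asc C a b c)"

definition ilun :: "('o, 'm, 'k, 'z) moncat_scheme \<Rightarrow> 'o \<Rightarrow> 'm" where
  "ilun C a = inv_arr C (one C \<otimes>\<^bsub>C\<^esub> a) a (lun C a)"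

definition irun :: "('o, 'm, 'k, 'z) moncat_scheme \<Rightarrow> 'o \<Rightarrow> 'm" where
  "irun C a = inv_arr C (a \<otimes>\<^bsub>C\<^esub> one C) a (run C a)"

text \<open>\<open>is_duality C a b e d\<close>: the morphisms \<open>e : b \<otimes> a \<rightarrow> 1\<close> and \<open>d : 1 \<rightarrow> a \<otimes> b\<close> exhibit \<open>b\<close> as a
  right dual of \<open>a\<close>, equivalently \<open>a\<close> as a left dual of \<open>b\<close>.\<close>

definition is_duality ::
  "('o, 'm, 'k, 'z) moncat_scheme \<Rightarrow> 'o \<Rightarrow> 'o \<Rightarrow> 'm \<Rightarrow> 'm \<Rightarrow> bool" where
  "is_duality C a b e d \<longleftrightarrow> a \<in> obj C \<and> b \<in> obj C \<and>
     e \<in> hom C (b \<otimes>\<^bsub>C\<^esub> a) (one C) \<and> d \<in> hom C (one C) (a \<otimes>\<^bsub>C\<^esub> b) \<and>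
     run C a \<cdot>\<^bsub>C\<^esub> (ide C a \<boxtimes>\<^bsub>C\<^esub> e) \<cdot>\<^bsub>C\<^esub> asc C a b a \<cdot>\<^bsub>C\<^esub> (d \<boxtimes>\<^bsub>C\<^esub> ide C a) = lun C a \<and>
     lun C b \<cdot>\<^bsub>C\<^esub> (e \<boxtimes>\<^bsub>C\<^esub> ide C b) \<cdot>\<^bsub>C\<^esub> iasc C b a b \<cdot>\<^bsub>C\<^esub> (ide C b \<boxtimes>\<^bsub>C\<^esub> d) = run C b"

locale fusion_category = monoidal_category C + finite_category C
  for C :: "('o, 'm::ab_group_add, 'k::field, 'z) rigcat_scheme" (structure) +
  assumes right_dual: "a \<in> obj C \<Longrightarrow> is_duality C a (rd C a) (rdev C a) (rdco C a)"
    and left_dual: "a \<in> obj C \<Longrightarrow> is_duality C (ld C a) a (ldev C a) (ldco C a)"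
    and semisimple: "semisimple_category C"
    and simple_one: "is_simple C (one C)"

text \<open>The same category with reversed tensor product; left and right duals are exchanged.\<close>

definition reverse :: "('o, 'm, 'k, 'z) rigcat_scheme \<Rightarrow> ('o, 'm, 'k, 'z) rigcat_scheme" where
  "reverse C = C\<lparr>
     tob := (\<lambda>a b. b \<otimes>\<^bsub>C\<^esub> a), tar := (\<lambda>f g. g \<boxtimes>\<^bsub>C\<^esub> f), asc := (\<lambda>a b c. iasc C c b a),
     lun := run C, run := lun C,
     rd := ld C, rdev := ldev C, rdco := ldco C, ld := rd C, ldev := rdev C, ldco := rdco C\<rparr>"

subsection \<open>Duals and pivotal structures\<close>

text \<open>The morphism \<open>w \<rightarrow> a\<^sup>\<or>\<close> corresponding to a pairing \<open>w \<otimes> a \<rightarrow> 1\<close>.\<close>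

definition to_dual :: "('o, 'm, 'k, 'z) rigcat_scheme \<Rightarrow> 'o \<Rightarrow> 'o \<Rightarrow> 'm \<Rightarrow> 'm" where
  "to_dual C w a e =
     (THE g. g \<in> hom C w (rd C a) \<and> rdev C a \<cdot>\<^bsub>C\<^esub> (g \<boxtimes>\<^bsub>C\<^esub> ide C a) = e)"

text \<open>The dual \<open>b\<^sup>\<or> \<rightarrow> a\<^sup>\<or>\<close> of \<open>f : a \<rightarrow> b\<close>.\<close>

definition dual_arr :: "('o, 'm, 'k, 'z) rigcat_scheme \<Rightarrow> 'o \<Rightarrow> 'o \<Rightarrow> 'm \<Rightarrow> 'm" where
  "dual_arr C a b f =
     to_dual C (rd C b) a (rdev C b \<cdot>\<^bsub>C\<^esub> (ide C (rd C b) \<boxtimes>\<^bsub>C\<^esub> f))"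

definition ddual_arr :: "('o, 'm, 'k, 'z) rigcat_scheme \<Rightarrow> 'o \<Rightarrow> 'o \<Rightarrow> 'm \<Rightarrow> 'm" where
  "ddual_arr C a b f = dual_arr C (rd C b) (rd C a) (dual_arr C a b f)"

text \<open>\<open>b\<^sup>\<or> \<otimes> a\<^sup>\<or> \<rightarrow> (a \<otimes> b)\<^sup>\<or>\<close>\<close>

definition dual_tensor :: "('o, 'm, 'k, 'z) rigcat_scheme \<Rightarrow> 'o \<Rightarrow> 'o \<Rightarrow> 'm" where
  "dual_tensor C a b =
     to_dual C (rd C b \<otimes>\<^bsub>C\<^esub> rd C a) (a \<otimes>\<^bsub>C\<^esub> b)
       (rdev C b \<cdot>\<^bsub>C\<^esub>
        (ide C (rd C b) \<boxtimes>\<^bsub>C\<^esub>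
          (lun C b \<cdot>\<^bsub>C\<^esub> (rdev C a \<boxtimes>\<^bsub>C\<^esub> ide C b) \<cdot>\<^bsub>C\<^esub> iasc C (rd C a) a b)) \<cdot>\<^bsub>C\<^esub>
        asc C (rd C b) (rd C a) (a \<otimes>\<^bsub>C\<^esub> b))"

definition idual_tensor :: "('o, 'm, 'k, 'z) rigcat_scheme \<Rightarrow> 'o \<Rightarrow> 'o \<Rightarrow> 'm" where
  "idual_tensor C a b =
     inv_arr C (rd C b \<otimes>\<^bsub>C\<^esub> rd C a) (rd C (a \<otimes>\<^bsub>C\<^esub> b)) (dual_tensor C a b)"

text \<open>\<open>1 \<rightarrow> 1\<^sup>\<or>\<close>\<close>

definition dual_one :: "('o, 'm, 'k, 'z) rigcat_scheme \<Rightarrow> 'm" where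
  "dual_one C = to_dual C (one C) (one C) (lun C (one C))"

text \<open>
  Monoidal natural isomorphisms \<open>p : id \<Rightarrow> (-)\<^sup>\<or>\<^sup>\<or>\<close>. The monoidal structure of \<open>(-)\<^sup>\<or>\<^sup>\<or>\<close> is the composite
  \<open>a\<^sup>\<or>\<^sup>\<or> \<otimes> b\<^sup>\<or>\<^sup>\<or> \<rightarrow> (b\<^sup>\<or> \<otimes> a\<^sup>\<or>)\<^sup>\<or> \<rightarrow> (a \<otimes> b)\<^sup>\<or>\<^sup>\<or>\<close> of \<open>dual_tensor\<close> with the inverse of the dual of
  \<open>dual_tensor\<close>.
\<close>

definition pivotal_structure ::
  "('o, 'm, 'k, 'z) rigcat_scheme \<Rightarrow> ('o \<Rightarrow> 'm) \<Rightarrow> bool" where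
  "pivotal_structure C p \<longleftrightarrow>
     (\<forall>a\<in>obj C. is_iso C a (rd C (rd C a)) (p a)) \<and>
     (\<forall>a\<in>obj C. \<forall>b\<in>obj C. \<forall>f\<in>hom C a b. ddual_arr C a b f \<cdot>\<^bsub>C\<^esub> p a = p b \<cdot>\<^bsub>C\<^esub> f) \<and>
     (\<forall>a\<in>obj C. \<forall>b\<in>obj C.
        dual_arr C (rd C b \<otimes>\<^bsub>C\<^esub> rd C a) (rd C (a \<otimes>\<^bsub>C\<^esub> b)) (dual_tensor C a b) \<cdot>\<^bsub>C\<^esub> p (a \<otimes>\<^bsub>C\<^esub> b)
          = dual_tensor C (rd C b) (rd C a) \<cdot>\<^bsub>C\<^esub> (p a \<boxtimes>\<^bsub>C\<^esub> p b)) \<and>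
     dual_arr C (one C) (rd C (one C)) (dual_one C) \<cdot>\<^bsub>C\<^esub> p (one C) = dual_one C"

definition pivotal_fusion ::
  "('o, 'm::ab_group_add, 'k::field, 'z) rigcat_scheme \<Rightarrow> ('o \<Rightarrow> 'm) \<Rightarrow> bool" where
  "pivotal_fusion C p \<longleftrightarrow> fusion_category C \<and> pivotal_structure C p"

text \<open>The canonical isomorphisms \<open>a \<rightarrow> (\<^sup>\<or>a)\<^sup>\<or>\<close> and \<open>a \<rightarrow> (\<^sup>\<or>\<^sup>\<or>a)\<^sup>\<or>\<^sup>\<or>\<close>.\<close>

definition ld_rd :: "('o, 'm, 'k, 'z) rigcat_scheme \<Rightarrow> 'o \<Rightarrow> 'm" where
  "ld_rd C a = to_dual C a (ld C a) (ldev C a)"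

definition ldd_rdd :: "('o, 'm, 'k, 'z) rigcat_scheme \<Rightarrow> 'o \<Rightarrow> 'm" where
  "ldd_rdd C a =
     inv_arr C (rd C (rd C (ld C (ld C a)))) (rd C (ld C a))
       (dual_arr C (ld C a) (rd C (ld C (ld C a))) (ld_rd C (ld C a))) \<cdot>\<^bsub>C\<^esub> ld_rd C a"

text \<open>The isomorphism \<open>a \<rightarrow> \<^sup>\<or>\<^sup>\<or>a\<close> induced by a pivotal structure; it is the induced pivotal structure
  of \<open>reverse C\<close>.\<close>

definition left_pivotal :: "('o, 'm, 'k, 'z) rigcat_scheme \<Rightarrow> ('o \<Rightarrow> 'm) \<Rightarrow> 'o \<Rightarrow> 'm" where
  "left_pivotal C p a =
     inv_arr C (ld C (ld C a)) (rd C (rd C (ld C (ld C a)))) (p (ld C (ld C a))) \<cdot>\<^bsub>C\<^esub> ldd_rdd C a"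

subsection \<open>The distinguished object and spherical fusion categories\<close>

text \<open>\<open>\<D>\<^sup>-\<^sup>1 = N(1)\<close>\<close>

definition dist_obj ::
  "('o, 'm, 'k, 'z) moncat_scheme \<Rightarrow> ('o, 'm, 'k) nak \<Rightarrow> 'o" where
  "dist_obj C N = fob (nfn N) (one C)"

definition std_triv ::
  "('o, 'm::ab_group_add, 'k::field, 'z) moncat_scheme \<Rightarrow> ('o, 'm, 'k) nak \<Rightarrow> 'm" where
  "std_triv C N = (THE s. is_iso C (one C) (dist_obj C N) s \<and> twisted_trace C N (one C) s = 1)"

definition istd_triv ::
  "('o, 'm::ab_group_add, 'k::field, 'z) moncat_scheme \<Rightarrow> ('o, 'm, 'k) nak \<Rightarrow> 'm" where
  "istd_triv C N = inv_arr C (one C) (dist_obj C N) (std_triv C N)"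

definition left_tensor ::
  "('o, 'm, 'k, 'z) moncat_scheme \<Rightarrow> 'o \<Rightarrow> ('o, 'm, 'o, 'm) fctr" where
  "left_tensor C a = \<lparr>fob = (\<lambda>x. a \<otimes>\<^bsub>C\<^esub> x), far = (\<lambda>f. ide C a \<boxtimes>\<^bsub>C\<^esub> f)\<rparr>"

text \<open>
  The isomorphism \<open>N(c) \<cong> N(c \<otimes> 1) \<rightarrow> \<^sup>\<or>\<^sup>\<or>c \<otimes> \<D>\<^sup>-\<^sup>1\<close>, from the adjunctions
  \<open>(c \<otimes> -) \<stileturn> (\<^sup>\<or>c \<otimes> -) \<stileturn> (\<^sup>\<or>\<^sup>\<or>c \<otimes> -)\<close>. For \<open>reverse C\<close> in place of \<open>C\<close> this is
  \<open>N(c) \<cong> N(1 \<otimes> c) \<rightarrow> \<D>\<^sup>-\<^sup>1 \<otimes> c\<^sup>\<or>\<^sup>\<or>\<close>.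
\<close>

definition nak_left ::
  "('o, 'm::ab_group_add, 'k::field, 'z) rigcat_scheme \<Rightarrow> ('o, 'm, 'k) nak \<Rightarrow> 'o \<Rightarrow> 'm" where
  "nak_left C N c =
     nak_rra C N C N (left_tensor C c) (\<lambda>x. ld C c \<otimes>\<^bsub>C\<^esub> x) (left_tensor C (ld C (ld C c)))
       (\<lambda>z. lun C z \<cdot>\<^bsub>C\<^esub> (ldev C c \<boxtimes>\<^bsub>C\<^esub> ide C z) \<cdot>\<^bsub>C\<^esub> iasc C c (ld C c) z)
       (\<lambda>z. asc C (ld C (ld C c)) (ld C c) z \<cdot>\<^bsub>C\<^esub> (ldco C (ld C c) \<boxtimes>\<^bsub>C\<^esub> ide C z) \<cdot>\<^bsub>C\<^esub> ilun C z)
       (one C)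
     \<cdot>\<^bsub>C\<^esub> far (nfn N) (irun C c)"

text \<open>\<open>\<^sup>\<or>\<^sup>\<or>c \<cong> \<^sup>\<or>\<^sup>\<or>c \<otimes> \<D>\<^sup>-\<^sup>1 \<cong> N(c) \<cong> \<D>\<^sup>-\<^sup>1 \<otimes> c\<^sup>\<or>\<^sup>\<or> \<cong> c\<^sup>\<or>\<^sup>\<or>\<close>; this does not depend on the
  normalisation of the trivialisation of \<open>\<D>\<^sup>-\<^sup>1\<close>.\<close>

definition fusion_radford_dual ::
  "('o, 'm::ab_group_add, 'k::field, 'z) rigcat_scheme \<Rightarrow> ('o, 'm, 'k) nak \<Rightarrow> 'o \<Rightarrow> 'm" where
  "fusion_radford_dual C N c =
     (let l = ld C (ld C c); r = rd C (rd C c); d = dist_obj C N in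
       lun C r \<cdot>\<^bsub>C\<^esub> (istd_triv C N \<boxtimes>\<^bsub>C\<^esub> ide C r) \<cdot>\<^bsub>C\<^esub> nak_left (reverse C) N c \<cdot>\<^bsub>C\<^esub>
       inv_arr C (fob (nfn N) c) (l \<otimes>\<^bsub>C\<^esub> d) (nak_left C N c) \<cdot>\<^bsub>C\<^esub>
       (ide C l \<boxtimes>\<^bsub>C\<^esub> std_triv C N) \<cdot>\<^bsub>C\<^esub> irun C l)"

text \<open>\<open>c \<cong> (\<^sup>\<or>\<^sup>\<or>c)\<^sup>\<or>\<^sup>\<or> \<rightarrow> (c\<^sup>\<or>\<^sup>\<or>)\<^sup>\<or>\<^sup>\<or>\<close>\<close>

definition fusion_radford ::
  "('o, 'm::ab_group_add, 'k::field, 'z) rigcat_scheme \<Rightarrow> ('o, 'm, 'k) nak \<Rightarrow> 'o \<Rightarrow> 'm" where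
  "fusion_radford C N c =
     ddual_arr C (ld C (ld C c)) (rd C (rd C c)) (fusion_radford_dual C N c) \<cdot>\<^bsub>C\<^esub> ldd_rdd C c"

definition spherical_fusion ::
  "('o, 'm::ab_group_add, 'k::field, 'z) rigcat_scheme \<Rightarrow> ('o, 'm, 'k) nak \<Rightarrow> ('o \<Rightarrow> 'm) \<Rightarrow> bool" where
  "spherical_fusion C N p \<longleftrightarrow> pivotal_fusion C p \<and>
     (\<forall>a\<in>obj C. ddual_arr C a (rd C (rd C a)) (p a) \<cdot>\<^bsub>C\<^esub> p a = fusion_radford C N a)"

section \<open>Module and bimodule categories\<close>

text \<open>\<open>masc a b x : (a \<otimes> b) \<triangleright> x \<rightarrow> a \<triangleright> (b \<triangleright> x)\<close>, \<open>mun x : 1 \<triangleright> x \<rightarrow> x\<close>; the action on morphisms is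
  written \<open>\<unrhd>\<close>.\<close>

record ('o, 'm, 'p, 'n) action =
  aob :: "'o \<Rightarrow> 'p \<Rightarrow> 'p"  (infixr "\<triangleright>\<index>" 75)
  aar :: "'m \<Rightarrow> 'n \<Rightarrow> 'n"  (infixr "\<unrhd>\<index>" 75)
  masc :: "'o \<Rightarrow> 'o \<Rightarrow> 'p \<Rightarrow> 'n"
  mun :: "'p \<Rightarrow> 'n"

definition act_by :: "('p, 'n, 'k, 'y) lincat_scheme \<Rightarrow> ('o, 'm, 'k, 'x) lincat_scheme \<Rightarrow>
    ('o, 'm, 'p, 'n, 'z) action_scheme \<Rightarrow> 'o \<Rightarrow> ('p, 'n, 'p, 'n) fctr" where
  "act_by L C A c = \<lparr>fob = (\<lambda>x. c \<triangleright>\<^bsub>A\<^esub> x), far = (\<lambda>f. ide C c \<unrhd>\<^bsub>A\<^esub> f)\<rparr>"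

definition act_on :: "('p, 'n, 'k, 'y) lincat_scheme \<Rightarrow>
    ('o, 'm, 'p, 'n, 'z) action_scheme \<Rightarrow> 'p \<Rightarrow> ('o, 'm, 'p, 'n) fctr" where
  "act_on L A x = \<lparr>fob = (\<lambda>c. c \<triangleright>\<^bsub>A\<^esub> x), far = (\<lambda>f. f \<unrhd>\<^bsub>A\<^esub> ide L x)\<rparr>"

locale module_category = C: monoidal_category C + L: finite_category L
  for C :: "('o, 'm::ab_group_add, 'k::field, 'x) moncat_scheme"
    and L :: "('p, 'n::ab_group_add, 'k, 'y) lincat_scheme" +
  fixes A :: "('o, 'm, 'p, 'n, 'z) action_scheme" (structure)
  assumes act_by_exact: "c \<in> obj C \<Longrightarrow> exact_functor L L (act_by L C A c)"
    and act_on_exact: "x \<in> obj L \<Longrightarrow> exact_functor C L (act_on L A x)"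
    and action_interchange:
      "\<lbrakk>c \<in> obj C; c' \<in> obj C; c'' \<in> obj C; x \<in> obj L; x' \<in> obj L; x'' \<in> obj L;
        f \<in> hom C c c'; f' \<in> hom C c' c''; h \<in> hom L x x'; h' \<in> hom L x' x''\<rbrakk>
        \<Longrightarrow> (f' \<cdot>\<^bsub>C\<^esub> f) \<unrhd> (h' \<cdot>\<^bsub>L\<^esub> h) = (f' \<unrhd> h') \<cdot>\<^bsub>L\<^esub> (f \<unrhd> h)"
    and action_in_hom:
      "\<lbrakk>c \<in> obj C; c' \<in> obj C; x \<in> obj L; x' \<in> obj L; f \<in> hom C c c'; h \<in> hom L x x'\<rbrakk>
        \<Longrightarrow> f \<unrhd> h \<in> hom L (c \<triangleright> x) (c' \<triangleright> x')"
    and masc_iso: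
      "\<lbrakk>a \<in> obj C; b \<in> obj C; x \<in> obj L\<rbrakk>
        \<Longrightarrow> is_iso L ((a \<otimes>\<^bsub>C\<^esub> b) \<triangleright> x) (a \<triangleright> (b \<triangleright> x)) (masc A a b x)"
    and mun_iso: "x \<in> obj L \<Longrightarrow> is_iso L (one C \<triangleright> x) x (mun A x)"
    and masc_natural:
      "\<lbrakk>a \<in> obj C; a' \<in> obj C; b \<in> obj C; b' \<in> obj C; x \<in> obj L; x' \<in> obj L;
        f \<in> hom C a a'; g \<in> hom C b b'; h \<in> hom L x x'\<rbrakk>
        \<Longrightarrow> masc A a' b' x' \<cdot>\<^bsub>L\<^esub> ((f \<boxtimes>\<^bsub>C\<^esub> g) \<unrhd> h) = (f \<unrhd> (g \<unrhd> h)) \<cdot>\<^bsub>L\<^esub> masc A a b x"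
    and mun_natural:
      "\<lbrakk>x \<in> obj L; x' \<in> obj L; h \<in> hom L x x'\<rbrakk>
        \<Longrightarrow> mun A x' \<cdot>\<^bsub>L\<^esub> (ide C (one C) \<unrhd> h) = h \<cdot>\<^bsub>L\<^esub> mun A x"
    and action_pentagon:
      "\<lbrakk>a \<in> obj C; b \<in> obj C; c \<in> obj C; x \<in> obj L\<rbrakk>
        \<Longrightarrow> (ide C a \<unrhd> masc A b c x) \<cdot>\<^bsub>L\<^esub> masc A a (b \<otimes>\<^bsub>C\<^esub> c) x \<cdot>\<^bsub>L\<^esub> (asc C a b c \<unrhd> ide L x)
          = masc A a b (c \<triangleright> x) \<cdot>\<^bsub>L\<^esub> masc A (a \<otimes>\<^bsub>C\<^esub> b) c x"
    and action_triangle: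
      "\<lbrakk>a \<in> obj C; x \<in> obj L\<rbrakk>
        \<Longrightarrow> (ide C a \<unrhd> mun A x) \<cdot>\<^bsub>L\<^esub> masc A a (one C) x = run C a \<unrhd> ide L x"

definition imasc :: "('o, 'm, 'k, 'x) moncat_scheme \<Rightarrow> ('p, 'n, 'k, 'y) lincat_scheme \<Rightarrow>
    ('o, 'm, 'p, 'n, 'z) action_scheme \<Rightarrow> 'o \<Rightarrow> 'o \<Rightarrow> 'p \<Rightarrow> 'n" where
  "imasc C L A a b x =
     inv_arr L ((a \<otimes>\<^bsub>C\<^esub> b) \<triangleright>\<^bsub>A\<^esub> x) (a \<triangleright>\<^bsub>A\<^esub> (b \<triangleright>\<^bsub>A\<^esub> x)) (masc A a b x)"

definition imun :: "('o, 'm, 'k, 'x) moncat_scheme \<Rightarrow> ('p, 'n, 'k, 'y) lincat_scheme \<Rightarrow>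
    ('o, 'm, 'p, 'n, 'z) action_scheme \<Rightarrow> 'p \<Rightarrow> 'n" where
  "imun C L A x = inv_arr L (one C \<triangleright>\<^bsub>A\<^esub> x) x (mun A x)"

definition exact_module ::
  "('o, 'm::ab_group_add, 'k::field, 'x) moncat_scheme \<Rightarrow>
   ('p, 'n::ab_group_add, 'k, 'y) lincat_scheme \<Rightarrow> ('o, 'm, 'p, 'n, 'z) action_scheme \<Rightarrow> bool" where
  "exact_module C L A \<longleftrightarrow> module_category C L A \<and>
     (\<forall>c x. is_projective C c \<and> x \<in> obj L \<longrightarrow> is_projective L (c \<triangleright>\<^bsub>A\<^esub> x))"

text \<open>
  A right action of \<open>D\<close> is a left action \<open>B\<close> of \<open>reverse D\<close>: the object \<open>x \<triangleleft> d\<close> is \<open>d \<triangleright>\<^bsub>B\<^esub> x\<close>.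
  The bimodule associator \<open>mid c x d : (c \<triangleright> x) \<triangleleft> d \<rightarrow> c \<triangleright> (x \<triangleleft> d)\<close> thus
  goes from \<open>d \<triangleright>\<^bsub>B\<^esub> (c \<triangleright>\<^bsub>A\<^esub> x)\<close> to \<open>c \<triangleright>\<^bsub>A\<^esub> (d \<triangleright>\<^bsub>B\<^esub> x)\<close>.
\<close>

locale bimodule_category =
  left: module_category C L A + right: module_category "reverse D" L B
  for C :: "('o, 'm::ab_group_add, 'k::field, 'w) rigcat_scheme"
    and D :: "('q, 'r::ab_group_add, 'k, 'x) rigcat_scheme"
    and L :: "('p, 'n::ab_group_add, 'k, 'y) lincat_scheme"
    and A :: "('o, 'm, 'p, 'n, 'z) action_scheme"
    and B :: "('q, 'r, 'p, 'n, 'u) action_scheme" +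
  fixes mid :: "'o \<Rightarrow> 'p \<Rightarrow> 'q \<Rightarrow> 'n"
  assumes mid_iso:
      "\<lbrakk>c \<in> obj C; x \<in> obj L; d \<in> obj D\<rbrakk>
        \<Longrightarrow> is_iso L (d \<triangleright>\<^bsub>B\<^esub> (c \<triangleright>\<^bsub>A\<^esub> x)) (c \<triangleright>\<^bsub>A\<^esub> (d \<triangleright>\<^bsub>B\<^esub> x)) (mid c x d)"
    and mid_natural:
      "\<lbrakk>c \<in> obj C; c' \<in> obj C; x \<in> obj L; x' \<in> obj L; d \<in> obj D; d' \<in> obj D;
        f \<in> hom C c c'; h \<in> hom L x x'; g \<in> hom D d d'\<rbrakk>
        \<Longrightarrow> mid c' x' d' \<cdot>\<^bsub>L\<^esub> (g \<unrhd>\<^bsub>B\<^esub> (f \<unrhd>\<^bsub>A\<^esub> h)) = (f \<unrhd>\<^bsub>A\<^esub> (g \<unrhd>\<^bsub>B\<^esub> h)) \<cdot>\<^bsub>L\<^esub> mid c x d"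
    and mid_left_pentagon:
      "\<lbrakk>c \<in> obj C; c' \<in> obj C; x \<in> obj L; d \<in> obj D\<rbrakk>
        \<Longrightarrow> masc A c c' (d \<triangleright>\<^bsub>B\<^esub> x) \<cdot>\<^bsub>L\<^esub> mid (c \<otimes>\<^bsub>C\<^esub> c') x d
          = (ide C c \<unrhd>\<^bsub>A\<^esub> mid c' x d) \<cdot>\<^bsub>L\<^esub> mid c (c' \<triangleright>\<^bsub>A\<^esub> x) d \<cdot>\<^bsub>L\<^esub>
              (ide D d \<unrhd>\<^bsub>B\<^esub> masc A c c' x)"
    and mid_right_pentagon:
      "\<lbrakk>c \<in> obj C; x \<in> obj L; d \<in> obj D; d' \<in> obj D\<rbrakk>
        \<Longrightarrow> (ide C c \<unrhd>\<^bsub>A\<^esub> masc B d d' x) \<cdot>\<^bsub>L\<^esub> mid c x (d' \<otimes>\<^bsub>D\<^esub> d)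
          = mid c (d' \<triangleright>\<^bsub>B\<^esub> x) d \<cdot>\<^bsub>L\<^esub> (ide D d \<unrhd>\<^bsub>B\<^esub> mid c x d') \<cdot>\<^bsub>L\<^esub>
              masc B d d' (c \<triangleright>\<^bsub>A\<^esub> x)"
    and mid_left_unit:
      "\<lbrakk>x \<in> obj L; d \<in> obj D\<rbrakk>
        \<Longrightarrow> mun A (d \<triangleright>\<^bsub>B\<^esub> x) \<cdot>\<^bsub>L\<^esub> mid (one C) x d = ide D d \<unrhd>\<^bsub>B\<^esub> mun A x"
    and mid_right_unit:
      "\<lbrakk>c \<in> obj C; x \<in> obj L\<rbrakk>
        \<Longrightarrow> (ide C c \<unrhd>\<^bsub>A\<^esub> mun B x) \<cdot>\<^bsub>L\<^esub> mid c x (one D) = mun B (c \<triangleright>\<^bsub>A\<^esub> x)"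

section \<open>Internal Homs and relative Serre functors\<close>

text \<open>
  An action together with internal Homs \<open>ih y z\<close>, their evaluations \<open>iev y z : ih y z \<triangleright> y \<rightarrow> z\<close>, an
  endofunctor \<open>sf\<close> and morphisms \<open>sphi y z : (ih y z)\<^sup>\<or> \<rightarrow> ih z (sf y)\<close>.
\<close>

record ('o, 'm, 'p, 'n) serre_action = "('o, 'm, 'p, 'n) action" +
  ih :: "'p \<Rightarrow> 'p \<Rightarrow> 'o"
  iev :: "'p \<Rightarrow> 'p \<Rightarrow> 'n"
  sf :: "('p, 'n, 'p, 'n) fctr"
  sphi :: "'p \<Rightarrow> 'p \<Rightarrow> 'm"

definition internal_hom ::
  "('o, 'm, 'k, 'x) moncat_scheme \<Rightarrow> ('p, 'n, 'k, 'y) lincat_scheme \<Rightarrow>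
   ('o, 'm, 'p, 'n, 'z) serre_action_scheme \<Rightarrow> bool" where
  "internal_hom C L A \<longleftrightarrow>
     (\<forall>y\<in>obj L. \<forall>z\<in>obj L. ih A y z \<in> obj C \<and> iev A y z \<in> hom L (ih A y z \<triangleright>\<^bsub>A\<^esub> y) z \<and>
        (\<forall>c\<in>obj C. \<forall>f\<in>hom L (c \<triangleright>\<^bsub>A\<^esub> y) z.
           \<exists>!g. g \<in> hom C c (ih A y z) \<and> iev A y z \<cdot>\<^bsub>L\<^esub> (g \<unrhd>\<^bsub>A\<^esub> ide L y) = f))"

text \<open>The morphism \<open>c \<rightarrow> ih y z\<close> corresponding to \<open>f : c \<triangleright> y \<rightarrow> z\<close>.\<close>

definition curry_ih ::
  "('o, 'm, 'k, 'x) moncat_scheme \<Rightarrow> ('p, 'n, 'k, 'y) lincat_scheme \<Rightarrow>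
   ('o, 'm, 'p, 'n, 'z) serre_action_scheme \<Rightarrow> 'o \<Rightarrow> 'p \<Rightarrow> 'p \<Rightarrow> 'n \<Rightarrow> 'm" where
  "curry_ih C L A c y z f =
     (THE g. g \<in> hom C c (ih A y z) \<and> iev A y z \<cdot>\<^bsub>L\<^esub> (g \<unrhd>\<^bsub>A\<^esub> ide L y) = f)"

text \<open>\<open>ih y g : ih y z \<rightarrow> ih y z'\<close> for \<open>g : z \<rightarrow> z'\<close>, and \<open>ih f z : ih y z \<rightarrow> ih y' z\<close> for \<open>f : y' \<rightarrow> y\<close>.\<close>

definition ih_post ::
  "('o, 'm, 'k, 'x) moncat_scheme \<Rightarrow> ('p, 'n, 'k, 'y) lincat_scheme \<Rightarrow>
   ('o, 'm, 'p, 'n, 'z) serre_action_scheme \<Rightarrow> 'p \<Rightarrow> 'p \<Rightarrow> 'p \<Rightarrow> 'n \<Rightarrow> 'm" where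
  "ih_post C L A y z z' g = curry_ih C L A (ih A y z) y z' (g \<cdot>\<^bsub>L\<^esub> iev A y z)"

definition ih_pre ::
  "('o, 'm, 'k, 'x) moncat_scheme \<Rightarrow> ('p, 'n, 'k, 'y) lincat_scheme \<Rightarrow>
   ('o, 'm, 'p, 'n, 'z) serre_action_scheme \<Rightarrow> 'p \<Rightarrow> 'p \<Rightarrow> 'p \<Rightarrow> 'n \<Rightarrow> 'm" where
  "ih_pre C L A y' y z f =
     curry_ih C L A (ih A y z) y' z (iev A y z \<cdot>\<^bsub>L\<^esub> (ide C (ih A y z) \<unrhd>\<^bsub>A\<^esub> f))"

text \<open>\<open>c \<otimes> ih y z \<rightarrow> ih y (c \<triangleright> z)\<close> and \<open>ih y z \<otimes> c\<^sup>\<or> \<rightarrow> ih (c \<triangleright> y) z\<close>\<close>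

definition ih_act ::
  "('o, 'm, 'k, 'x) rigcat_scheme \<Rightarrow> ('p, 'n, 'k, 'y) lincat_scheme \<Rightarrow>
   ('o, 'm, 'p, 'n, 'z) serre_action_scheme \<Rightarrow> 'o \<Rightarrow> 'p \<Rightarrow> 'p \<Rightarrow> 'm" where
  "ih_act C L A c y z =
     curry_ih C L A (c \<otimes>\<^bsub>C\<^esub> ih A y z) y (c \<triangleright>\<^bsub>A\<^esub> z)
       ((ide C c \<unrhd>\<^bsub>A\<^esub> iev A y z) \<cdot>\<^bsub>L\<^esub> masc A c (ih A y z) y)"

definition ih_coact ::
  "('o, 'm, 'k, 'x) rigcat_scheme \<Rightarrow> ('p, 'n, 'k, 'y) lincat_scheme \<Rightarrow>
   ('o, 'm, 'p, 'n, 'z) serre_action_scheme \<Rightarrow> 'o \<Rightarrow> 'p \<Rightarrow> 'p \<Rightarrow> 'm" where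
  "ih_coact C L A c y z =
     curry_ih C L A (ih A y z \<otimes>\<^bsub>C\<^esub> rd C c) (c \<triangleright>\<^bsub>A\<^esub> y) z
       (iev A y z \<cdot>\<^bsub>L\<^esub>
        (ide C (ih A y z) \<unrhd>\<^bsub>A\<^esub>
          (mun A y \<cdot>\<^bsub>L\<^esub> (rdev C c \<unrhd>\<^bsub>A\<^esub> ide L y) \<cdot>\<^bsub>L\<^esub> imasc C L A (rd C c) c y)) \<cdot>\<^bsub>L\<^esub>
        masc A (ih A y z) (rd C c) (c \<triangleright>\<^bsub>A\<^esub> y))"

text \<open>
  The isomorphisms \<open>(ih y z)\<^sup>\<or> \<cong> ih z (S y)\<close> of a relative Serre functor are natural in both variables
  and, as functors of \<open>z\<close>, compatible with the module structure:
  \<open>(ih y (c \<triangleright> z))\<^sup>\<or> \<cong> (c \<otimes> ih y z)\<^sup>\<or> \<cong> (ih y z)\<^sup>\<or> \<otimes> c\<^sup>\<or> \<cong> ih z (S y) \<otimes> c\<^sup>\<or> \<cong> ih (c \<triangleright> z) (S y)\<close>.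
  Without the latter, \<open>S\<close> with its isomorphisms would not be unique up to unique isomorphism.
\<close>

definition relative_serre ::
  "('o, 'm::ab_group_add, 'k::field, 'x) rigcat_scheme \<Rightarrow>
   ('p, 'n::ab_group_add, 'k, 'y) lincat_scheme \<Rightarrow>
   ('o, 'm, 'p, 'n, 'z) serre_action_scheme \<Rightarrow> bool" where
  "relative_serre C L A \<longleftrightarrow> linear_functor L L (sf A) \<and>
     (\<forall>y\<in>obj L. \<forall>z\<in>obj L. is_iso C (rd C (ih A y z)) (ih A z (fob (sf A) y)) (sphi A y z)) \<and>
     (\<forall>y\<in>obj L. \<forall>z\<in>obj L. \<forall>z'\<in>obj L. \<forall>g\<in>hom L z z'.
        sphi A y z \<cdot>\<^bsub>C\<^esub> dual_arr C (ih A y z) (ih A y z') (ih_post C L A y z z' g)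
          = ih_pre C L A z z' (fob (sf A) y) g \<cdot>\<^bsub>C\<^esub> sphi A y z') \<and>
     (\<forall>y\<in>obj L. \<forall>y'\<in>obj L. \<forall>z\<in>obj L. \<forall>f\<in>hom L y y'.
        sphi A y' z \<cdot>\<^bsub>C\<^esub> dual_arr C (ih A y' z) (ih A y z) (ih_pre C L A y y' z f)
          = ih_post C L A z (fob (sf A) y) (fob (sf A) y') (far (sf A) f) \<cdot>\<^bsub>C\<^esub> sphi A y z) \<and>
     (\<forall>c\<in>obj C. \<forall>y\<in>obj L. \<forall>z\<in>obj L.
        sphi A y (c \<triangleright>\<^bsub>A\<^esub> z)
          = ih_coact C L A c z (fob (sf A) y) \<cdot>\<^bsub>C\<^esub> (sphi A y z \<boxtimes>\<^bsub>C\<^esub> ide C (rd C c)) \<cdot>\<^bsub>C\<^esub>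
            idual_tensor C c (ih A y z) \<cdot>\<^bsub>C\<^esub>
            dual_arr C (c \<otimes>\<^bsub>C\<^esub> ih A y z) (ih A y (c \<triangleright>\<^bsub>A\<^esub> z)) (ih_act C L A c y z))"

text \<open>
  The twisted module structure \<open>S(c \<triangleright> y) \<rightarrow> c\<^sup>\<or>\<^sup>\<or> \<triangleright> S y\<close>, obtained by Yoneda from
  \<open>(ih (c \<triangleright> y) z)\<^sup>\<or> \<cong> (ih y z \<otimes> c\<^sup>\<or>)\<^sup>\<or> \<cong> c\<^sup>\<or>\<^sup>\<or> \<otimes> (ih y z)\<^sup>\<or> \<cong> c\<^sup>\<or>\<^sup>\<or> \<otimes> ih z (S y) \<cong> ih z (c\<^sup>\<or>\<^sup>\<or> \<triangleright> S y)\<close>.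
\<close>

definition serre_act ::
  "('o, 'm, 'k, 'x) rigcat_scheme \<Rightarrow> ('p, 'n, 'k, 'y) lincat_scheme \<Rightarrow>
   ('o, 'm, 'p, 'n, 'z) serre_action_scheme \<Rightarrow> 'o \<Rightarrow> 'p \<Rightarrow> 'n" where
  "serre_act C L A c y =
     (let S = fob (sf A); c'' = rd C (rd C c) in
       THE s. s \<in> hom L (S (c \<triangleright>\<^bsub>A\<^esub> y)) (c'' \<triangleright>\<^bsub>A\<^esub> S y) \<and>
         (\<forall>z\<in>obj L.
            ih_post C L A z (S (c \<triangleright>\<^bsub>A\<^esub> y)) (c'' \<triangleright>\<^bsub>A\<^esub> S y) s \<cdot>\<^bsub>C\<^esub> sphi A (c \<triangleright>\<^bsub>A\<^esub> y) z
              = ih_act C L A c'' z (S y) \<cdot>\<^bsub>C\<^esub> (ide C c'' \<boxtimes>\<^bsub>C\<^esub> sphi A y z) \<cdot>\<^bsub>C\<^esub>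
                idual_tensor C (ih A y z) (rd C c) \<cdot>\<^bsub>C\<^esub>
                dual_arr C (ih A y z \<otimes>\<^bsub>C\<^esub> rd C c) (ih A (c \<triangleright>\<^bsub>A\<^esub> y) z) (ih_coact C L A c y z)))"

text \<open>
  Let \<open>E\<close> act by \<open>B\<close>, commuting with the action \<open>A\<close> of \<open>C\<close> via
  \<open>mid c x e : e \<triangleright>\<^bsub>B\<^esub> (c \<triangleright>\<^bsub>A\<^esub> x) \<rightarrow> c \<triangleright>\<^bsub>A\<^esub> (e \<triangleright>\<^bsub>B\<^esub> x)\<close>. As \<open>e \<triangleright> -\<close> is a \<open>C\<close>-module functor with right adjoint
  \<open>\<^sup>\<or>e \<triangleright> -\<close>, there is an isomorphism \<open>ih (e \<triangleright> y) z \<rightarrow> ih y (\<^sup>\<or>e \<triangleright> z)\<close>.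
\<close>

definition ih_commute ::
  "('o, 'm, 'k, 'x) rigcat_scheme \<Rightarrow> ('q, 'r, 'k, 'w) rigcat_scheme \<Rightarrow>
   ('p, 'n, 'k, 'y) lincat_scheme \<Rightarrow> ('o, 'm, 'p, 'n, 'z) serre_action_scheme \<Rightarrow>
   ('q, 'r, 'p, 'n, 'u) action_scheme \<Rightarrow> ('o \<Rightarrow> 'p \<Rightarrow> 'q \<Rightarrow> 'n) \<Rightarrow> 'q \<Rightarrow> 'p \<Rightarrow> 'p \<Rightarrow> 'm" where
  "ih_commute C E L A B mid e y z =
     (let h = ih A (e \<triangleright>\<^bsub>B\<^esub> y) z; e' = ld E e in
       curry_ih C L A h y (e' \<triangleright>\<^bsub>B\<^esub> z)
         ((ide E e' \<unrhd>\<^bsub>B\<^esub> iev A (e \<triangleright>\<^bsub>B\<^esub> y) z) \<cdot>\<^bsub>L\<^esub>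
          inv_arr L (e' \<triangleright>\<^bsub>B\<^esub> (h \<triangleright>\<^bsub>A\<^esub> (e \<triangleright>\<^bsub>B\<^esub> y))) (h \<triangleright>\<^bsub>A\<^esub> (e' \<triangleright>\<^bsub>B\<^esub> (e \<triangleright>\<^bsub>B\<^esub> y)))
            (mid h (e \<triangleright>\<^bsub>B\<^esub> y) e') \<cdot>\<^bsub>L\<^esub>
          (ide C h \<unrhd>\<^bsub>A\<^esub> (masc B e' e y \<cdot>\<^bsub>L\<^esub> (ldco E e \<unrhd>\<^bsub>B\<^esub> ide L y) \<cdot>\<^bsub>L\<^esub> imun E L B y))))"

text \<open>
  The structure \<open>S(e \<triangleright> y) \<rightarrow> \<^sup>\<or>\<^sup>\<or>e \<triangleright> S y\<close> for the commuting action, obtained by Yoneda from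
  \<open>(ih y (\<^sup>\<or>e \<triangleright> z))\<^sup>\<or> \<cong> ih (\<^sup>\<or>e \<triangleright> z) (S y) \<cong> ih z (\<^sup>\<or>\<^sup>\<or>e \<triangleright> S y)\<close>.
\<close>

definition serre_commute ::
  "('o, 'm, 'k, 'x) rigcat_scheme \<Rightarrow> ('q, 'r, 'k, 'w) rigcat_scheme \<Rightarrow>
   ('p, 'n, 'k, 'y) lincat_scheme \<Rightarrow> ('o, 'm, 'p, 'n, 'z) serre_action_scheme \<Rightarrow>
   ('q, 'r, 'p, 'n, 'u) action_scheme \<Rightarrow> ('o \<Rightarrow> 'p \<Rightarrow> 'q \<Rightarrow> 'n) \<Rightarrow> 'q \<Rightarrow> 'p \<Rightarrow> 'n" where
  "serre_commute C E L A B mid e y =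
     (let S = fob (sf A); e' = ld E e; e'' = ld E e' in
       THE s. s \<in> hom L (S (e \<triangleright>\<^bsub>B\<^esub> y)) (e'' \<triangleright>\<^bsub>B\<^esub> S y) \<and>
         (\<forall>z\<in>obj L.
            ih_post C L A z (S (e \<triangleright>\<^bsub>B\<^esub> y)) (e'' \<triangleright>\<^bsub>B\<^esub> S y) s \<cdot>\<^bsub>C\<^esub> sphi A (e \<triangleright>\<^bsub>B\<^esub> y) z \<cdot>\<^bsub>C\<^esub>
              dual_arr C (ih A (e \<triangleright>\<^bsub>B\<^esub> y) z) (ih A y (e' \<triangleright>\<^bsub>B\<^esub> z)) (ih_commute C E L A B mid e y z)
              = ih_commute C E L A B mid e' z (S y) \<cdot>\<^bsub>C\<^esub> sphi A y (e' \<triangleright>\<^bsub>B\<^esub> z)))"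

text \<open>
  The canonical isomorphism \<open>N\<^sub>L(x) \<cong> N\<^sub>L(1 \<triangleright> x) \<rightarrow> \<D>\<^sup>-\<^sup>1 \<triangleright> S x\<close>, from the adjunctions
  \<open>(- \<triangleright> x) \<stileturn> ih x - \<stileturn> (- \<triangleright> S x)\<close>.
\<close>

definition nak_serre ::
  "('o, 'm::ab_group_add, 'k::field, 'x) rigcat_scheme \<Rightarrow> ('o, 'm, 'k) nak \<Rightarrow>
   ('p, 'n::ab_group_add, 'k, 'y) lincat_scheme \<Rightarrow> ('p, 'n, 'k) nak \<Rightarrow>
   ('o, 'm, 'p, 'n, 'z) serre_action_scheme \<Rightarrow> 'p \<Rightarrow> 'n" where
  "nak_serre C NC L NL A x =
     nak_rra C NC L NL
       (act_on L A x)
       (ih A x)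
       (act_on L A (fob (sf A) x))
       (iev A x)
       (\<lambda>z. (ide C (ih A x z) \<unrhd>\<^bsub>A\<^esub> iev A z (fob (sf A) x)) \<cdot>\<^bsub>L\<^esub>
            masc A (ih A x z) (ih A z (fob (sf A) x)) z \<cdot>\<^bsub>L\<^esub>
            (((ide C (ih A x z) \<boxtimes>\<^bsub>C\<^esub> sphi A x z) \<cdot>\<^bsub>C\<^esub> rdco C (ih A x z)) \<unrhd>\<^bsub>A\<^esub> ide L z) \<cdot>\<^bsub>L\<^esub>
            imun C L A z)
       (one C)
     \<cdot>\<^bsub>L\<^esub> far (nfn NL) (imun C L A x)"

definition inak_serre ::
  "('o, 'm::ab_group_add, 'k::field, 'x) rigcat_scheme \<Rightarrow> ('o, 'm, 'k) nak \<Rightarrow>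
   ('p, 'n::ab_group_add, 'k, 'y) lincat_scheme \<Rightarrow> ('p, 'n, 'k) nak \<Rightarrow>
   ('o, 'm, 'p, 'n, 'z) serre_action_scheme \<Rightarrow> 'p \<Rightarrow> 'n" where
  "inak_serre C NC L NL A x =
     inv_arr L (fob (nfn NL) x) (dist_obj C NC \<triangleright>\<^bsub>A\<^esub> fob (sf A) x) (nak_serre C NC L NL A x)"

section \<open>Pivotal and spherical bimodule categories, left and right traces\<close>

text \<open>Bimodule natural isomorphisms \<open>t : id \<Rightarrow> S\<close> for the relative Serre functor of the action \<open>A\<close>,
  where the double duals in the bimodule structure of \<open>S\<close> are untwisted by
  \<open>p c : c \<rightarrow> c\<^sup>\<or>\<^sup>\<or>\<close> and \<open>l e : e \<rightarrow> \<^sup>\<or>\<^sup>\<or>e\<close>.\<close>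

definition bimodule_trivialization ::
  "('o, 'm, 'k, 'x) rigcat_scheme \<Rightarrow> ('o \<Rightarrow> 'm) \<Rightarrow> ('q, 'r, 'k, 'w) rigcat_scheme \<Rightarrow> ('q \<Rightarrow> 'r) \<Rightarrow>
   ('p, 'n, 'k, 'y) lincat_scheme \<Rightarrow> ('o, 'm, 'p, 'n, 'z) serre_action_scheme \<Rightarrow>
   ('q, 'r, 'p, 'n, 'u) action_scheme \<Rightarrow> ('o \<Rightarrow> 'p \<Rightarrow> 'q \<Rightarrow> 'n) \<Rightarrow> ('p \<Rightarrow> 'n) \<Rightarrow> bool" where
  "bimodule_trivialization C p E l L A B mid t \<longleftrightarrow>
     (\<forall>x\<in>obj L. is_iso L x (fob (sf A) x) (t x)) \<and>
     (\<forall>x\<in>obj L. \<forall>y\<in>obj L. \<forall>f\<in>hom L x y. far (sf A) f \<cdot>\<^bsub>L\<^esub> t x = t y \<cdot>\<^bsub>L\<^esub> f) \<and>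
     (\<forall>c\<in>obj C. \<forall>y\<in>obj L. serre_act C L A c y \<cdot>\<^bsub>L\<^esub> t (c \<triangleright>\<^bsub>A\<^esub> y) = p c \<unrhd>\<^bsub>A\<^esub> t y) \<and>
     (\<forall>e\<in>obj E. \<forall>y\<in>obj L.
        serre_commute C E L A B mid e y \<cdot>\<^bsub>L\<^esub> t (e \<triangleright>\<^bsub>B\<^esub> y) = l e \<unrhd>\<^bsub>B\<^esub> t y)"

text \<open>
  For the relative Serre functor of \<open>reverse D\<close> the two actions exchange their roles. In \<open>reverse D\<close> the
  right double dual is the left double dual of \<open>D\<close>, whence \<open>left_pivotal D pD\<close>.
\<close>

definition pivotal_bimodule ::
  "('o, 'm::ab_group_add, 'k::field, 'w) rigcat_scheme \<Rightarrow> ('o \<Rightarrow> 'm) \<Rightarrow>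
   ('q, 'r::ab_group_add, 'k, 'x) rigcat_scheme \<Rightarrow> ('q \<Rightarrow> 'r) \<Rightarrow>
   ('p, 'n::ab_group_add, 'k, 'y) lincat_scheme \<Rightarrow>
   ('o, 'm, 'p, 'n, 'z) serre_action_scheme \<Rightarrow> ('q, 'r, 'p, 'n, 'u) serre_action_scheme \<Rightarrow>
   ('o \<Rightarrow> 'p \<Rightarrow> 'q \<Rightarrow> 'n) \<Rightarrow> ('p \<Rightarrow> 'n) \<Rightarrow> ('p \<Rightarrow> 'n) \<Rightarrow> bool" where
  "pivotal_bimodule C pC D pD L A B mid p q \<longleftrightarrow>
     bimodule_category C D L A B mid \<and>
     exact_module C L A \<and> exact_module (reverse D) L B \<and>
     internal_hom C L A \<and> internal_hom (reverse D) L B \<and>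
     relative_serre C L A \<and> relative_serre (reverse D) L B \<and>
     bimodule_trivialization C pC (reverse D) pD L A B mid p \<and>
     bimodule_trivialization (reverse D) (left_pivotal D pD) C (left_pivotal C pC) L B A
       (\<lambda>d x c. inv_arr L (d \<triangleright>\<^bsub>B\<^esub> (c \<triangleright>\<^bsub>A\<^esub> x)) (c \<triangleright>\<^bsub>A\<^esub> (d \<triangleright>\<^bsub>B\<^esub> x)) (mid c x d)) q"

text \<open>The Radford isomorphism \<open>\<D>\<^sub>C\<^sup>-\<^sup>1 \<triangleright> S\<^sup>C x \<cong> N\<^sub>L(x) \<cong> S\<^sup>D x \<triangleleft> \<D>\<^sub>D\<^sup>-\<^sup>1\<close>.\<close>

definition radford ::
  "('o, 'm::ab_group_add, 'k::field, 'w) rigcat_scheme \<Rightarrow> ('o, 'm, 'k) nak \<Rightarrow>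
   ('q, 'r::ab_group_add, 'k, 'x) rigcat_scheme \<Rightarrow> ('q, 'r, 'k) nak \<Rightarrow>
   ('p, 'n::ab_group_add, 'k, 'y) lincat_scheme \<Rightarrow> ('p, 'n, 'k) nak \<Rightarrow>
   ('o, 'm, 'p, 'n, 'z) serre_action_scheme \<Rightarrow> ('q, 'r, 'p, 'n, 'u) serre_action_scheme \<Rightarrow>
   'p \<Rightarrow> 'n" where
  "radford C NC D ND L NL A B x =
     nak_serre (reverse D) ND L NL B x \<cdot>\<^bsub>L\<^esub> inak_serre C NC L NL A x"

definition trivialized_radford ::
  "('o, 'm::ab_group_add, 'k::field, 'w) rigcat_scheme \<Rightarrow> ('o, 'm, 'k) nak \<Rightarrow>
   ('q, 'r::ab_group_add, 'k, 'x) rigcat_scheme \<Rightarrow> ('q, 'r, 'k) nak \<Rightarrow>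
   ('p, 'n::ab_group_add, 'k, 'y) lincat_scheme \<Rightarrow> ('p, 'n, 'k) nak \<Rightarrow>
   ('o, 'm, 'p, 'n, 'z) serre_action_scheme \<Rightarrow> ('q, 'r, 'p, 'n, 'u) serre_action_scheme \<Rightarrow>
   'p \<Rightarrow> 'n" where
  "trivialized_radford C NC D ND L NL A B x =
     mun B (fob (sf B) x) \<cdot>\<^bsub>L\<^esub> (istd_triv D ND \<unrhd>\<^bsub>B\<^esub> ide L (fob (sf B) x)) \<cdot>\<^bsub>L\<^esub>
     radford C NC D ND L NL A B x \<cdot>\<^bsub>L\<^esub>
     (std_triv C NC \<unrhd>\<^bsub>A\<^esub> ide L (fob (sf A) x)) \<cdot>\<^bsub>L\<^esub> imun C L A (fob (sf A) x)"

definition spherical_bimodule ::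
  "('o, 'm::ab_group_add, 'k::field, 'w) rigcat_scheme \<Rightarrow> ('o \<Rightarrow> 'm) \<Rightarrow> ('o, 'm, 'k) nak \<Rightarrow>
   ('q, 'r::ab_group_add, 'k, 'x) rigcat_scheme \<Rightarrow> ('q \<Rightarrow> 'r) \<Rightarrow> ('q, 'r, 'k) nak \<Rightarrow>
   ('p, 'n::ab_group_add, 'k, 'y) lincat_scheme \<Rightarrow> ('p, 'n, 'k) nak \<Rightarrow>
   ('o, 'm, 'p, 'n, 'z) serre_action_scheme \<Rightarrow> ('q, 'r, 'p, 'n, 'u) serre_action_scheme \<Rightarrow>
   ('o \<Rightarrow> 'p \<Rightarrow> 'q \<Rightarrow> 'n) \<Rightarrow> ('p \<Rightarrow> 'n) \<Rightarrow> ('p \<Rightarrow> 'n) \<Rightarrow> bool" where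
  "spherical_bimodule C pC NC D pD ND L NL A B mid p q \<longleftrightarrow>
     pivotal_bimodule C pC D pD L A B mid p q \<and>
     (\<forall>x\<in>obj L. trivialized_radford C NC D ND L NL A B x \<cdot>\<^bsub>L\<^esub> p x = q x)"

definition left_trace ::
  "('o, 'm::ab_group_add, 'k::field, 'x) rigcat_scheme \<Rightarrow> ('o, 'm, 'k) nak \<Rightarrow>
   ('p, 'n::ab_group_add, 'k, 'y) lincat_scheme \<Rightarrow> ('p, 'n, 'k) nak \<Rightarrow>
   ('o, 'm, 'p, 'n, 'z) serre_action_scheme \<Rightarrow> ('p \<Rightarrow> 'n) \<Rightarrow> 'p \<Rightarrow> 'n \<Rightarrow> 'k" where
  "left_trace C NC L NL A p x f =
     twisted_trace L NL x
       (inak_serre C NC L NL A x \<cdot>\<^bsub>L\<^esub> (std_triv C NC \<unrhd>\<^bsub>A\<^esub> p x) \<cdot>\<^bsub>L\<^esub> imun C L A x \<cdot>\<^bsub>L\<^esub> f)"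

definition right_trace ::
  "('q, 'r::ab_group_add, 'k::field, 'x) rigcat_scheme \<Rightarrow> ('q, 'r, 'k) nak \<Rightarrow>
   ('p, 'n::ab_group_add, 'k, 'y) lincat_scheme \<Rightarrow> ('p, 'n, 'k) nak \<Rightarrow>
   ('q, 'r, 'p, 'n, 'z) serre_action_scheme \<Rightarrow> ('p \<Rightarrow> 'n) \<Rightarrow> 'p \<Rightarrow> 'n \<Rightarrow> 'k" where
  "right_trace D ND L NL B q x f =
     twisted_trace L NL x
       (inak_serre (reverse D) ND L NL B x \<cdot>\<^bsub>L\<^esub> (std_triv D ND \<unrhd>\<^bsub>B\<^esub> q x) \<cdot>\<^bsub>L\<^esub>
        imun (reverse D) L B x \<cdot>\<^bsub>L\<^esub> f)"

end

theory Submission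
  imports Defs
begin

text \<open>
  In a semisimple category every \<open>Hom(y, -)\<^sup>*\<close> is represented by \<open>y\<close> itself, so the universal family of the
  Nakayama functor \<open>N\<close> consists of bijections \<open>Hom(y, x)\<^sup>* \<rightarrow> Hom(x, N y)\<close>, the twisted trace pairing is
  non-degenerate, and it is cyclic up to applying \<open>N\<close>. Composing it with any natural isomorphism
  \<open>id \<Rightarrow> N\<close> therefore gives a Calabi-Yau structure. The left and the right trace arise in this way from
  \<open>x \<rightarrow> 1 \<triangleright> x \<rightarrow> D \<triangleright> S x \<rightarrow> N x\<close> for the two actions, so the main point is that the canonical morphism
  \<open>N x \<rightarrow> D \<triangleright> S x\<close> exists, is natural and is invertible. It is a monomorphism between isomorphic
  objects, hence invertible since hom spaces are finite-dimensional. The Radford isomorphism compares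
  the two trivializations of \<open>N\<close>, and sphericality says precisely that they agree.
\<close>

section \<open>Linear categories and Schur's lemma\<close>

text \<open>Two obstacles shape the proof. The canonical morphisms (\<open>inv_arr\<close>,
  \<open>dual_arr\<close>, \<open>nak_rra\<close>, \<open>std_triv\<close>) and the twisted trace
  are definite descriptions, so each says something only after existence and uniqueness have been
  shown. And pentagon and triangle are the only coherence axioms at hand, while the usual calculus
  of duals also needs their consequences for the unit constraints. Wherever coherence would make an
  automorphism an identity, only its invertibility is proved; this still makes transposition along a
  duality injective or bijective, which is all that is used. Likewise no inverse of N x
  \<rightarrow> D \<triangleright> S x is constructed: it is injective against one test object, and
  an isomorphism between its ends is found independently, from D \<cong> 1, from the pivotal
  trivialization S x \<cong> x and from x \<cong> N x. Algebraic closure enters where an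
  endomorphism of a simple object has to be a scalar; reading off that scalar is the functional that
  represents the dual of Hom. The right action is a left action of \<open>reverse D\<close>, so
  everything is proved once, for a left action.\<close>

sublocale linear_category \<subseteq> V: vector_space "scl X"
  by (rule vector_space)

context linear_category
begin

lemma hom_zero: "\<lbrakk>x \<in> obj X; y \<in> obj X\<rbrakk> \<Longrightarrow> 0 \<in> hom X x y"
  by (rule V.subspace_0[OF hom_subspace])

lemma hom_add: "\<lbrakk>x \<in> obj X; y \<in> obj X; f \<in> hom X x y; g \<in> hom X x y\<rbrakk> \<Longrightarrow> f + g \<in> hom X x y"
  by (rule V.subspace_add[OF hom_subspace])

lemma hom_diff: "\<lbrakk>x \<in> obj X; y \<in> obj X; f \<in> hom X x y; g \<in> hom X x y\<rbrakk> \<Longrightarrow> f - g \<in> hom X x y"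
  by (rule V.subspace_diff[OF hom_subspace])

lemma hom_scl: "\<lbrakk>x \<in> obj X; y \<in> obj X; f \<in> hom X x y\<rbrakk> \<Longrightarrow> scl X a f \<in> hom X x y"
  by (rule V.subspace_scale[OF hom_subspace])

lemma cmp_zero_right: "\<lbrakk>x \<in> obj X; y \<in> obj X; z \<in> obj X; g \<in> hom X y z\<rbrakk> \<Longrightarrow> g \<cdot> 0 = 0"
  using cmp_scl_right[of x y z 0 g 0] hom_zero[of x y] by simp

lemma cmp_zero_left: "\<lbrakk>x \<in> obj X; y \<in> obj X; z \<in> obj X; f \<in> hom X x y\<rbrakk> \<Longrightarrow> 0 \<cdot> f = 0"
  using cmp_scl_left[of x y z f 0 0] hom_zero[of y z] by simp

lemma cmp_diff_right:
  assumes "x \<in> obj X" "y \<in> obj X" "z \<in> obj X" "f \<in> hom X x y" "f' \<in> hom X x y" "g \<in> hom X y z"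
  shows "g \<cdot> (f - f') = g \<cdot> f - g \<cdot> f'"
  using cmp_add_right[of x y z "f - f'" f' g] hom_diff assms by (simp add: algebra_simps)

lemma cmp_diff_left:
  assumes "x \<in> obj X" "y \<in> obj X" "z \<in> obj X" "f \<in> hom X x y" "g \<in> hom X y z" "g' \<in> hom X y z"
  shows "(g - g') \<cdot> f = g \<cdot> f - g' \<cdot> f"
  using cmp_add_left[of x y z f "g - g'" g'] hom_diff assms by (simp add: algebra_simps)

section \<open>Inverses and cancellation of isomorphisms\<close>

lemma inverse_unique:
  assumes "x \<in> obj X" "y \<in> obj X" "f \<in> hom X x y" "g \<in> hom X y x" "g' \<in> hom X y x"
    and "g \<cdot> f = ide X x" "f \<cdot> g' = ide X y"
  shows "g = g'"
proof -
  have "g = g \<cdot> (f \<cdot> g')" using assms cmp_ide by simp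
  also have "\<dots> = (g \<cdot> f) \<cdot> g'" using assms cmp_assoc[of y x y x g' f g] by simp
  finally show ?thesis using assms ide_cmp by simp
qed

lemma inv_arr_eq:
  assumes "x \<in> obj X" "y \<in> obj X" "f \<in> hom X x y" "g \<in> hom X y x"
    and "g \<cdot> f = ide X x" "f \<cdot> g = ide X y"
  shows "inv_arr X x y f = g"
  unfolding inv_arr_def
proof (rule the_equality)
  show "g' = g" if "g' \<in> hom X y x \<and> g' \<cdot> f = ide X x \<and> f \<cdot> g' = ide X y" for g'
    using inverse_unique[of x y f g' g] assms that by blast
qed (use assms in simp)

lemma
  assumes "x \<in> obj X" "y \<in> obj X" "is_iso X x y f"
  shows inv_arr_in_hom: "inv_arr X x y f \<in> hom X y x"
    and inv_arr_cmp: "inv_arr X x y f \<cdot> f = ide X x"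
    and cmp_inv_arr: "f \<cdot> inv_arr X x y f = ide X y"
proof -
  obtain g where g: "f \<in> hom X x y" "g \<in> hom X y x" "g \<cdot> f = ide X x" "f \<cdot> g = ide X y"
    using assms(3) unfolding is_iso_def by blast
  then have "inv_arr X x y f = g" using assms inv_arr_eq by blast
  then show "inv_arr X x y f \<in> hom X y x" "inv_arr X x y f \<cdot> f = ide X x"
    "f \<cdot> inv_arr X x y f = ide X y" using g by auto
qed

lemma is_iso_in_hom: "is_iso X x y f \<Longrightarrow> f \<in> hom X x y"
  by (simp add: is_iso_def)

lemma is_iso_inv_arr:
  "\<lbrakk>x \<in> obj X; y \<in> obj X; is_iso X x y f\<rbrakk> \<Longrightarrow> is_iso X y x (inv_arr X x y f)"
  unfolding is_iso_def[of X y x]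
  by (intro conjI bexI[of _ f]) (auto simp: inv_arr_in_hom inv_arr_cmp cmp_inv_arr is_iso_in_hom)

lemma inv_arr_inv_arr:
  "\<lbrakk>x \<in> obj X; y \<in> obj X; is_iso X x y f\<rbrakk> \<Longrightarrow> inv_arr X y x (inv_arr X x y f) = f"
  by (intro inv_arr_eq) (auto simp: inv_arr_in_hom inv_arr_cmp cmp_inv_arr is_iso_in_hom)

lemma is_iso_cmp:
  assumes "x \<in> obj X" "y \<in> obj X" "z \<in> obj X" and f: "is_iso X x y f" and g: "is_iso X y z g"
  shows "is_iso X x z (g \<cdot> f)"
proof -
  let ?f = "inv_arr X x y f" and ?g = "inv_arr X y z g"
  note fs = is_iso_in_hom[OF f] inv_arr_in_hom[OF assms(1,2) f] inv_arr_cmp[OF assms(1,2) f]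
    cmp_inv_arr[OF assms(1,2) f]
  note gs = is_iso_in_hom[OF g] inv_arr_in_hom[OF assms(2,3) g] inv_arr_cmp[OF assms(2,3) g]
    cmp_inv_arr[OF assms(2,3) g]
  have gf: "g \<cdot> f \<in> hom X x z" and fg: "?f \<cdot> ?g \<in> hom X z x"
    using fs gs assms cmp_in_hom by blast+
  have "(?f \<cdot> ?g) \<cdot> (g \<cdot> f) = ?f \<cdot> ((?g \<cdot> g) \<cdot> f)"
    using fs gs assms gf cmp_assoc[of x z y x "g \<cdot> f" ?g ?f] cmp_assoc[of x y z y f g ?g] by simp
  also have "\<dots> = ide X x" using fs gs assms ide_cmp by simp
  finally have 1: "(?f \<cdot> ?g) \<cdot> (g \<cdot> f) = ide X x" .
  have "(g \<cdot> f) \<cdot> (?f \<cdot> ?g) = g \<cdot> ((f \<cdot> ?f) \<cdot> ?g)"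
    using fs gs assms fg cmp_assoc[of z x y z "?f \<cdot> ?g" f g] cmp_assoc[of z y x y ?g ?f f] by simp
  also have "\<dots> = ide X z" using fs gs assms ide_cmp by simp
  finally show ?thesis unfolding is_iso_def using gf fg 1 by blast
qed

lemma iso_cancel_left:
  assumes "w \<in> obj X" "x \<in> obj X" "y \<in> obj X" "is_iso X x y f"
    and "g \<in> hom X w x" "h \<in> hom X w x" "f \<cdot> g = f \<cdot> h"
  shows "g = h"
proof -
  let ?f = "inv_arr X x y f"
  have "?f \<cdot> (f \<cdot> g) = ?f \<cdot> (f \<cdot> h)" using assms by simp
  then have "(?f \<cdot> f) \<cdot> g = (?f \<cdot> f) \<cdot> h"
    using assms is_iso_in_hom inv_arr_in_hom[of x y f] cmp_assoc[of w x y x _ f ?f] by simp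
  then show ?thesis using assms inv_arr_cmp[of x y f] ide_cmp by simp
qed

lemma iso_cancel_right:
  assumes "x \<in> obj X" "y \<in> obj X" "z \<in> obj X" "is_iso X x y f"
    and "g \<in> hom X y z" "h \<in> hom X y z" "g \<cdot> f = h \<cdot> f"
  shows "g = h"
proof -
  let ?f = "inv_arr X x y f"
  have "(g \<cdot> f) \<cdot> ?f = (h \<cdot> f) \<cdot> ?f" using assms by simp
  then have "g \<cdot> (f \<cdot> ?f) = h \<cdot> (f \<cdot> ?f)"
    using assms is_iso_in_hom inv_arr_in_hom[of x y f] cmp_assoc[of y x y z ?f f] by metis
  then show ?thesis using assms cmp_inv_arr[of x y f] cmp_ide by simp
qed

lemma ide_zero_imp_is_zero:
  assumes "x \<in> obj X" "ide X x = 0"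
  shows "is_zero X x"
proof -
  have "f = 0" if "y \<in> obj X" "f \<in> hom X y x" for f y
    using ide_cmp[of y x f] cmp_zero_left[of y x x f] assms that by simp
  moreover have "f = 0" if "y \<in> obj X" "f \<in> hom X x y" for f y
    using cmp_ide[of x y f] cmp_zero_right[of x x y f] assms that by simp
  ultimately show ?thesis unfolding is_zero_def using assms hom_zero by blast
qed

section \<open>Kernels, cokernels and split extensions\<close>

lemma kernel_is_mono:
  assumes "a \<in> obj X" "b \<in> obj X" "c \<in> obj X" "is_kernel X a b c k f"
  shows "is_mono X a b k"
  unfolding is_mono_def
proof (intro conjI ballI impI)
  show k: "k \<in> hom X a b" using assms by (simp add: is_kernel_def)
  fix w g h assume w: "w \<in> obj X" "g \<in> hom X w a" "h \<in> hom X w a" "k \<cdot> g = k \<cdot> h"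
  have f: "f \<in> hom X b c" "f \<cdot> k = 0" using assms by (auto simp: is_kernel_def)
  have "f \<cdot> (k \<cdot> g) = 0"
    using cmp_assoc[of w a b c g k f] w k f assms cmp_zero_left[of w a c g] by simp
  moreover have "k \<cdot> g \<in> hom X w b" using w k assms cmp_in_hom by blast
  ultimately have "\<exists>!h. h \<in> hom X w a \<and> k \<cdot> h = k \<cdot> g"
    using assms(4) w(1) unfolding is_kernel_def by blast
  then show "g = h" using w by metis
qed

lemma cokernel_is_epi:
  assumes "a \<in> obj X" "b \<in> obj X" "c \<in> obj X" "is_cokernel X a b c f q"
  shows "is_epi X b c q"
  unfolding is_epi_def
proof (intro conjI ballI impI)
  show q: "q \<in> hom X b c" using assms by (simp add: is_cokernel_def)
  fix w g h assume w: "w \<in> obj X" "g \<in> hom X c w" "h \<in> hom X c w" "g \<cdot> q = h \<cdot> q"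
  have f: "f \<in> hom X a b" "q \<cdot> f = 0" using assms by (auto simp: is_cokernel_def)
  have "(g \<cdot> q) \<cdot> f = 0"
    using cmp_assoc[of a b c w f q g] w q f assms cmp_zero_right[of a c w g] by simp
  moreover have "g \<cdot> q \<in> hom X b w" using w q assms cmp_in_hom by blast
  ultimately have "\<exists>!h. h \<in> hom X c w \<and> h \<cdot> q = g \<cdot> q"
    using assms(4) w(1) unfolding is_cokernel_def by blast
  then show "g = h" using w by metis
qed

text \<open>A lift of \<open>f \<cdot> r\<close> along the epimorphism, restricted along
  \<open>i\<close>, is a lift of \<open>f\<close>.\<close>

lemma is_projective_retract:
  assumes "is_projective X q" "p \<in> obj X" "i \<in> hom X p q" "r \<in> hom X q p" "r \<cdot> i = ide X p"
  shows "is_projective X p"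
  unfolding is_projective_def
proof (intro conjI ballI allI impI)
  fix x y e f assume *: "x \<in> obj X" "y \<in> obj X" "is_epi X x y e" "f \<in> hom X p y"
  have q: "q \<in> obj X" and e: "e \<in> hom X x y" using assms * by (auto simp: is_projective_def is_epi_def)
  have "f \<cdot> r \<in> hom X q y" using cmp_in_hom[of q p y r f] q assms * by blast
  then obtain g where g: "g \<in> hom X q x" "e \<cdot> g = f \<cdot> r"
    using assms(1) * unfolding is_projective_def by blast
  have "e \<cdot> (g \<cdot> i) = f \<cdot> (r \<cdot> i)"
    using cmp_assoc[of p q x y i g e] cmp_assoc[of p q p y i r f] g q e assms * by simp
  then show "\<exists>g\<in>hom X p x. e \<cdot> g = f"
    using assms * q g cmp_in_hom[of p q x i g] cmp_ide by auto
qed (use assms in auto)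

text \<open>Projectivity of \<open>c\<close> gives a section \<open>j\<close> of \<open>g\<close>.
  Then \<open>e = ide X b - j \<cdot> g\<close> is killed by \<open>g\<close>, so it factors through
  the kernel \<open>f\<close>, and the factor \<open>p\<close> is the missing projection.\<close>

lemma short_exact_projective_is_biproduct:
  assumes ob: "a \<in> obj X" "b \<in> obj X" "c \<in> obj X"
    and ex: "short_exact X a b c f g" and c: "is_projective X c"
  shows "is_biproduct X a c b"
proof -
  have ker: "is_kernel X a b c f g" and cok: "is_cokernel X a b c f g"
    using ex by (auto simp: short_exact_def)
  have f: "f \<in> hom X a b" and g: "g \<in> hom X b c" and gf: "g \<cdot> f = 0"
    using ker by (auto simp: is_kernel_def)
  obtain j where j: "j \<in> hom X c b" "g \<cdot> j = ide X c"
    using c cokernel_is_epi[OF ob cok] ob ide_in_hom unfolding is_projective_def by blast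
  define e where "e = ide X b - j \<cdot> g"
  have jg: "j \<cdot> g \<in> hom X b b" using j g ob cmp_in_hom by blast
  have e: "e \<in> hom X b b" unfolding e_def using jg ob ide_in_hom hom_diff by blast
  have "g \<cdot> (j \<cdot> g) = g" using cmp_assoc[of b c b c g j g] j g ob ide_cmp by simp
  then have "g \<cdot> e = 0"
    unfolding e_def using cmp_diff_right[of b b c "ide X b" "j \<cdot> g" g] jg g ob ide_in_hom cmp_ide by simp
  then obtain p where p: "p \<in> hom X b a" "f \<cdot> p = e"
    using ker e ob unfolding is_kernel_def by blast
  \<comment> \<open>The equations for \<open>p\<close> are verified after composing with the
    monomorphism \<open>f\<close>.\<close>
  have mono: "u = v" if "w \<in> obj X" "u \<in> hom X w a" "v \<in> hom X w a" "f \<cdot> u = f \<cdot> v" for u v w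
    using kernel_is_mono[OF ob ker] that unfolding is_mono_def by blast
  have "(j \<cdot> g) \<cdot> f = 0" using cmp_assoc[of a b c b f g j] j f g gf ob cmp_zero_right[of a c b j] by simp
  then have "e \<cdot> f = f"
    unfolding e_def using cmp_diff_left[of a b b f "ide X b" "j \<cdot> g"] jg f ob ide_in_hom ide_cmp by simp
  then have "f \<cdot> (p \<cdot> f) = f \<cdot> ide X a" using cmp_assoc[of a b a b f p f] p f ob cmp_ide by simp
  then have pf: "p \<cdot> f = ide X a" using mono[of a "p \<cdot> f" "ide X a"] p f ob cmp_in_hom[of a b a f p] ide_in_hom by simp
  have "(j \<cdot> g) \<cdot> j = j" using cmp_assoc[of c b c b j g j] j g ob cmp_ide by simp
  then have "e \<cdot> j = 0"
    unfolding e_def using cmp_diff_left[of c b b j "ide X b" "j \<cdot> g"] jg j ob ide_in_hom ide_cmp by simp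
  then have "f \<cdot> (p \<cdot> j) = f \<cdot> 0"
    using cmp_assoc[of c b a b j p f] p f j ob cmp_zero_right[of c a b f] by simp
  then have pj: "p \<cdot> j = 0" using mono[of c "p \<cdot> j" 0] p j ob cmp_in_hom[of c b a j p] hom_zero by simp
  have "f \<cdot> p + j \<cdot> g = ide X b" using p e_def by simp
  then show ?thesis unfolding is_biproduct_def
    by (intro conjI bexI[OF _ f] bexI[OF _ j(1)] bexI[OF _ p(1)] bexI[OF _ g] ob pf j(2) pj gf)
qed

text \<open>Each step of a composition series is an extension by a simple quotient; this quotient is
  projective, so the extension splits.\<close>

lemma semisimple_obj_if_projective:
  assumes "\<And>x. x \<in> obj X \<Longrightarrow> is_projective X x" and "finite_length X x"
  shows "semisimple_obj X x"
  using assms(2)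
proof induction
  case (extension a b c f g)
  then have "a \<in> obj X"
    by (metis finite_length.cases is_zero_def)
  moreover have "c \<in> obj X" using extension by (simp add: is_simple_def)
  ultimately have "is_biproduct X a c b"
    using short_exact_projective_is_biproduct extension assms(1) by blast
  then show ?case using semisimple_obj.sum[OF extension(5,3)] by blast
qed (rule semisimple_obj.zero)

lemma semisimple_obj_in_obj: "semisimple_obj X x \<Longrightarrow> x \<in> obj X"
  by (induction rule: semisimple_obj.induct) (auto simp: is_zero_def is_biproduct_def)

end

section \<open>Simple objects and Schur's lemma\<close>

context abelian_category
begin

text \<open>The kernel of \<open>f\<close> is a subobject of a simple object, so it is zero or
  everything; the latter would force \<open>f = 0\<close>.\<close>

lemma simple_nonzero_is_mono:
  assumes s: "is_simple X s" and t: "t \<in> obj X" and f: "f \<in> hom X s t" "f \<noteq> 0"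
  shows "is_mono X s t f"
proof -
  have ob: "s \<in> obj X" using s by (simp add: is_simple_def)
  obtain a k where a: "a \<in> obj X" "is_kernel X a s t k f"
    using ex_kernel ob t f by blast
  have k: "k \<in> hom X a s" "f \<cdot> k = 0" using a by (auto simp: is_kernel_def)
  have "is_zero X a \<or> is_iso X a s k"
    using s a kernel_is_mono[OF a(1) ob t a(2)] unfolding is_simple_def by blast
  moreover have "\<not> is_iso X a s k"
  proof
    assume "is_iso X a s k"
    moreover have "f \<cdot> k = 0 \<cdot> k" using k ob a t cmp_zero_left[of a s t k] by simp
    ultimately show False using iso_cancel_right[of a s t k f 0] a ob t f hom_zero by blast
  qed
  ultimately have z: "is_zero X a" by blast
  show ?thesis unfolding is_mono_def
  proof (intro conjI ballI impI)
    fix w g h assume w: "w \<in> obj X" "g \<in> hom X w s" "h \<in> hom X w s" "f \<cdot> g = f \<cdot> h"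
    have "f \<cdot> (g - h) = 0" using cmp_diff_right[of w s t g h f] w f ob t by simp
    then obtain u where "u \<in> hom X w a" "k \<cdot> u = g - h"
      using a(2) w hom_diff[of w s g h] ob unfolding is_kernel_def by blast
    then have "g - h = 0" using z w(1) cmp_zero_right[of w a s k] a ob k unfolding is_zero_def by auto
    then show "g = h" by simp
  qed (rule f)
qed

lemma schur:
  assumes "is_simple X s" "is_simple X t" "f \<in> hom X s t" "f \<noteq> 0"
  shows "is_iso X s t f"
  using simple_nonzero_is_mono[of s t f] assms unfolding is_simple_def by blast

text \<open>One of the two components of \<open>f\<close> on the summands is nonzero. The induction
  hypothesis splits it on \<open>a\<close>, Schur's lemma inverts it on the simple summand, and the
  inclusion carries the section into the sum.\<close>

lemma semisimple_obj_section:
  assumes "semisimple_obj X a" and t: "is_simple X t" and "f \<in> hom X a t" "f \<noteq> 0"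
  shows "\<exists>g\<in>hom X t a. f \<cdot> g = ide X t"
  using assms(1,3,4)
proof (induction arbitrary: f)
  case (zero z)
  then show ?case using t by (auto simp: is_zero_def is_simple_def)
next
  case (sum a s b)
  have ob: "a \<in> obj X" "s \<in> obj X" "b \<in> obj X" "t \<in> obj X"
    using sum t by (auto simp: is_biproduct_def is_simple_def semisimple_obj_in_obj)
  obtain i j p q where h: "i \<in> hom X a b" "j \<in> hom X s b" "p \<in> hom X b a" "q \<in> hom X b s"
    and pq: "i \<cdot> p + j \<cdot> q = ide X b"
    using sum(3) unfolding is_biproduct_def by blast
  have "f \<cdot> i \<noteq> 0 \<or> f \<cdot> j \<noteq> 0"
  proof (rule ccontr)
    assume c: "\<not> ?thesis"
    have "f = f \<cdot> (i \<cdot> p + j \<cdot> q)" using pq sum ob cmp_ide by simp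
    also have "\<dots> = (f \<cdot> i) \<cdot> p + (f \<cdot> j) \<cdot> q"
      using cmp_add_right[of b b t "i \<cdot> p" "j \<cdot> q" f] cmp_assoc[of b a b t p i f]
        cmp_assoc[of b s b t q j f] cmp_in_hom[of b a b p i] cmp_in_hom[of b s b q j]
        h sum ob by simp
    also have "\<dots> = 0" using c h ob cmp_zero_left[of b a t p] cmp_zero_left[of b s t q] by simp
    finally show False using sum by simp
  qed
  then show ?case
  proof
    assume n: "f \<cdot> i \<noteq> 0"
    have "f \<cdot> i \<in> hom X a t" using h ob sum cmp_in_hom by blast
    then obtain g where g: "g \<in> hom X t a" "(f \<cdot> i) \<cdot> g = ide X t" using n sum.IH by blast
    then have "f \<cdot> (i \<cdot> g) = ide X t" "i \<cdot> g \<in> hom X t b"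
      using cmp_assoc[of t a b t g i f] cmp_in_hom[of t a b g i] sum h ob by auto
    then show ?thesis by blast
  next
    assume n: "f \<cdot> j \<noteq> 0"
    have "f \<cdot> j \<in> hom X s t" using h ob sum cmp_in_hom by blast
    then have iso: "is_iso X s t (f \<cdot> j)" using schur n sum t by blast
    let ?g = "inv_arr X s t (f \<cdot> j)"
    have "f \<cdot> (j \<cdot> ?g) = ide X t" "j \<cdot> ?g \<in> hom X t b"
      using cmp_assoc[of t s b t ?g j f] cmp_in_hom[of t s b ?g j] sum h ob
        inv_arr_in_hom[OF ob(2,4) iso] cmp_inv_arr[OF ob(2,4) iso] by auto
    then show ?thesis by blast
  qed
qed

end

text \<open>Some projective \<open>p\<close> maps onto \<open>t\<close>. As \<open>p\<close> is a
  sum of simple objects, this nonzero morphism splits, and \<open>t\<close> is a retract of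
  \<open>p\<close>.\<close>

lemma (in finite_category) simple_is_projective:
  assumes ss: "semisimple_category X" and t: "is_simple X t"
  shows "is_projective X t"
proof -
  have ob: "t \<in> obj X" using t by (simp add: is_simple_def)
  obtain p e where p: "is_projective X p" "is_epi X p t e" using enough_projectives ob by blast
  have e: "p \<in> obj X" "e \<in> hom X p t" using p by (auto simp: is_projective_def is_epi_def)
  \<comment> \<open>A zero epimorphism would identify \<open>ide X t\<close> with
    \<open>0\<close>.\<close>
  have "e \<noteq> 0"
  proof
    assume 0: "e = 0"
    have "ide X t \<cdot> e = 0 \<cdot> e" using 0 ide_cmp[of p t e] cmp_zero_left[of p t t e] e ob by simp
    then have "ide X t = 0" using p(2) ob ide_in_hom hom_zero unfolding is_epi_def by blast
    then show False using ide_zero_imp_is_zero ob t by (auto simp: is_simple_def)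
  qed
  then obtain g where "g \<in> hom X t p" "e \<cdot> g = ide X t"
    using semisimple_obj_section ss t e unfolding semisimple_category_def by blast
  then show ?thesis using is_projective_retract p ob e by blast
qed

section \<open>Duals of hom spaces in semisimple categories\<close>

text \<open>\<open>T\<close> is linear on \<open>V\<close> only, so the dimension count is carried
  out on a basis \<open>b\<close> of \<open>V\<close>: its image is independent and of the same
  size, and a vector of \<open>V\<close> outside the span of the image would give too many
  independent vectors in \<open>span b\<close>.\<close>

lemma (in vector_space) injective_endomorphism_surjective:
  assumes sub: "subspace V" and B: "finite B" "V \<subseteq> span B"
    and T: "\<And>v. v \<in> V \<Longrightarrow> T v \<in> V"
    and add: "\<And>u v. u \<in> V \<Longrightarrow> v \<in> V \<Longrightarrow> T (u + v) = T u + T v"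
    and scale: "\<And>a v. v \<in> V \<Longrightarrow> T (scale a v) = scale a (T v)"
    and inj: "\<And>v. v \<in> V \<Longrightarrow> T v = 0 \<Longrightarrow> v = 0"
    and w: "w \<in> V"
  shows "\<exists>v\<in>V. T v = w"
proof -
  obtain b where b: "b \<subseteq> V" "independent b" "V \<subseteq> span b"
    using basis_exists[of V] by metis
  have fin: "finite b" using independent_span_bound[OF B(1) b(2)] b(1) B(2) by blast
  have T0: "T 0 = 0" using scale[of 0 0] subspace_0[OF sub] by simp
  have sum: "(\<Sum>v\<in>S. scale (c v) v) \<in> V \<and> T (\<Sum>v\<in>S. scale (c v) v) = (\<Sum>v\<in>S. scale (c v) (T v))"
    if "finite S" "S \<subseteq> V" for S c
    using that
  proof (induction S)
    case empty
    then show ?case using T0 subspace_0[OF sub] by simp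
  next
    case (insert x S)
    moreover have "scale (c x) x \<in> V" using insert subspace_scale[OF sub] by simp
    ultimately show ?case using add scale subspace_add[OF sub] by simp
  qed
  have injT: "inj_on T V"
  proof (rule inj_onI)
    fix u v assume uv: "u \<in> V" "v \<in> V" "T u = T v"
    have "T (u - v) + T v = T (u - v + v)"
      using add[of "u - v" v] subspace_diff[OF sub] uv by simp
    then have "T (u - v) = 0" using uv by simp
    then show "u = v" using inj[of "u - v"] subspace_diff[OF sub] uv by simp
  qed
  have ind: "independent (T ` b)"
  proof
    assume "dependent (T ` b)"
    then obtain u v where u: "v \<in> b" "u (T v) \<noteq> 0" "(\<Sum>v\<in>T ` b. scale (u v) v) = 0"
      using dependent_finite[of "T ` b"] fin by auto
    have "(\<Sum>v\<in>T ` b. scale (u v) v) = (\<Sum>v\<in>b. scale (u (T v)) (T v))"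
      using sum.reindex[of T b] inj_on_subset[OF injT b(1)] by (simp add: comp_def)
    also have "\<dots> = T (\<Sum>v\<in>b. scale (u (T v)) v)"
      using sum[OF fin b(1), of "\<lambda>v. u (T v)"] by simp
    finally have "(\<Sum>v\<in>b. scale (u (T v)) v) = 0"
      using u inj[of "\<Sum>v\<in>b. scale (u (T v)) v"] sum[OF fin b(1), of "\<lambda>v. u (T v)"] by simp
    then have "dependent b"
      unfolding dependent_finite[OF fin] using u by (intro exI[of _ "\<lambda>v. u (T v)"]) auto
    then show False using b by simp
  qed
  have "w \<in> span (T ` b)"
  proof (rule ccontr)
    assume n: "w \<notin> span (T ` b)"
    then have "independent (insert w (T ` b))" using ind by (simp add: independent_insert)
    moreover have "insert w (T ` b) \<subseteq> span b" using w b T by auto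
    ultimately have "card (insert w (T ` b)) \<le> card b" using independent_span_bound[OF fin] by blast
    moreover have "w \<notin> T ` b" using n span_base by blast
    moreover have "card (T ` b) = card b" using card_image[OF inj_on_subset[OF injT b(1)]] .
    ultimately show False using fin by simp
  qed
  then obtain u where "w = (\<Sum>v\<in>T ` b. scale (u v) v)"
    using span_finite[of "T ` b"] fin by auto
  also have "\<dots> = (\<Sum>v\<in>b. scale (u (T v)) (T v))"
    using sum.reindex[of T b] inj_on_subset[OF injT b(1)] by (simp add: comp_def)
  also have "\<dots> = T (\<Sum>v\<in>b. scale (u (T v)) v)"
    using sum[OF fin b(1), of "\<lambda>v. u (T v)"] by simp
  finally show ?thesis using sum[OF fin b(1), of "\<lambda>v. u (T v)"] by blast
qed

section \<open>Dimension counting for endomorphisms\<close>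

context finite_category
begin

text \<open>Composition with \<open>f\<close> is an injective endomorphism of the finite-dimensional
  space \<open>hom X x x\<close>, hence onto. This gives a right inverse \<open>g\<close>, and
  injectivity applied to \<open>g \<cdot> f - ide X x\<close> makes it two-sided.\<close>

lemma mono_endomorphism_is_iso:
  assumes x: "x \<in> obj X" and f: "f \<in> hom X x x"
    and mono: "\<And>v. v \<in> hom X x x \<Longrightarrow> f \<cdot> v = 0 \<Longrightarrow> v = 0"
  shows "is_iso X x x f"
proof -
  obtain B where B: "finite B" "hom X x x = V.span B" using hom_finite_dim[OF x x] by blast
  have "\<exists>g\<in>hom X x x. f \<cdot> g = ide X x"
    using V.injective_endomorphism_surjective[of "hom X x x" B "\<lambda>g. f \<cdot> g" "ide X x"]
      hom_subspace[OF x x] B cmp_in_hom[OF x x x _ f] cmp_add_right[OF x x x _ _ f]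
      cmp_scl_right[OF x x x _ f] mono ide_in_hom[OF x] by blast
  then obtain g where g: "g \<in> hom X x x" "f \<cdot> g = ide X x" by blast
  have gf: "g \<cdot> f \<in> hom X x x" using cmp_in_hom[OF x x x f g(1)] .
  have "f \<cdot> (g \<cdot> f) = f" using cmp_assoc[OF x x x x f g(1) f] g ide_cmp[OF x x f] by simp
  then have "f \<cdot> (g \<cdot> f - ide X x) = 0"
    using cmp_diff_right[OF x x x gf ide_in_hom[OF x] f] cmp_ide[OF x x f] by simp
  then have "g \<cdot> f = ide X x" using mono hom_diff[OF x x gf ide_in_hom[OF x]] by fastforce
  then show ?thesis unfolding is_iso_def using f g by blast
qed

text \<open>Reduces to the endomorphism \<open>f \<cdot> h\<close> of \<open>y\<close>. Injectivity
  has to be tested against the single source object \<open>y\<close>, and this is what makes the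
  lemma applicable to the Nakayama comparison.\<close>

lemma mono_isomorphic_is_iso:
  assumes ob: "x \<in> obj X" "y \<in> obj X" and f: "f \<in> hom X x y" and h: "is_iso X y x h"
    and mono: "\<And>v. v \<in> hom X y x \<Longrightarrow> f \<cdot> v = 0 \<Longrightarrow> v = 0"
  shows "is_iso X x y f"
proof -
  note hs = is_iso_in_hom[OF h] inv_arr_in_hom[OF ob(2,1) h] cmp_inv_arr[OF ob(2,1) h]
    inv_arr_cmp[OF ob(2,1) h]
  let ?i = "inv_arr X y x h"
  have fh: "f \<cdot> h \<in> hom X y y" using cmp_in_hom[OF ob(2,1,2) hs(1) f] .
  have "is_iso X y y (f \<cdot> h)"
  proof (rule mono_endomorphism_is_iso[OF ob(2) fh])
    fix v assume v: "v \<in> hom X y y" "(f \<cdot> h) \<cdot> v = 0"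
    have "h \<cdot> v \<in> hom X y x" using cmp_in_hom[OF ob(2,2,1) v(1) hs(1)] .
    then have "h \<cdot> v = 0" using mono cmp_assoc[OF ob(2,2,1,2) v(1) hs(1) f] v by simp
    then have "h \<cdot> v = h \<cdot> 0" using cmp_zero_right[OF ob(2,2,1) hs(1)] by simp
    then show "v = 0" using iso_cancel_left[OF ob(2,2,1) h v(1)] hom_zero ob by blast
  qed
  then have "is_iso X x y ((f \<cdot> h) \<cdot> ?i)"
    using is_iso_cmp[OF ob(1,2,2) is_iso_inv_arr[OF ob(2,1) h]] by blast
  then show ?thesis
    using cmp_assoc[OF ob(1,2,1,2) hs(2,1) f] hs(3) cmp_ide[OF ob f] by simp
qed

text \<open>The powers of \<open>f\<close> with exponents up to \<open>card B\<close> are one more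
  than the vectors in the spanning set \<open>B\<close>.\<close>

lemma endomorphism_annihilating_poly:
  assumes x: "x \<in> obj X" and f: "f \<in> hom X x x"
  defines "pw \<equiv> \<lambda>i. ((\<cdot>) f ^^ i) (ide X x)"
  shows "\<exists>p. p \<noteq> 0 \<and> (\<Sum>i\<le>degree p. scl X (coeff p i) (pw i)) = 0"
proof -
  obtain B where B: "finite B" "hom X x x = V.span B" using hom_finite_dim[OF x x] by blast
  have pw: "pw i \<in> hom X x x" for i
    unfolding pw_def by (induction i) (auto simp: ide_in_hom x intro: cmp_in_hom[OF x x x _ f])
  have *: "\<exists>c. (\<exists>i\<le>card B. c i \<noteq> 0) \<and> (\<Sum>i\<le>card B. scl X (c i) (pw i)) = 0"
  proof (cases "inj_on pw {..card B}")
    case True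
    then have "card (pw ` {..card B}) = Suc (card B)" by (simp add: card_image)
    then have "V.dependent (pw ` {..card B})"
      using V.independent_span_bound[OF B(1), of "pw ` {..card B}"] pw B(2) by auto
    then obtain u where u: "\<exists>v\<in>pw ` {..card B}. u v \<noteq> 0" "(\<Sum>v\<in>pw ` {..card B}. scl X (u v) v) = 0"
      using V.dependent_finite by blast
    have "(\<Sum>i\<le>card B. scl X (u (pw i)) (pw i)) = 0"
      using u(2) unfolding sum.reindex[OF True] comp_def .
    then show ?thesis using u by (intro exI[of _ "\<lambda>i. u (pw i)"]) auto
  next
    \<comment> \<open>Linear dependence is a property of the set of powers, which is too small if
      two powers coincide. In that case the relation is the difference of the two monomials.\<close>
    case False
    then obtain i j where ij: "i \<le> card B" "j \<le> card B" "i \<noteq> j" "pw i = pw j"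
      unfolding inj_on_def by auto
    have "(\<Sum>l\<le>card B. scl X ((if l = i then 1 else 0) - (if l = j then 1 else 0)) (pw l))
      = (\<Sum>l\<le>card B. (if l = i then pw i else 0) - (if l = j then pw j else 0))"
      by (intro sum.cong) (auto simp: V.scale_left_diff_distrib)
    also have "\<dots> = 0" using ij by (simp add: sum_subtractf sum.delta)
    finally show ?thesis
      using ij by (intro exI[of _ "\<lambda>l. (if l = i then 1 else 0) - (if l = j then 1 else 0)"]) auto
  qed
  then obtain c where c: "\<exists>i\<le>card B. c i \<noteq> 0" "(\<Sum>i\<le>card B. scl X (c i) (pw i)) = 0" by blast
  define p where "p = (\<Sum>i\<le>card B. monom (c i) i)"
  have cp: "coeff p i = (if i \<le> card B then c i else 0)" for i
    unfolding p_def by (simp add: coeff_sum sum.delta)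
  then have deg: "degree p \<le> card B" by (intro degree_le) auto
  have "(\<Sum>i\<le>degree p. scl X (coeff p i) (pw i)) = (\<Sum>i\<le>card B. scl X (coeff p i) (pw i))"
    using deg by (intro sum.mono_neutral_left) (auto simp: coeff_eq_0)
  also have "\<dots> = 0" using c by (simp add: cp)
  finally have "(\<Sum>i\<le>degree p. scl X (coeff p i) (pw i)) = 0" .
  moreover have "p \<noteq> 0" using c(1) cp by (metis coeff_0)
  ultimately show ?thesis by blast
qed

end

text \<open>If \<open>f\<close> is not a scalar, each \<open>f - scl X r (ide X s)\<close> is
  nonzero and so invertible by Schur's lemma. Linear factors can then be cancelled from an
  annihilating polynomial, until a nonzero constant would annihilate the identity.\<close>

lemma simple_endomorphism_scalar:
  fixes X :: "('o, 'm::ab_group_add, 'k::alg_closed_field, 'z) lincat_scheme" (structure)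
  assumes "finite_category X" and s: "is_simple X s" and f: "f \<in> hom X s s"
  shows "\<exists>a. f = scl X a (ide X s)"
proof (rule ccontr)
  interpret finite_category X by fact
  assume no: "\<not> ?thesis"
  have x: "s \<in> obj X" using s by (simp add: is_simple_def)
  define pw where "pw i = ((\<cdot>) f ^^ i) (ide X s)" for i
  have pw_Suc: "pw (Suc i) = f \<cdot> pw i" for i by (simp add: pw_def)
  have pw: "pw i \<in> hom X s s" for i
    unfolding pw_def by (induction i) (auto simp: ide_in_hom x intro: cmp_in_hom[OF x x x _ f])
  have pws: "scl X a (pw i) \<in> hom X s s" for a i using hom_scl[OF x x] pw by blast
  \<comment> \<open>\<open>ev n p\<close> is \<open>p\<close> evaluated at \<open>f\<close>, summed
    up to degree \<open>n\<close>. All \<open>n \<ge> degree p\<close> give the same value; the free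
    bound is needed because multiplication by the variable lengthens the sum by one.\<close>
  define ev where "ev n p = (\<Sum>i\<le>n. scl X (coeff p i) (pw i))" for n p
  have ev_deg: "ev n p = ev (degree p) p" if "degree p \<le> n" for n p
    unfolding ev_def using that by (intro sum.mono_neutral_right) (auto simp: coeff_eq_0)
  have ev_hom: "ev n p \<in> hom X s s" for n p
    unfolding ev_def by (intro V.subspace_sum[OF hom_subspace[OF x x]] pws)
  have f_sum: "f \<cdot> (\<Sum>i\<le>n. scl X (c i) (pw i)) = (\<Sum>i\<le>n. scl X (c i) (pw (Suc i)))" for n :: nat and c
  proof (induction n)
    case 0
    then show ?case using cmp_scl_right[OF x x x pw f] by (simp add: pw_Suc)
  next
    case (Suc n)
    have h: "(\<Sum>i\<le>n. scl X (c i) (pw i)) \<in> hom X s s"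
      by (intro V.subspace_sum[OF hom_subspace[OF x x]] pws)
    have "f \<cdot> scl X (c (Suc n)) (pw (Suc n)) = scl X (c (Suc n)) (pw (Suc (Suc n)))"
      using cmp_scl_right[OF x x x pw f] pw_Suc by metis
    then show ?case
      using Suc cmp_add_right[OF x x x h pws f, of "c (Suc n)" "Suc n"]
      unfolding sum.atMost_Suc by simp
  qed
  have ev_pCons0: "ev (Suc n) (pCons 0 q) = f \<cdot> ev n q" for n q
    unfolding ev_def f_sum by (subst sum.atMost_Suc_shift) simp
  have no_root: "p = 0" if "ev (degree p) p = 0" for p
    using that
  proof (induction "degree p" arbitrary: p)
    case 0
    then obtain a where a: "p = [:a:]" using degree_eq_zeroE by metis
    have "scl X a (ide X s) = 0" using 0 by (simp add: a ev_def pw_def)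
    moreover have "ide X s \<noteq> 0" using ide_zero_imp_is_zero[OF x] s by (auto simp: is_simple_def)
    ultimately show ?case using a by simp
  next
    case (Suc n)
    then obtain r where "poly p r = 0" using alg_closed_imp_poly_has_root[of p] by auto
    then obtain q where q: "p = [:- r, 1:] * q" using poly_eq_0_iff_dvd by blast
    have q0: "q \<noteq> 0" using Suc(2) q by auto
    then have dq: "degree q = n" using Suc(2) degree_mult_eq[of "[:- r, 1:]" q] q by simp
    have pq: "coeff p i = coeff (pCons 0 q) i - r * coeff q i" for i
    proof -
      have "p = pCons 0 q - smult r q" using q by simp
      then show ?thesis by simp
    qed
    have "ev (Suc n) p = ev (Suc n) (pCons 0 q) - scl X r (ev (Suc n) q)"
      unfolding ev_def pq V.scale_left_diff_distrib sum_subtractf V.scale_sum_right V.scale_scale ..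
    also have "\<dots> = f \<cdot> ev n q - scl X r (ev n q)"
      using ev_pCons0 ev_deg[of q n] ev_deg[of q "Suc n"] dq by simp
    also have "\<dots> = (f - scl X r (ide X s)) \<cdot> ev n q"
      using cmp_diff_left[OF x x x ev_hom f hom_scl[OF x x ide_in_hom[OF x]]]
        cmp_scl_left[OF x x x ev_hom ide_in_hom[OF x]] ide_cmp[OF x x ev_hom] by simp
    finally have 0: "(f - scl X r (ide X s)) \<cdot> ev n q = 0" using Suc by simp
    have g: "f - scl X r (ide X s) \<in> hom X s s" using hom_diff[OF x x f] hom_scl x ide_in_hom by blast
    have "is_iso X s s (f - scl X r (ide X s))"
      using schur[OF s s g] no by (metis eq_iff_diff_eq_0)
    then have "ev n q = 0"
      using iso_cancel_left[OF x x x _ ev_hom hom_zero[OF x x]] 0 cmp_zero_right[OF x x x g] by simp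
    then have "q = 0" using Suc(1)[of q] dq by simp
    then show ?case using q0 by blast
  qed
  obtain p where "p \<noteq> 0" "ev (degree p) p = 0"
    using endomorphism_annihilating_poly[OF x f] unfolding ev_def pw_def by blast
  then show False using no_root by blast
qed

text \<open>Such a \<open>\<tau>\<close> exhibits \<open>y\<close> itself as the coend of \<open>Hom(y, x)\<^sup>* \<otimes> x\<close>, with universal family \<open>\<psi> \<mapsto> g\<close>.\<close>

definition represents_dual ::
  "('o, 'm::ab_group_add, 'k::field, 'z) lincat_scheme \<Rightarrow> 'o \<Rightarrow> ('m \<Rightarrow> 'k) \<Rightarrow> bool" where
  "represents_dual X y \<tau> \<longleftrightarrow> functional X (hom X y y) \<tau> \<and>
     (\<forall>x\<in>obj X. \<forall>\<psi>. functional X (hom X y x) \<psi> \<longrightarrow>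
        (\<exists>!g. g \<in> hom X x y \<and> (\<forall>u\<in>hom X y x. \<tau> (g \<cdot>\<^bsub>X\<^esub> u) = \<psi> u)))"

section \<open>Functionals on hom spaces and objects representing them\<close>

context linear_category
begin

lemma functionalD_add: "\<lbrakk>functional X V \<psi>; u \<in> V; v \<in> V\<rbrakk> \<Longrightarrow> \<psi> (u + v) = \<psi> u + \<psi> v"
  and functionalD_scl: "\<lbrakk>functional X V \<psi>; u \<in> V\<rbrakk> \<Longrightarrow> \<psi> (scl X a u) = a * \<psi> u"
  by (auto simp: functional_def)

lemma functionalD_zero: "\<lbrakk>functional X (hom X x y) \<psi>; x \<in> obj X; y \<in> obj X\<rbrakk> \<Longrightarrow> \<psi> 0 = 0"
  using functionalD_scl[of "hom X x y" \<psi> 0 0] hom_zero[of x y] by simp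

lemma functional_precompose:
  assumes "functional X (hom X x z) \<psi>" "f \<in> hom X x y" "x \<in> obj X" "y \<in> obj X" "z \<in> obj X"
  shows "functional X (hom X y z) (\<lambda>v. \<psi> (v \<cdot> f))"
  unfolding functional_def
  using assms cmp_add_left[of x y z f] cmp_scl_left[of x y z f] cmp_in_hom[of x y z f]
    functionalD_add[OF assms(1)] functionalD_scl[OF assms(1)] by simp

lemma functional_postcompose:
  assumes "functional X (hom X x z) \<psi>" "f \<in> hom X y z" "x \<in> obj X" "y \<in> obj X" "z \<in> obj X"
  shows "functional X (hom X x y) (\<lambda>v. \<psi> (f \<cdot> v))"
  unfolding functional_def
  using assms cmp_add_right[of x y z _ _ f] cmp_scl_right[of x y z _ f] cmp_in_hom[of x y z _ f]
    functionalD_add[OF assms(1)] functionalD_scl[OF assms(1)] by simp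

lemma represents_dual_zero:
  assumes "is_zero X y"
  shows "represents_dual X y (\<lambda>_. 0)"
proof -
  have y: "y \<in> obj X" using assms by (simp add: is_zero_def)
  have "\<exists>!g. g \<in> hom X x y \<and> (\<forall>u\<in>hom X y x. 0 = \<psi> u)"
    if x: "x \<in> obj X" and \<psi>: "functional X (hom X y x) \<psi>" for x \<psi>
  proof -
    have "hom X y x = {0}" "hom X x y = {0}" using assms x by (auto simp: is_zero_def)
    then show ?thesis using functionalD_zero[OF \<psi> y x] by auto
  qed
  then show ?thesis
    unfolding represents_dual_def by (simp add: functional_def)
qed

text \<open>\<open>?\<tau>\<close> adds the values of \<open>\<alpha>\<close> and
  \<open>\<beta>\<close> on the two diagonal blocks of an endomorphism of \<open>s\<close>. The
  representing morphism is glued from \<open>ga\<close> and \<open>gb\<close>, which represent the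
  restrictions of \<open>\<psi>\<close> along \<open>p\<close> and \<open>q\<close>.\<close>

lemma represents_dual_biproduct:
  assumes a: "a \<in> obj X" "represents_dual X a \<alpha>" and b: "b \<in> obj X" "represents_dual X b \<beta>"
    and s: "is_biproduct X a b s"
  shows "\<exists>\<tau>. represents_dual X s \<tau>"
proof -
  obtain i j p q where ijpq: "i \<in> hom X a s" "j \<in> hom X b s" "p \<in> hom X s a" "q \<in> hom X s b"
    and eqs: "p \<cdot> i = ide X a" "q \<cdot> j = ide X b" "p \<cdot> j = 0" "q \<cdot> i = 0" "i \<cdot> p + j \<cdot> q = ide X s"
    and ob: "s \<in> obj X"
    using s unfolding is_biproduct_def by blast
  let ?\<tau> = "\<lambda>f. \<alpha> (p \<cdot> f \<cdot> i) + \<beta> (q \<cdot> f \<cdot> j)"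
  have fa: "functional X (hom X a a) \<alpha>" and fb: "functional X (hom X b b) \<beta>"
    using a b by (auto simp: represents_dual_def)
  have "functional X (hom X s s) (\<lambda>f. \<alpha> (p \<cdot> f \<cdot> i))"
    using functional_postcompose[OF functional_precompose[OF fa ijpq(1) a(1) ob a(1)] ijpq(3) ob ob a(1)] .
  moreover have "functional X (hom X s s) (\<lambda>f. \<beta> (q \<cdot> f \<cdot> j))"
    using functional_postcompose[OF functional_precompose[OF fb ijpq(2) b(1) ob b(1)] ijpq(4) ob ob b(1)] .
  ultimately have 1: "functional X (hom X s s) ?\<tau>"
    unfolding functional_def by (auto simp: algebra_simps)
  have 2: "\<exists>!g. g \<in> hom X x s \<and> (\<forall>u\<in>hom X s x. ?\<tau> (g \<cdot> u) = \<psi> u)"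
    if x: "x \<in> obj X" and \<psi>: "functional X (hom X s x) \<psi>" for x \<psi>
  proof -
    have comp: "c \<cdot> (g \<cdot> u) \<cdot> k = (c \<cdot> g) \<cdot> (u \<cdot> k)"
      if "g \<in> hom X x s" "u \<in> hom X s x" "k \<in> hom X e s" "c \<in> hom X s e" "e \<in> obj X" for g u k c e
      using that cmp_assoc[of s x s e u g c] cmp_assoc[of e s x e k u "c \<cdot> g"] cmp_in_hom[of x s e g c]
        ob x by simp
    obtain ga where ga: "ga \<in> hom X x a" "\<And>u. u \<in> hom X a x \<Longrightarrow> \<alpha> (ga \<cdot> u) = \<psi> (u \<cdot> p)"
      using a(2) x functional_precompose[OF \<psi> ijpq(3) ob a(1) x] unfolding represents_dual_def by blast
    obtain gb where gb: "gb \<in> hom X x b" "\<And>u. u \<in> hom X b x \<Longrightarrow> \<beta> (gb \<cdot> u) = \<psi> (u \<cdot> q)"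
      using b(2) x functional_precompose[OF \<psi> ijpq(4) ob b(1) x] unfolding represents_dual_def by blast
    define g where "g = i \<cdot> ga + j \<cdot> gb"
    have ig: "i \<cdot> ga \<in> hom X x s" "j \<cdot> gb \<in> hom X x s"
      using cmp_in_hom[OF x a(1) ob ga(1) ijpq(1)] cmp_in_hom[OF x b(1) ob gb(1) ijpq(2)] .
    have g: "g \<in> hom X x s" unfolding g_def using hom_add[OF x ob ig] .
    have pg: "p \<cdot> g = ga"
      unfolding g_def cmp_add_right[OF x ob a(1) ig ijpq(3)]
        cmp_assoc[OF x a(1) ob a(1) ga(1) ijpq(1,3), symmetric]
        cmp_assoc[OF x b(1) ob a(1) gb(1) ijpq(2,3), symmetric]
      by (simp add: eqs ide_cmp[OF x a(1) ga(1)] cmp_zero_left[OF x b(1) a(1) gb(1)])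
    have qg: "q \<cdot> g = gb"
      unfolding g_def cmp_add_right[OF x ob b(1) ig ijpq(4)]
        cmp_assoc[OF x a(1) ob b(1) ga(1) ijpq(1,4), symmetric]
        cmp_assoc[OF x b(1) ob b(1) gb(1) ijpq(2,4), symmetric]
      by (simp add: eqs ide_cmp[OF x b(1) gb(1)] cmp_zero_left[OF x a(1) b(1) ga(1)])
    have \<tau>g: "?\<tau> (g \<cdot> u) = \<psi> u" if u: "u \<in> hom X s x" for u
    proof -
      have ui: "u \<cdot> i \<in> hom X a x" "u \<cdot> j \<in> hom X b x"
        using cmp_in_hom[OF a(1) ob x ijpq(1) u] cmp_in_hom[OF b(1) ob x ijpq(2) u] .
      have "?\<tau> (g \<cdot> u) = \<psi> ((u \<cdot> i) \<cdot> p) + \<psi> ((u \<cdot> j) \<cdot> q)"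
        using comp[OF g u ijpq(1,3) a(1)] comp[OF g u ijpq(2,4) b(1)] pg qg ga(2)[OF ui(1)] gb(2)[OF ui(2)]
        by simp
      also have "\<dots> = \<psi> (u \<cdot> (i \<cdot> p)) + \<psi> (u \<cdot> (j \<cdot> q))"
        using cmp_assoc[OF ob a(1) ob x ijpq(3,1) u] cmp_assoc[OF ob b(1) ob x ijpq(4,2) u] by simp
      also have "\<dots> = \<psi> (u \<cdot> (i \<cdot> p) + u \<cdot> (j \<cdot> q))"
        using functionalD_add[OF \<psi>] cmp_in_hom[OF ob ob x _ u] cmp_in_hom[OF ob a(1) ob ijpq(3,1)]
          cmp_in_hom[OF ob b(1) ob ijpq(4,2)] by simp
      also have "\<dots> = \<psi> (u \<cdot> (i \<cdot> p + j \<cdot> q))"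
        using cmp_add_right[OF ob ob x _ _ u] cmp_in_hom[OF ob a(1) ob ijpq(3,1)]
          cmp_in_hom[OF ob b(1) ob ijpq(4,2)] by simp
      finally show ?thesis using eqs cmp_ide[OF ob x u] by simp
    qed
    have uniq: "g' = g" if g': "g' \<in> hom X x s" "\<And>u. u \<in> hom X s x \<Longrightarrow> ?\<tau> (g' \<cdot> u) = \<psi> u" for g'
    proof -
      have "p \<cdot> g' = ga"
      proof -
        have pg': "p \<cdot> g' \<in> hom X x a" using cmp_in_hom[OF x ob a(1) g'(1) ijpq(3)] .
        have qg': "q \<cdot> g' \<in> hom X x b" using cmp_in_hom[OF x ob b(1) g'(1) ijpq(4)] .
        have "\<alpha> ((p \<cdot> g') \<cdot> v) = \<psi> (v \<cdot> p)" if v: "v \<in> hom X a x" for v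
        proof -
          have vp: "v \<cdot> p \<in> hom X s x" using cmp_in_hom[OF ob a(1) x ijpq(3) v] .
          \<comment> \<open>Testing on \<open>v \<cdot> p\<close> kills the second block because
            \<open>p \<cdot> j = 0\<close>; what is left is the condition that characterises
            \<open>ga\<close>.\<close>
          have "\<beta> ((q \<cdot> g') \<cdot> ((v \<cdot> p) \<cdot> j)) = 0"
            using cmp_assoc[OF b(1) ob a(1) x ijpq(2,3) v] eqs cmp_zero_right[OF b(1) a(1) x v]
              cmp_zero_right[OF b(1) x b(1) qg'] functionalD_zero[OF fb b(1,1)] by simp
          moreover have "(v \<cdot> p) \<cdot> i = v"
            using cmp_assoc[OF a(1) ob a(1) x ijpq(1,3) v] eqs cmp_ide[OF a(1) x v] by simp
          ultimately show ?thesis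
            using g'(2)[OF vp] comp[OF g'(1) vp ijpq(1,3) a(1)] comp[OF g'(1) vp ijpq(2,4) b(1)] by simp
        qed
        then show ?thesis
          using a(2) x functional_precompose[OF \<psi> ijpq(3) ob a(1) x] ga pg'
          unfolding represents_dual_def by blast
      qed
      moreover have "q \<cdot> g' = gb"
      proof -
        have pg': "p \<cdot> g' \<in> hom X x a" using cmp_in_hom[OF x ob a(1) g'(1) ijpq(3)] .
        have qg': "q \<cdot> g' \<in> hom X x b" using cmp_in_hom[OF x ob b(1) g'(1) ijpq(4)] .
        have "\<beta> ((q \<cdot> g') \<cdot> v) = \<psi> (v \<cdot> q)" if v: "v \<in> hom X b x" for v
        proof -
          have vp: "v \<cdot> q \<in> hom X s x" using cmp_in_hom[OF ob b(1) x ijpq(4) v] .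
          have "\<alpha> ((p \<cdot> g') \<cdot> ((v \<cdot> q) \<cdot> i)) = 0"
            using cmp_assoc[OF a(1) ob b(1) x ijpq(1,4) v] eqs cmp_zero_right[OF a(1) b(1) x v]
              cmp_zero_right[OF a(1) x a(1) pg'] functionalD_zero[OF fa a(1,1)] by simp
          moreover have "(v \<cdot> q) \<cdot> j = v"
            using cmp_assoc[OF b(1) ob b(1) x ijpq(2,4) v] eqs cmp_ide[OF b(1) x v] by simp
          ultimately show ?thesis
            using g'(2)[OF vp] comp[OF g'(1) vp ijpq(1,3) a(1)] comp[OF g'(1) vp ijpq(2,4) b(1)] by simp
        qed
        then show ?thesis
          using b(2) x functional_precompose[OF \<psi> ijpq(4) ob b(1) x] gb qg'
          unfolding represents_dual_def by blast
      qed
      moreover have "(i \<cdot> p + j \<cdot> q) \<cdot> g' = i \<cdot> (p \<cdot> g') + j \<cdot> (q \<cdot> g')"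
        using cmp_add_left[OF x ob ob g'(1) cmp_in_hom[OF ob a(1) ob ijpq(3,1)]
            cmp_in_hom[OF ob b(1) ob ijpq(4,2)]]
          cmp_assoc[OF x ob a(1) ob g'(1) ijpq(3,1)] cmp_assoc[OF x ob b(1) ob g'(1) ijpq(4,2)] by simp
      ultimately show ?thesis unfolding g_def using eqs ide_cmp[OF x ob g'(1)] by simp
    qed
    show ?thesis using g \<tau>g uniq by blast
  qed
  show ?thesis unfolding represents_dual_def using 1 2 by blast
qed

end

text \<open>\<open>\<tau>\<close> reads off the scalar by which an endomorphism of \<open>s\<close>
  acts. It represents the dual because the hom space from \<open>s\<close> to a simple object is
  zero or spanned by one isomorphism.\<close>

lemma represents_dual_simple:
  fixes X :: "('o, 'm::ab_group_add, 'k::alg_closed_field, 'z) lincat_scheme" (structure)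
  assumes fin: "finite_category X" and ss: "semisimple_category X" and s: "is_simple X s"
  shows "\<exists>\<tau>. represents_dual X s \<tau>"
proof -
  interpret finite_category X by fact
  have ob: "s \<in> obj X" using s by (simp add: is_simple_def)
  have id0: "ide X s \<noteq> 0" using ide_zero_imp_is_zero[OF ob] s by (auto simp: is_simple_def)
  note ids = ide_in_hom[OF ob]
  define \<tau> where "\<tau> f = (THE a. f = scl X a (ide X s))" for f
  have \<tau>_scl: "\<tau> (scl X a (ide X s)) = a" for a
    unfolding \<tau>_def using id0 by (intro the_equality) auto
  have \<tau>: "f = scl X (\<tau> f) (ide X s)" if "f \<in> hom X s s" for f
    using simple_endomorphism_scalar[OF fin s that] \<tau>_scl by auto
  have fun_\<tau>: "functional X (hom X s s) \<tau>"
    unfolding functional_def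
  proof (intro conjI ballI allI)
    fix u v assume "u \<in> hom X s s" "v \<in> hom X s s"
    then show "\<tau> (u + v) = \<tau> u + \<tau> v" using \<tau> \<tau>_scl by (metis V.scale_left_distrib)
  next
    fix a u assume "u \<in> hom X s s"
    then show "\<tau> (scl X a u) = a * \<tau> u" using \<tau> \<tau>_scl by (metis V.scale_scale)
  qed
  have ex: "\<exists>g\<in>hom X x s. \<forall>u\<in>hom X s x. \<tau> (g \<cdot> u) = \<psi> u"
    if "semisimple_obj X x" "functional X (hom X s x) \<psi>" for x \<psi>
    using that
  proof (induction arbitrary: \<psi>)
    case (zero z)
    then have "z \<in> obj X" "hom X s z = {0}" using ob by (auto simp: is_zero_def)
    then have "\<tau> (0 \<cdot> u) = \<psi> u" if "u \<in> hom X s z" for u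
      using that functionalD_zero[OF zero(2) ob] functionalD_zero[OF fun_\<tau> ob ob]
        cmp_zero_left[OF ob, of z s u] ob by simp
    then show ?case using hom_zero[OF \<open>z \<in> obj X\<close> ob] by blast
  next
    case (sum a t b)
    have obs: "a \<in> obj X" "t \<in> obj X" "b \<in> obj X"
      using sum by (auto simp: is_biproduct_def is_simple_def semisimple_obj_in_obj)
    obtain i j p q where h: "i \<in> hom X a b" "j \<in> hom X t b" "p \<in> hom X b a" "q \<in> hom X b t"
      and pq: "i \<cdot> p + j \<cdot> q = ide X b"
      using sum(3) unfolding is_biproduct_def by blast
    obtain ga where ga: "ga \<in> hom X a s" "\<And>u. u \<in> hom X s a \<Longrightarrow> \<tau> (ga \<cdot> u) = \<psi> (i \<cdot> u)"
      using sum.IH[OF functional_postcompose[OF sum.prems h(1) ob obs(1,3)]] by blast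
    obtain gt where gt: "gt \<in> hom X t s" "\<And>u. u \<in> hom X s t \<Longrightarrow> \<tau> (gt \<cdot> u) = \<psi> (j \<cdot> u)"
    proof (cases "\<exists>w\<in>hom X s t. w \<noteq> 0")
      case False
      have "\<tau> (0 \<cdot> u) = \<psi> (j \<cdot> u)" if "u \<in> hom X s t" for u
      proof -
        have "u = 0" using False that by blast
        then show ?thesis
          using cmp_zero_left[OF ob obs(2) ob that] cmp_zero_right[OF ob obs(2,3) h(2)]
            functionalD_zero[OF sum.prems ob obs(3)] functionalD_zero[OF fun_\<tau> ob ob] by simp
      qed
      then show ?thesis using that hom_zero[OF obs(2) ob] by blast
    next
      case True
      then obtain w where w: "w \<in> hom X s t" "w \<noteq> 0" by blast
      then have iso: "is_iso X s t w" using schur s sum by blast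
      let ?w = "inv_arr X s t w"
      note ws = inv_arr_in_hom[OF ob obs(2) iso] inv_arr_cmp[OF ob obs(2) iso]
        cmp_inv_arr[OF ob obs(2) iso]
      \<comment> \<open>Every \<open>u\<close> from \<open>s\<close> to \<open>t\<close> is a
        multiple of \<open>w\<close>, so only the value at \<open>w\<close> has to be right; this
        fixes the multiple of the inverse of \<open>w\<close>.\<close>
      have "\<tau> (scl X (\<psi> (j \<cdot> w)) ?w \<cdot> u) = \<psi> (j \<cdot> u)" if u: "u \<in> hom X s t" for u
      proof -
        have "?w \<cdot> u \<in> hom X s s" using cmp_in_hom[OF ob obs(2) ob u ws(1)] .
        then obtain c where c: "?w \<cdot> u = scl X c (ide X s)"
          using simple_endomorphism_scalar[OF fin s] by blast
        have "u = (w \<cdot> ?w) \<cdot> u" using ws ide_cmp[OF ob obs(2) u] by simp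
        also have "\<dots> = scl X c w"
          using cmp_assoc[OF ob obs(2) ob obs(2) u ws(1) w(1)] c
            cmp_scl_right[OF ob ob obs(2) ids w(1)] cmp_ide[OF ob obs(2) w(1)] by simp
        finally have uc: "u = scl X c w" .
        have "\<psi> (j \<cdot> u) = c * \<psi> (j \<cdot> w)"
          using uc cmp_scl_right[OF ob obs(2,3) w(1) h(2)]
            functionalD_scl[OF sum.prems cmp_in_hom[OF ob obs(2,3) w(1) h(2)]] by simp
        moreover have "scl X (\<psi> (j \<cdot> w)) ?w \<cdot> u = scl X (\<psi> (j \<cdot> w) * c) (ide X s)"
          using cmp_scl_left[OF ob obs(2) ob u ws(1)] c by simp
        ultimately show ?thesis using \<tau>_scl by simp
      qed
      then show ?thesis using that hom_scl[OF obs(2) ob ws(1)] by blast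
    qed
    define g where "g = ga \<cdot> p + gt \<cdot> q"
    have gs: "ga \<cdot> p \<in> hom X b s" "gt \<cdot> q \<in> hom X b s"
      using cmp_in_hom[OF obs(3,1) ob h(3) ga(1)] cmp_in_hom[OF obs(3,2) ob h(4) gt(1)] .
    have "\<tau> (g \<cdot> u) = \<psi> u" if u: "u \<in> hom X s b" for u
    proof -
      have pu: "p \<cdot> u \<in> hom X s a" "q \<cdot> u \<in> hom X s t"
        using cmp_in_hom[OF ob obs(3,1) u h(3)] cmp_in_hom[OF ob obs(3,2) u h(4)] .
      have "g \<cdot> u = ga \<cdot> (p \<cdot> u) + gt \<cdot> (q \<cdot> u)"
        unfolding g_def using cmp_add_left[OF ob obs(3) ob u gs]
          cmp_assoc[OF ob obs(3,1) ob u h(3) ga(1)] cmp_assoc[OF ob obs(3,2) ob u h(4) gt(1)] by simp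
      then have "\<tau> (g \<cdot> u) = \<psi> (i \<cdot> (p \<cdot> u)) + \<psi> (j \<cdot> (q \<cdot> u))"
        using functionalD_add[OF fun_\<tau>] ga(2)[OF pu(1)] gt(2)[OF pu(2)]
          cmp_in_hom[OF ob obs(1) ob pu(1) ga(1)] cmp_in_hom[OF ob obs(2) ob pu(2) gt(1)] by simp
      also have "\<dots> = \<psi> (i \<cdot> (p \<cdot> u) + j \<cdot> (q \<cdot> u))"
        using functionalD_add[OF sum.prems cmp_in_hom[OF ob obs(1,3) pu(1) h(1)]
            cmp_in_hom[OF ob obs(2,3) pu(2) h(2)]] by simp
      also have "i \<cdot> (p \<cdot> u) + j \<cdot> (q \<cdot> u) = (i \<cdot> p + j \<cdot> q) \<cdot> u"
        using cmp_add_left[OF ob obs(3,3) u cmp_in_hom[OF obs(3,1,3) h(3,1)]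
            cmp_in_hom[OF obs(3,2,3) h(4,2)]]
          cmp_assoc[OF ob obs(3,1,3) u h(3,1)] cmp_assoc[OF ob obs(3,2,3) u h(4,2)] by simp
      finally show ?thesis using pq ide_cmp[OF ob obs(3) u] by simp
    qed
    then show ?case using hom_add[OF obs(3) ob gs] unfolding g_def by blast
  qed
  have uniq: "g = g'" if x: "x \<in> obj X" and g: "g \<in> hom X x s" "g' \<in> hom X x s"
    and eq: "\<And>u. u \<in> hom X s x \<Longrightarrow> \<tau> (g \<cdot> u) = \<tau> (g' \<cdot> u)" for x g g'
  proof (rule ccontr)
    \<comment> \<open>A nonzero difference has a section \<open>u\<close>, and at this
      \<open>u\<close> the two values of \<open>\<tau>\<close> differ by
      \<open>\<tau> (ide X s) = 1\<close>.\<close>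
    assume "g \<noteq> g'"
    then obtain u where u: "u \<in> hom X s x" "(g - g') \<cdot> u = ide X s"
      using semisimple_obj_section[of x s "g - g'"] hom_diff[OF x ob g] ss x s
      unfolding semisimple_category_def by auto
    have gu: "g \<cdot> u \<in> hom X s s" "g' \<cdot> u \<in> hom X s s"
      using cmp_in_hom[OF ob x ob u(1)] g by auto
    have "\<tau> (ide X s + g' \<cdot> u) = \<tau> (g \<cdot> u)"
      using cmp_diff_left[OF ob x ob u(1) g] u(2) by (metis diff_add_cancel)
    then have "\<tau> (ide X s) = 0" using functionalD_add[OF fun_\<tau> ids gu(2)] eq[OF u(1)] by simp
    then show False using \<tau>_scl[of 1] by simp
  qed
  have "\<exists>!g. g \<in> hom X x s \<and> (\<forall>u\<in>hom X s x. \<tau> (g \<cdot> u) = \<psi> u)"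
    if "x \<in> obj X" "functional X (hom X s x) \<psi>" for x \<psi>
    using ex[OF _ that(2)] uniq[OF that(1)] ss that unfolding semisimple_category_def by metis
  then show ?thesis unfolding represents_dual_def using fun_\<tau> by blast
qed

lemma semisimple_represents_dual:
  fixes X :: "('o, 'm::ab_group_add, 'k::alg_closed_field, 'z) lincat_scheme" (structure)
  assumes fin: "finite_category X" and ss: "semisimple_category X" and "y \<in> obj X"
  shows "\<exists>\<tau>. represents_dual X y \<tau>"
proof -
  interpret finite_category X by fact
  have "semisimple_obj X y" using assms by (simp add: semisimple_category_def)
  then show ?thesis
  proof induction
    case (zero z)
    then show ?case using represents_dual_zero by blast
  next
    case (sum a s b)
    then show ?case
      using represents_dual_biproduct[of a _ s _ b] represents_dual_simple[OF fin ss, of s]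
        semisimple_obj_in_obj[of a] by (auto simp: is_simple_def)
  qed
qed

section \<open>The Nakayama functor and traces\<close>

text \<open>Semisimplicity and algebraic closure are present only through the second assumption, so
  \<open>'k\<close> can be any field here.\<close>

locale nakayama_category = linear_category X
  for X :: "('o, 'm::ab_group_add, 'k::field, 'z) lincat_scheme" (structure) +
  fixes N :: "('o, 'm, 'k) nak"
  assumes nakayama: "nakayama X N"
    and ex_represents_dual: "y \<in> obj X \<Longrightarrow> \<exists>\<tau>. represents_dual X y \<tau>"
begin

lemma nfn_linear: "linear_functor X X (nfn N)"
  by (rule nakayama[unfolded nakayama_def, THEN conjunct1])

lemma nfn_obj: "x \<in> obj X \<Longrightarrow> fob (nfn N) x \<in> obj X"
  using nfn_linear by (simp add: linear_functor_def)

lemma nfn_in_hom: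
  "\<lbrakk>x \<in> obj X; y \<in> obj X; f \<in> hom X x y\<rbrakk> \<Longrightarrow> far (nfn N) f \<in> hom X (fob (nfn N) x) (fob (nfn N) y)"
  using nfn_linear by (simp add: linear_functor_def)

lemma nin_dinatural: "y \<in> obj X \<Longrightarrow> dinatural_family X y (fob (nfn N) y) (nin N y)"
  by (rule nakayama[unfolded nakayama_def, THEN conjunct2, THEN conjunct1, THEN bspec, THEN conjunct1])

lemma nin_universal:
  "\<lbrakk>y \<in> obj X; z \<in> obj X; dinatural_family X y z j\<rbrakk> \<Longrightarrow>
    \<exists>!h. h \<in> hom X (fob (nfn N) y) z \<and>
      (\<forall>x\<in>obj X. \<forall>\<psi>. functional X (hom X y x) \<psi> \<longrightarrow> h \<cdot> nin N y x \<psi> = j x \<psi>)"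
  by (rule nakayama[unfolded nakayama_def, THEN conjunct2, THEN conjunct1, THEN bspec, THEN conjunct2,
        THEN bspec, THEN spec, THEN mp])

lemma nfn_nin:
  "\<lbrakk>y \<in> obj X; y' \<in> obj X; f \<in> hom X y y'; x \<in> obj X; functional X (hom X y x) \<psi>\<rbrakk> \<Longrightarrow>
    far (nfn N) f \<cdot> nin N y x \<psi> = nin N y' x (\<lambda>v. \<psi> (v \<cdot> f))"
  by (rule nakayama[unfolded nakayama_def, THEN conjunct2, THEN conjunct2, THEN bspec, THEN bspec,
        THEN bspec, THEN bspec, THEN spec, THEN mp])

lemma
  assumes "y \<in> obj X" "x \<in> obj X" "functional X (hom X y x) \<psi>"
  shows nin_in_hom: "nin N y x \<psi> \<in> hom X x (fob (nfn N) y)"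
    and nin_scl: "nin N y x (\<lambda>v. a * \<psi> v) = scl X a (nin N y x \<psi>)"
    and nin_add: "functional X (hom X y x) \<psi>' \<Longrightarrow> nin N y x (\<lambda>v. \<psi> v + \<psi>' v) = nin N y x \<psi> + nin N y x \<psi>'"
    and nin_cong: "\<lbrakk>functional X (hom X y x) \<psi>'; \<And>v. v \<in> hom X y x \<Longrightarrow> \<psi> v = \<psi>' v\<rbrakk>
      \<Longrightarrow> nin N y x \<psi> = nin N y x \<psi>'"
proof -
  note * = nin_dinatural[OF assms(1), unfolded dinatural_family_def, THEN conjunct1,
      THEN bspec, OF assms(2), THEN spec, THEN mp, OF assms(3)]
  note ** = *[THEN conjunct2, THEN conjunct2, THEN spec, THEN mp]
  show "nin N y x \<psi> \<in> hom X x (fob (nfn N) y)" by (rule *[THEN conjunct1])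
  show "nin N y x (\<lambda>v. a * \<psi> v) = scl X a (nin N y x \<psi>)"
    by (rule *[THEN conjunct2, THEN conjunct1, THEN spec])
  show "nin N y x (\<lambda>v. \<psi> v + \<psi>' v) = nin N y x \<psi> + nin N y x \<psi>'" if "functional X (hom X y x) \<psi>'"
    by (rule **[OF that, THEN conjunct1])
  show "nin N y x \<psi> = nin N y x \<psi>'"
    if "functional X (hom X y x) \<psi>'" "\<And>v. v \<in> hom X y x \<Longrightarrow> \<psi> v = \<psi>' v"
    by (rule **[OF that(1), THEN conjunct2, THEN mp]) (use that(2) in blast)
qed

lemma nin_cmp:
  "\<lbrakk>y \<in> obj X; x \<in> obj X; x' \<in> obj X; f \<in> hom X x x'; functional X (hom X y x') \<psi>\<rbrakk>
    \<Longrightarrow> nin N y x' \<psi> \<cdot> f = nin N y x (\<lambda>v. \<psi> (f \<cdot> v))"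
  by (rule nin_dinatural[unfolded dinatural_family_def, THEN conjunct2, THEN bspec, THEN bspec,
        THEN bspec, THEN spec, THEN mp])

text \<open>\<open>y\<close> with the family \<open>j\<close> is a second coend of the same functor.
  Universality of N gives \<open>h\<close> from N y to \<open>y\<close>; it is inverse to
  \<open>k\<close> because dinaturality turns \<open>k \<cdot> j x \<psi>\<close> into
  \<open>nin N y x \<psi>\<close>.\<close>

lemma nakayama_representation:
  assumes y: "y \<in> obj X" and \<tau>: "represents_dual X y \<tau>"
  defines "k \<equiv> nin N y y \<tau>"
  shows "is_iso X y (fob (nfn N) y) k"
    and "\<lbrakk>x \<in> obj X; functional X (hom X y x) \<psi>\<rbrakk> \<Longrightarrow>
      \<exists>g\<in>hom X x y. nin N y x \<psi> = k \<cdot> g \<and> (\<forall>u\<in>hom X y x. \<tau> (g \<cdot> u) = \<psi> u)"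
proof -
  note Ny = nfn_obj[OF y]
  define j where "j x \<psi> = (THE g. g \<in> hom X x y \<and> (\<forall>u\<in>hom X y x. \<tau> (g \<cdot> u) = \<psi> u))" for x \<psi>
  have fun_\<tau>: "functional X (hom X y y) \<tau>" using \<tau> by (simp add: represents_dual_def)
  have ex1: "\<exists>!g. g \<in> hom X x y \<and> (\<forall>u\<in>hom X y x. \<tau> (g \<cdot> u) = \<psi> u)"
    if "x \<in> obj X" "functional X (hom X y x) \<psi>" for x \<psi>
    using \<tau> that by (simp add: represents_dual_def)
  have j: "j x \<psi> \<in> hom X x y" "\<And>u. u \<in> hom X y x \<Longrightarrow> \<tau> (j x \<psi> \<cdot> u) = \<psi> u"
    if "x \<in> obj X" "functional X (hom X y x) \<psi>" for x \<psi>
    unfolding j_def using theI'[OF ex1[OF that]] by blast+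
  have j_eq: "j x \<psi> = g"
    if "x \<in> obj X" "functional X (hom X y x) \<psi>" "g \<in> hom X x y"
      "\<And>u. u \<in> hom X y x \<Longrightarrow> \<tau> (g \<cdot> u) = \<psi> u" for x \<psi> g
    using ex1[OF that(1,2)] j[OF that(1,2)] that(3,4) by blast
  have din: "dinatural_family X y y j"
    unfolding dinatural_family_def
  proof (intro conjI ballI allI impI)
    fix x \<psi> assume x: "x \<in> obj X" and \<psi>: "functional X (hom X y x) \<psi>"
    note jx = j[OF x \<psi>]
    show "j x \<psi> \<in> hom X x y" by (rule jx)
    show "j x (\<lambda>v. a * \<psi> v) = scl X a (j x \<psi>)" for a
    proof (rule j_eq[OF x])
      show "functional X (hom X y x) (\<lambda>v. a * \<psi> v)"
        using \<psi> by (simp add: functional_def algebra_simps)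
      show "scl X a (j x \<psi>) \<in> hom X x y" by (rule hom_scl[OF x y jx(1)])
      show "\<tau> (scl X a (j x \<psi>) \<cdot> u) = a * \<psi> u" if "u \<in> hom X y x" for u
        using cmp_scl_left[OF y x y that jx(1)] jx(2)[OF that]
          functionalD_scl[OF fun_\<tau> cmp_in_hom[OF y x y that jx(1)]] by simp
    qed
    fix \<psi>' assume \<psi>': "functional X (hom X y x) \<psi>'"
    note jx' = j[OF x \<psi>']
    show "j x (\<lambda>v. \<psi> v + \<psi>' v) = j x \<psi> + j x \<psi>'"
    proof (rule j_eq[OF x])
      show "functional X (hom X y x) (\<lambda>v. \<psi> v + \<psi>' v)"
        using \<psi> \<psi>' by (simp add: functional_def algebra_simps)
      show "j x \<psi> + j x \<psi>' \<in> hom X x y" by (rule hom_add[OF x y jx(1) jx'(1)])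
      show "\<tau> ((j x \<psi> + j x \<psi>') \<cdot> u) = \<psi> u + \<psi>' u" if "u \<in> hom X y x" for u
        using cmp_add_left[OF y x y that jx(1) jx'(1)] jx(2)[OF that] jx'(2)[OF that]
          functionalD_add[OF fun_\<tau> cmp_in_hom[OF y x y that jx(1)] cmp_in_hom[OF y x y that jx'(1)]]
        by simp
    qed
    assume eq: "\<forall>v\<in>hom X y x. \<psi> v = \<psi>' v"
    show "j x \<psi> = j x \<psi>'"
      by (rule j_eq[OF x \<psi> jx'(1)]) (simp add: eq jx'(2))
  next
    fix x x' f \<psi> assume x: "x \<in> obj X" "x' \<in> obj X" and f: "f \<in> hom X x x'"
      and \<psi>: "functional X (hom X y x') \<psi>"
    note jx = j[OF x(2) \<psi>]
    have "j x (\<lambda>v. \<psi> (f \<cdot> v)) = j x' \<psi> \<cdot> f"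
    proof (rule j_eq[OF x(1) functional_postcompose[OF \<psi> f y x]])
      show "j x' \<psi> \<cdot> f \<in> hom X x y" by (rule cmp_in_hom[OF x y f jx(1)])
      show "\<tau> ((j x' \<psi> \<cdot> f) \<cdot> u) = \<psi> (f \<cdot> u)" if "u \<in> hom X y x" for u
        using cmp_assoc[OF y x y that f jx(1)] jx(2)[OF cmp_in_hom[OF y x that f]] by simp
    qed
    then show "j x' \<psi> \<cdot> f = j x (\<lambda>v. \<psi> (f \<cdot> v))" by simp
  qed
  have k: "k \<in> hom X y (fob (nfn N) y)"
    unfolding k_def by (rule nin_in_hom[OF y y fun_\<tau>])
  have kj: "k \<cdot> j x \<psi> = nin N y x \<psi>" if x: "x \<in> obj X" and \<psi>: "functional X (hom X y x) \<psi>" for x \<psi>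
    unfolding k_def nin_cmp[OF y x y j(1)[OF x \<psi>] fun_\<tau>]
    by (rule nin_cong[OF y x functional_postcompose[OF fun_\<tau> j(1)[OF x \<psi>] y x y] \<psi>])
      (rule j(2)[OF x \<psi>])
  show "\<exists>g\<in>hom X x y. nin N y x \<psi> = k \<cdot> g \<and> (\<forall>u\<in>hom X y x. \<tau> (g \<cdot> u) = \<psi> u)"
    if x: "x \<in> obj X" and \<psi>: "functional X (hom X y x) \<psi>" for x \<psi>
    using kj[OF x \<psi>] j[OF x \<psi>] by (intro bexI[of _ "j x \<psi>"]) auto
  obtain h where h: "h \<in> hom X (fob (nfn N) y) y"
    and hn: "\<And>x \<psi>. \<lbrakk>x \<in> obj X; functional X (hom X y x) \<psi>\<rbrakk> \<Longrightarrow> h \<cdot> nin N y x \<psi> = j x \<psi>"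
    using nin_universal[OF y y din] by blast
  have "h \<cdot> k = ide X y"
    unfolding k_def hn[OF y fun_\<tau>]
    by (rule j_eq[OF y fun_\<tau> ide_in_hom[OF y]]) (simp add: ide_cmp[OF y y])
  \<comment> \<open>Two endomorphisms of N y that agree on the universal family are equal.\<close>
  moreover have "k \<cdot> h = ide X (fob (nfn N) y)"
  proof -
    have "k \<cdot> h \<in> hom X (fob (nfn N) y) (fob (nfn N) y)" by (rule cmp_in_hom[OF Ny y Ny h k])
    moreover have "(k \<cdot> h) \<cdot> nin N y x \<psi> = nin N y x \<psi>"
      if x: "x \<in> obj X" and \<psi>: "functional X (hom X y x) \<psi>" for x \<psi>
      using cmp_assoc[OF x Ny y Ny nin_in_hom[OF y x \<psi>] h k] hn[OF x \<psi>] kj[OF x \<psi>] by simp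
    moreover have "ide X (fob (nfn N) y) \<cdot> nin N y x \<psi> = nin N y x \<psi>"
      if x: "x \<in> obj X" and \<psi>: "functional X (hom X y x) \<psi>" for x \<psi>
      using ide_cmp[OF x Ny nin_in_hom[OF y x \<psi>]] .
    ultimately show ?thesis
      using nin_universal[OF y Ny nin_dinatural[OF y]] ide_in_hom[OF Ny] by blast
  qed
  ultimately show "is_iso X y (fob (nfn N) y) k" unfolding is_iso_def using h k by blast
qed

text \<open>\<open>nin N y x \<psi>\<close> is an isomorphism after the morphism that represents
  \<open>\<psi>\<close>, and that morphism determines \<open>\<psi>\<close>. Values outside the hom
  space are arbitrary, hence the restriction on \<open>u\<close>.\<close>

lemma nin_inj:
  assumes y: "y \<in> obj X" and x: "x \<in> obj X"
    and \<psi>: "functional X (hom X y x) \<psi>" and \<psi>': "functional X (hom X y x) \<psi>'"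
    and eq: "nin N y x \<psi> = nin N y x \<psi>'" and u: "u \<in> hom X y x"
  shows "\<psi> u = \<psi>' u"
proof -
  obtain \<tau> where \<tau>: "represents_dual X y \<tau>" using ex_represents_dual[OF y] by blast
  let ?k = "nin N y y \<tau>"
  obtain g where g: "g \<in> hom X x y" "nin N y x \<psi> = ?k \<cdot> g" "\<forall>u\<in>hom X y x. \<tau> (g \<cdot> u) = \<psi> u"
    using nakayama_representation(2)[OF y \<tau> x \<psi>] by blast
  obtain g' where g': "g' \<in> hom X x y" "nin N y x \<psi>' = ?k \<cdot> g'" "\<forall>u\<in>hom X y x. \<tau> (g' \<cdot> u) = \<psi>' u"
    using nakayama_representation(2)[OF y \<tau> x \<psi>'] by blast
  have "g = g'"
    using iso_cancel_left[OF x y nfn_obj[OF y] nakayama_representation(1)[OF y \<tau>] g(1) g'(1)]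
      eq g g' by simp
  then show ?thesis using g g' u by simp
qed

text \<open>Every \<open>g\<close> is the isomorphism \<open>?k\<close> after some morphism into
  \<open>y\<close>, and dinaturality writes such a composite as a structure morphism.\<close>

lemma nin_surj:
  assumes y: "y \<in> obj X" and x: "x \<in> obj X" and g: "g \<in> hom X x (fob (nfn N) y)"
  obtains \<psi> where "functional X (hom X y x) \<psi>" "nin N y x \<psi> = g"
proof -
  obtain \<tau> where \<tau>: "represents_dual X y \<tau>" using ex_represents_dual[OF y] by blast
  have fun_\<tau>: "functional X (hom X y y) \<tau>" using \<tau> by (simp add: represents_dual_def)
  let ?k = "nin N y y \<tau>"
  note k = nakayama_representation(1)[OF y \<tau>]
  note Ny = nfn_obj[OF y]
  let ?h = "inv_arr X y (fob (nfn N) y) ?k"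
  have hg: "?h \<cdot> g \<in> hom X x y" by (rule cmp_in_hom[OF x Ny y g inv_arr_in_hom[OF y Ny k]])
  have "?k \<cdot> (?h \<cdot> g) = nin N y x (\<lambda>v. \<tau> ((?h \<cdot> g) \<cdot> v))"
    by (rule nin_cmp[OF y x y hg fun_\<tau>])
  moreover have "?k \<cdot> (?h \<cdot> g) = g"
    using cmp_assoc[OF x Ny y Ny g inv_arr_in_hom[OF y Ny k] is_iso_in_hom[OF k]]
      cmp_inv_arr[OF y Ny k] ide_cmp[OF x Ny g] by simp
  ultimately show ?thesis
    using that functional_postcompose[OF fun_\<tau> hg y x y] by metis
qed

lemma ex_iso_nfn: "y \<in> obj X \<Longrightarrow> \<exists>h. is_iso X y (fob (nfn N) y) h"
  using ex_represents_dual nakayama_representation(1) by blast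

section \<open>The twisted trace\<close>

text \<open>Injectivity of \<open>nin\<close> makes the value described in
  \<open>nak_pairing\<close> unique.\<close>

lemma twisted_trace_nin:
  assumes y: "y \<in> obj X" and \<psi>: "functional X (hom X y y) \<psi>"
  shows "twisted_trace X N y (nin N y y \<psi>) = \<psi> (ide X y)"
  unfolding twisted_trace_def nak_pairing_def
  using \<psi> nin_inj[OF y y _ \<psi> _ ide_in_hom[OF y]] by (intro the_equality) blast+

text \<open>The working formula: once a morphism into N y is written as
  \<open>nin N y x \<psi>\<close>, statements about the twisted trace become statements about
  \<open>\<psi>\<close>.\<close>

lemma twisted_trace_nin_cmp:
  assumes y: "y \<in> obj X" and x: "x \<in> obj X" and f: "f \<in> hom X y x" and \<psi>: "functional X (hom X y x) \<psi>"
  shows "twisted_trace X N y (nin N y x \<psi> \<cdot> f) = \<psi> f"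
  using nin_cmp[OF y y x f \<psi>] twisted_trace_nin[OF y functional_postcompose[OF \<psi> f y y x]]
    cmp_ide[OF y x f] by simp

lemma twisted_trace_functional:
  assumes y: "y \<in> obj X"
  shows "functional X (hom X y (fob (nfn N) y)) (twisted_trace X N y)"
  unfolding functional_def
proof (intro conjI ballI allI)
  fix u v assume "u \<in> hom X y (fob (nfn N) y)" "v \<in> hom X y (fob (nfn N) y)"
  then obtain \<psi> \<phi> where *: "functional X (hom X y y) \<psi>" "nin N y y \<psi> = u"
    "functional X (hom X y y) \<phi>" "nin N y y \<phi> = v"
    using nin_surj[OF y y] by metis
  have "functional X (hom X y y) (\<lambda>v. \<psi> v + \<phi> v)"
    using * by (simp add: functional_def algebra_simps)
  then show "twisted_trace X N y (u + v) = twisted_trace X N y u + twisted_trace X N y v"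
    using * nin_add[OF y y *(1,3)] twisted_trace_nin[OF y] by metis
next
  fix a v assume "v \<in> hom X y (fob (nfn N) y)"
  then obtain \<psi> where *: "functional X (hom X y y) \<psi>" "nin N y y \<psi> = v"
    using nin_surj[OF y y] by metis
  have "functional X (hom X y y) (\<lambda>v. a * \<psi> v)"
    using * by (simp add: functional_def algebra_simps)
  then show "twisted_trace X N y (scl X a v) = a * twisted_trace X N y v"
    using * nin_scl[OF y y *(1)] twisted_trace_nin[OF y] by metis
qed

text \<open>With \<open>g = nin N x y \<psi>\<close>, both sides equal
  \<open>\<psi> f\<close>.\<close>

lemma twisted_trace_cyclic:
  assumes x: "x \<in> obj X" and y: "y \<in> obj X"
    and f: "f \<in> hom X x y" and g: "g \<in> hom X y (fob (nfn N) x)"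
  shows "twisted_trace X N y (far (nfn N) f \<cdot> g) = twisted_trace X N x (g \<cdot> f)"
proof -
  obtain \<psi> where \<psi>: "functional X (hom X x y) \<psi>" "nin N x y \<psi> = g"
    using nin_surj[OF x y g] by blast
  have "twisted_trace X N y (far (nfn N) f \<cdot> g) = \<psi> (ide X y \<cdot> f)"
    using nfn_nin[OF x y f y \<psi>(1)] twisted_trace_nin[OF y functional_precompose[OF \<psi>(1) f x y y]] \<psi>
    by simp
  then show ?thesis using twisted_trace_nin_cmp[OF x y f \<psi>(1)] \<psi> ide_cmp[OF x y f] by simp
qed

text \<open>\<open>g\<close> is \<open>nin\<close> of a functional that vanishes on the hom space.
  Writing the zero functional as \<open>0 * \<psi>\<close> lets homogeneity of \<open>nin\<close>
  conclude.\<close>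

lemma twisted_trace_nondegenerate_left:
  assumes x: "x \<in> obj X" and y: "y \<in> obj X" and g: "g \<in> hom X y (fob (nfn N) x)"
    and 0: "\<And>f. f \<in> hom X x y \<Longrightarrow> twisted_trace X N x (g \<cdot> f) = 0"
  shows "g = 0"
proof -
  obtain \<psi> where \<psi>: "functional X (hom X x y) \<psi>" "nin N x y \<psi> = g"
    using nin_surj[OF x y g] by blast
  have "nin N x y \<psi> = nin N x y (\<lambda>v. 0 * \<psi> v)"
  proof (rule nin_cong[OF x y \<psi>(1)])
    show "functional X (hom X x y) (\<lambda>v. 0 * \<psi> v)" by (simp add: functional_def)
  qed (use 0 twisted_trace_nin_cmp[OF x y _ \<psi>(1)] \<psi> in auto)
  then show ?thesis using nin_scl[OF x y \<psi>(1), of 0] \<psi> by simp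
qed

text \<open>Testing against the images of the functionals \<tau>(- u) gives
  \<open>\<tau> (f \<cdot> u) = 0\<close> for every \<open>u\<close>. As \<open>\<tau>\<close>
  represents the dual, zero is the only morphism with this property.\<close>

lemma twisted_trace_nondegenerate_right:
  assumes x: "x \<in> obj X" and y: "y \<in> obj X" and f: "f \<in> hom X x y"
    and 0: "\<And>g. g \<in> hom X y (fob (nfn N) x) \<Longrightarrow> twisted_trace X N x (g \<cdot> f) = 0"
  shows "f = 0"
proof -
  obtain \<tau> where \<tau>: "represents_dual X y \<tau>" using ex_represents_dual[OF y] by blast
  have fun_\<tau>: "functional X (hom X y y) \<tau>" using \<tau> by (simp add: represents_dual_def)
  have vanish: "\<tau> (f \<cdot> u) = 0" if u: "u \<in> hom X y x" for u
  proof -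
    have "functional X (hom X x y) (\<lambda>v. \<tau> (v \<cdot> u))"
      by (rule functional_precompose[OF fun_\<tau> u y x y])
    then show ?thesis using 0 nin_in_hom[OF x y] twisted_trace_nin_cmp[OF x y f] by metis
  qed
  have "functional X (hom X y x) (\<lambda>_. 0)" by (simp add: functional_def)
  then have "\<exists>!g. g \<in> hom X x y \<and> (\<forall>u\<in>hom X y x. \<tau> (g \<cdot> u) = 0)"
    using \<tau> x unfolding represents_dual_def by metis
  moreover have "\<tau> (0 \<cdot> u) = 0" if "u \<in> hom X y x" for u
    using cmp_zero_left[OF y x y that] functionalD_zero[OF fun_\<tau> y y] by simp
  ultimately show ?thesis using vanish f hom_zero[OF x y] by blast
qed

text \<open>A trivialization \<open>\<Phi>\<close> of the Nakayama functor turns the twisted trace into a trace: cyclicity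
  of the twisted trace moves \<open>f\<close> across as \<open>N f\<close>, and naturality of \<open>\<Phi>\<close> turns \<open>N f\<close> back into \<open>f\<close>.\<close>

lemma calabi_yau_twisted_trace:
  assumes iso: "\<And>x. x \<in> obj X \<Longrightarrow> is_iso X x (fob (nfn N) x) (\<Phi> x)"
    and natural: "\<And>x y f. \<lbrakk>x \<in> obj X; y \<in> obj X; f \<in> hom X x y\<rbrakk> \<Longrightarrow> far (nfn N) f \<cdot> \<Phi> x = \<Phi> y \<cdot> f"
    and tr: "\<And>x f. \<lbrakk>x \<in> obj X; f \<in> hom X x x\<rbrakk> \<Longrightarrow> tr x f = twisted_trace X N x (\<Phi> x \<cdot> f)"
  shows "calabi_yau X tr"
  unfolding calabi_yau_def
proof (intro conjI ballI impI)
  fix x assume x: "x \<in> obj X"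
  note \<Phi> = is_iso_in_hom[OF iso[OF x]] and Nx = nfn_obj[OF x]
  show "functional X (hom X x x) (tr x)"
    using functional_postcompose[OF twisted_trace_functional[OF x] \<Phi> x x Nx] tr[OF x] hom_add[OF x x]
      hom_scl[OF x x] unfolding functional_def by simp
  fix y assume y: "y \<in> obj X"
  note \<Phi>y = is_iso_in_hom[OF iso[OF y]] and Ny = nfn_obj[OF y]
  have trc: "tr x (g \<cdot> f) = twisted_trace X N x ((\<Phi> x \<cdot> g) \<cdot> f)"
    if "f \<in> hom X x y" "g \<in> hom X y x" for f g
    using tr[OF x cmp_in_hom[OF x y x that]] cmp_assoc[OF x y x Nx that \<Phi>] by simp
  show "tr y (f \<cdot> g) = tr x (g \<cdot> f)" if f: "f \<in> hom X x y" and g: "g \<in> hom X y x" for f g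
  proof -
    have "tr y (f \<cdot> g) = twisted_trace X N y ((\<Phi> y \<cdot> f) \<cdot> g)"
      using tr[OF y cmp_in_hom[OF y x y g f]] cmp_assoc[OF y x y Ny g f \<Phi>y] by simp
    also have "\<dots> = twisted_trace X N y (far (nfn N) f \<cdot> (\<Phi> x \<cdot> g))"
      using natural[OF x y f] cmp_assoc[OF y x Nx Ny g \<Phi> nfn_in_hom[OF x y f]] by simp
    also have "\<dots> = tr x (g \<cdot> f)"
      using twisted_trace_cyclic[OF x y f cmp_in_hom[OF y x Nx g \<Phi>]] trc[OF f g] by simp
    finally show ?thesis .
  qed
  show "f = 0" if f: "f \<in> hom X x y" and 0: "\<forall>g\<in>hom X y x. tr x (g \<cdot> f) = 0" for f
  proof (rule twisted_trace_nondegenerate_right[OF x y f])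
    fix g assume g: "g \<in> hom X y (fob (nfn N) x)"
    \<comment> \<open>Every test morphism into N x is \<open>\<Phi> x\<close> after a morphism into
      \<open>x\<close>, so the assumption on \<open>tr\<close> covers all of them.\<close>
    let ?h = "inv_arr X x (fob (nfn N) x) (\<Phi> x)"
    note h = inv_arr_in_hom[OF x Nx iso[OF x]]
    have hg: "?h \<cdot> g \<in> hom X y x" by (rule cmp_in_hom[OF y Nx x g h])
    have "\<Phi> x \<cdot> (?h \<cdot> g) = g"
      using cmp_assoc[OF y Nx x Nx g h \<Phi>] cmp_inv_arr[OF x Nx iso[OF x]] ide_cmp[OF y Nx g] by simp
    then show "twisted_trace X N x (g \<cdot> f) = 0" using trc[OF f hg] 0 hg by simp
  qed
  show "g = 0" if g: "g \<in> hom X y x" and 0: "\<forall>f\<in>hom X x y. tr x (g \<cdot> f) = 0" for g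
  proof -
    have "\<Phi> x \<cdot> g = 0"
      using twisted_trace_nondegenerate_left[OF x y cmp_in_hom[OF y x Nx g \<Phi>]] trc[OF _ g] 0 by simp
    then show ?thesis
      using iso_cancel_left[OF y x Nx iso[OF x] g hom_zero[OF y x]] cmp_zero_right[OF y x Nx \<Phi>] by simp
  qed
qed

text \<open>The isomorphism \<open>k\<close> spans the morphisms from \<open>y\<close> to N y.
  Non-degeneracy gives it a nonzero twisted trace \<open>t\<close>, so \<open>1 / t\<close> is the
  only normalising factor. For the unit object this is the standard trivialization.\<close>

lemma unique_normalized_trivialization:
  assumes y: "y \<in> obj X" and scalar: "\<And>f. f \<in> hom X y y \<Longrightarrow> \<exists>a. f = scl X a (ide X y)"
    and id0: "ide X y \<noteq> 0"
  shows "\<exists>!s. is_iso X y (fob (nfn N) y) s \<and> twisted_trace X N y s = 1"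
proof -
  obtain \<tau> where \<tau>: "represents_dual X y \<tau>" using ex_represents_dual[OF y] by blast
  have fun_\<tau>: "functional X (hom X y y) \<tau>" using \<tau> by (simp add: represents_dual_def)
  define k where "k = nin N y y \<tau>"
  note Ny = nfn_obj[OF y]
  have k: "is_iso X y (fob (nfn N) y) k"
    unfolding k_def by (rule nakayama_representation(1)[OF y \<tau>])
  note kh = is_iso_in_hom[OF k] inv_arr_in_hom[OF y Ny k] cmp_inv_arr[OF y Ny k] inv_arr_cmp[OF y Ny k]
  let ?h = "inv_arr X y (fob (nfn N) y) k"
  have multiple: "\<exists>a. s = scl X a k" if s: "s \<in> hom X y (fob (nfn N) y)" for s
  proof -
    obtain a where "?h \<cdot> s = scl X a (ide X y)" using scalar[OF cmp_in_hom[OF y Ny y s kh(2)]] by blast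
    then have "k \<cdot> (?h \<cdot> s) = scl X a k"
      using cmp_scl_right[OF y y Ny ide_in_hom[OF y] kh(1)] cmp_ide[OF y Ny kh(1)] by simp
    then show ?thesis using cmp_assoc[OF y Ny y Ny s kh(2,1)] kh(3) ide_cmp[OF y Ny s] by auto
  qed
  define t where "t = twisted_trace X N y k"
  have ttr: "twisted_trace X N y (scl X a k) = a * t" for a
    unfolding t_def using functionalD_scl[OF twisted_trace_functional[OF y] kh(1)] .
  have t0: "t \<noteq> 0"
  proof
    assume "t = 0"
    have "twisted_trace X N y (k \<cdot> f) = 0" if f: "f \<in> hom X y y" for f
      using multiple[OF cmp_in_hom[OF y y Ny f kh(1)]] ttr \<open>t = 0\<close> by auto
    then have "k = 0" using twisted_trace_nondegenerate_left[OF y y kh(1)] by blast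
    then show False using kh(4) cmp_zero_right[OF y Ny y kh(2)] id0 y by simp
  qed
  show ?thesis
  proof (intro ex1I conjI)
    have "scl X t ?h \<cdot> scl X (1 / t) k = ide X y"
      using cmp_scl_left[OF y Ny y hom_scl[OF y Ny kh(1)] kh(2)] cmp_scl_right[OF y Ny y kh(1,2)] kh(4) t0
      by simp
    moreover have "scl X (1 / t) k \<cdot> scl X t ?h = ide X (fob (nfn N) y)"
      using cmp_scl_left[OF Ny y Ny hom_scl[OF Ny y kh(2)] kh(1)] cmp_scl_right[OF Ny y Ny kh(2,1)] kh(3) t0
      by simp
    ultimately show "is_iso X y (fob (nfn N) y) (scl X (1 / t) k)"
      unfolding is_iso_def using hom_scl[OF y Ny kh(1)] hom_scl[OF Ny y kh(2)] by blast
    show "twisted_trace X N y (scl X (1 / t) k) = 1" using ttr t0 by simp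
    fix s assume s: "is_iso X y (fob (nfn N) y) s \<and> twisted_trace X N y s = 1"
    then obtain a where a: "s = scl X a k" using multiple is_iso_in_hom by blast
    then have "a = 1 / t" using s ttr[of a] t0 by (simp add: field_simps)
    then show "s = scl X (1 / t) k" using a by simp
  qed
qed

end

section \<open>Typed arrows in monoidal categories\<close>

text \<open>Coherence computations are carried out with arrows that carry their source and target. Composition
  and tensor product of such triples are total, so that well-typedness is checked by rewriting.\<close>

definition tdom :: "'o \<times> 'm \<times> 'o \<Rightarrow> 'o" where "tdom F = fst F"

definition tcod :: "'o \<times> 'm \<times> 'o \<Rightarrow> 'o" where "tcod F = snd (snd F)"

definition tarr :: "('o, 'm, 'k, 'z) lincat_scheme \<Rightarrow> 'o \<times> 'm \<times> 'o \<Rightarrow> bool" where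
  "tarr X F \<longleftrightarrow> fst F \<in> obj X \<and> snd (snd F) \<in> obj X \<and> fst (snd F) \<in> hom X (fst F) (snd (snd F))"

definition tid :: "('o, 'm, 'k, 'z) lincat_scheme \<Rightarrow> 'o \<Rightarrow> 'o \<times> 'm \<times> 'o" where
  "tid X x = (x, ide X x, x)"

definition tcmp :: "('o, 'm, 'k, 'z) lincat_scheme \<Rightarrow> 'o \<times> 'm \<times> 'o \<Rightarrow> 'o \<times> 'm \<times> 'o \<Rightarrow> 'o \<times> 'm \<times> 'o"
  (infixr "\<bullet>\<index>" 70) where
  "G \<bullet>\<^bsub>X\<^esub> F = (fst F, fst (snd G) \<cdot>\<^bsub>X\<^esub> fst (snd F), snd (snd G))"

definition tiso :: "('o, 'm, 'k, 'z) lincat_scheme \<Rightarrow> 'o \<times> 'm \<times> 'o \<Rightarrow> bool" where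
  "tiso X F \<longleftrightarrow> tarr X F \<and> (\<exists>G. tarr X G \<and> tdom G = tcod F \<and> tcod G = tdom F \<and>
     G \<bullet>\<^bsub>X\<^esub> F = tid X (tdom F) \<and> F \<bullet>\<^bsub>X\<^esub> G = tid X (tcod F))"

lemma tdom_triple [simp]: "tdom (x, f, y) = x" and tcod_triple [simp]: "tcod (x, f, y) = y"
  by (simp_all add: tdom_def tcod_def)

lemma tdom_tcmp [simp]: "tdom (G \<bullet>\<^bsub>X\<^esub> F) = tdom F" and tcod_tcmp [simp]: "tcod (G \<bullet>\<^bsub>X\<^esub> F) = tcod G"
  by (simp_all add: tdom_def tcod_def tcmp_def)

lemma tdom_tid [simp]: "tdom (tid X x) = x" and tcod_tid [simp]: "tcod (tid X x) = x"
  by (simp_all add: tdom_def tcod_def tid_def)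

lemma tarr_triple [simp]: "tarr X (x, f, y) \<longleftrightarrow> x \<in> obj X \<and> y \<in> obj X \<and> f \<in> hom X x y"
  by (simp add: tarr_def)

context linear_category
begin

lemma tarr_obj [simp]: "tarr X F \<Longrightarrow> tdom F \<in> obj X" "tarr X F \<Longrightarrow> tcod F \<in> obj X"
  by (simp_all add: tarr_def tdom_def tcod_def)

lemma tarr_tid [simp]: "x \<in> obj X \<Longrightarrow> tarr X (tid X x)"
  by (simp add: tarr_def tid_def ide_in_hom)

lemma tarr_tcmp [simp]: "\<lbrakk>tarr X F; tarr X G; tcod F = tdom G\<rbrakk> \<Longrightarrow> tarr X (G \<bullet> F)"
  using cmp_in_hom[of "fst F" "fst G" "snd (snd G)" "fst (snd F)" "fst (snd G)"]
  by (simp add: tarr_def tcmp_def tdom_def tcod_def)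

lemma tcmp_assoc [simp]:
  "\<lbrakk>tarr X F; tarr X G; tarr X H; tcod F = tdom G; tcod G = tdom H\<rbrakk> \<Longrightarrow> (H \<bullet> G) \<bullet> F = H \<bullet> (G \<bullet> F)"
  using cmp_assoc[of "fst F" "fst G" "fst H" "snd (snd H)" "fst (snd F)" "fst (snd G)" "fst (snd H)"]
  by (simp add: tarr_def tcmp_def tdom_def tcod_def)

lemma tcmp_tid [simp]: "\<lbrakk>tarr X F; tdom F = x\<rbrakk> \<Longrightarrow> F \<bullet> tid X x = F"
  using cmp_ide[of "fst F" "snd (snd F)" "fst (snd F)"]
  by (cases F) (simp add: tarr_def tcmp_def tdom_def tcod_def tid_def)

lemma tid_tcmp [simp]: "\<lbrakk>tarr X F; tcod F = x\<rbrakk> \<Longrightarrow> tid X x \<bullet> F = F"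
  using ide_cmp[of "fst F" "snd (snd F)" "fst (snd F)"]
  by (cases F) (simp add: tarr_def tcmp_def tdom_def tcod_def tid_def)

text \<open>Composites are kept nested to the right, where \<open>G \<bullet> F\<close> is no longer
  a subterm of a longer chain. This form of an equation rewrites in front of an arbitrary tail
  \<open>T\<close>.\<close>

lemma tcmp_tail:
  "\<lbrakk>G \<bullet> F = R; tarr X F; tarr X G; tcod F = tdom G; tarr X T; tcod T = tdom F\<rbrakk>
    \<Longrightarrow> G \<bullet> (F \<bullet> T) = R \<bullet> T"
  using tcmp_assoc[of T F G] by simp

lemma tiso_tarr [simp]: "tiso X F \<Longrightarrow> tarr X F"
  by (simp add: tiso_def)

lemma tisoE:
  assumes "tiso X F"
  obtains G where "tarr X G" "tdom G = tcod F" "tcod G = tdom F"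
    "G \<bullet> F = tid X (tdom F)" "F \<bullet> G = tid X (tcod F)"
  using assms unfolding tiso_def by blast

lemma tiso_tid: "x \<in> obj X \<Longrightarrow> tiso X (tid X x)"
  unfolding tiso_def by (intro conjI exI[of _ "tid X x"]) simp_all

lemma tiso_tcmp:
  assumes F: "tiso X F" and G: "tiso X G" and eq: "tcod F = tdom G"
  shows "tiso X (G \<bullet> F)"
proof -
  obtain F' where F': "tarr X F'" "tdom F' = tcod F" "tcod F' = tdom F"
    "F' \<bullet> F = tid X (tdom F)" "F \<bullet> F' = tid X (tcod F)" using tisoE[OF F] .
  obtain G' where G': "tarr X G'" "tdom G' = tcod G" "tcod G' = tdom G"
    "G' \<bullet> G = tid X (tdom G)" "G \<bullet> G' = tid X (tcod G)" using tisoE[OF G] .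
  show ?thesis
    unfolding tiso_def using F' G' F G eq
    by (intro conjI exI[of _ "F' \<bullet> G'"]) (simp_all add: tcmp_tail[OF F'(5)] tcmp_tail[OF G'(4)])
qed

lemma tiso_cancel_left:
  assumes F: "tiso X F" and "tarr X G" "tarr X H" "tcod G = tdom F" "tcod H = tdom F"
    and eq: "F \<bullet> G = F \<bullet> H"
  shows "G = H"
proof -
  obtain F' where F': "tarr X F'" "tdom F' = tcod F" "tcod F' = tdom F"
    "F' \<bullet> F = tid X (tdom F)" using tisoE[OF F] .
  have "G = F' \<bullet> (F \<bullet> G)" "H = F' \<bullet> (F \<bullet> H)"
    using assms(1-5) F' by (simp_all add: tcmp_tail[OF F'(4)])
  then show ?thesis using eq by simp
qed

lemma tiso_cancel_right:
  assumes F: "tiso X F" and "tarr X G" "tarr X H" "tdom G = tcod F" "tdom H = tcod F"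
    and eq: "G \<bullet> F = H \<bullet> F"
  shows "G = H"
proof -
  obtain F' where F': "tarr X F'" "tdom F' = tcod F" "tcod F' = tdom F"
    "F \<bullet> F' = tid X (tcod F)" using tisoE[OF F] .
  have "G = (G \<bullet> F) \<bullet> F'" "H = (H \<bullet> F) \<bullet> F'" using assms(1-5) F' by simp_all
  then show ?thesis using eq by simp
qed

lemma tiso_triple: "\<lbrakk>x \<in> obj X; y \<in> obj X; is_iso X x y f\<rbrakk> \<Longrightarrow> tiso X (x, f, y)"
  unfolding tiso_def
  by (intro conjI exI[of _ "(y, inv_arr X x y f, x)"])
    (simp_all add: is_iso_in_hom inv_arr_in_hom inv_arr_cmp cmp_inv_arr tcmp_def tid_def)

lemma
  assumes "x \<in> obj X" "y \<in> obj X" "is_iso X x y f"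
  shows tcmp_inv_arr: "(x, f, y) \<bullet> (y, inv_arr X x y f, x) = tid X y"
    and inv_arr_tcmp: "(y, inv_arr X x y f, x) \<bullet> (x, f, y) = tid X x"
  using assms by (simp_all add: inv_arr_cmp cmp_inv_arr tcmp_def tid_def)

end

section \<open>Tensor products and structure isomorphisms as typed arrows\<close>

definition ttar :: "('o, 'm, 'k, 'z) moncat_scheme \<Rightarrow> 'o \<times> 'm \<times> 'o \<Rightarrow> 'o \<times> 'm \<times> 'o \<Rightarrow> 'o \<times> 'm \<times> 'o"
  (infixr "\<odot>\<index>" 75) where
  "F \<odot>\<^bsub>C\<^esub> G = (fst F \<otimes>\<^bsub>C\<^esub> fst G, fst (snd F) \<boxtimes>\<^bsub>C\<^esub> fst (snd G), snd (snd F) \<otimes>\<^bsub>C\<^esub> snd (snd G))"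

definition tasc :: "('o, 'm, 'k, 'z) moncat_scheme \<Rightarrow> 'o \<Rightarrow> 'o \<Rightarrow> 'o \<Rightarrow> 'o \<times> 'm \<times> 'o" where
  "tasc C a b c = ((a \<otimes>\<^bsub>C\<^esub> b) \<otimes>\<^bsub>C\<^esub> c, asc C a b c, a \<otimes>\<^bsub>C\<^esub> (b \<otimes>\<^bsub>C\<^esub> c))"

definition tiasc :: "('o, 'm, 'k, 'z) moncat_scheme \<Rightarrow> 'o \<Rightarrow> 'o \<Rightarrow> 'o \<Rightarrow> 'o \<times> 'm \<times> 'o" where
  "tiasc C a b c = (a \<otimes>\<^bsub>C\<^esub> (b \<otimes>\<^bsub>C\<^esub> c), iasc C a b c, (a \<otimes>\<^bsub>C\<^esub> b) \<otimes>\<^bsub>C\<^esub> c)"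

definition tlun :: "('o, 'm, 'k, 'z) moncat_scheme \<Rightarrow> 'o \<Rightarrow> 'o \<times> 'm \<times> 'o" where
  "tlun C a = (one C \<otimes>\<^bsub>C\<^esub> a, lun C a, a)"

definition trun :: "('o, 'm, 'k, 'z) moncat_scheme \<Rightarrow> 'o \<Rightarrow> 'o \<times> 'm \<times> 'o" where
  "trun C a = (a \<otimes>\<^bsub>C\<^esub> one C, run C a, a)"

definition tilun :: "('o, 'm, 'k, 'z) moncat_scheme \<Rightarrow> 'o \<Rightarrow> 'o \<times> 'm \<times> 'o" where
  "tilun C a = (a, ilun C a, one C \<otimes>\<^bsub>C\<^esub> a)"

definition tirun :: "('o, 'm, 'k, 'z) moncat_scheme \<Rightarrow> 'o \<Rightarrow> 'o \<times> 'm \<times> 'o" where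
  "tirun C a = (a, irun C a, a \<otimes>\<^bsub>C\<^esub> one C)"

lemmas tmon_defs = tid_def tcmp_def ttar_def tasc_def tiasc_def tlun_def trun_def tilun_def tirun_def

lemma tdom_tcod_monoidal [simp]:
  "tdom (F \<odot>\<^bsub>C\<^esub> G) = tdom F \<otimes>\<^bsub>C\<^esub> tdom G" "tcod (F \<odot>\<^bsub>C\<^esub> G) = tcod F \<otimes>\<^bsub>C\<^esub> tcod G"
  "tdom (tasc C a b c) = (a \<otimes>\<^bsub>C\<^esub> b) \<otimes>\<^bsub>C\<^esub> c" "tcod (tasc C a b c) = a \<otimes>\<^bsub>C\<^esub> (b \<otimes>\<^bsub>C\<^esub> c)"
  "tdom (tiasc C a b c) = a \<otimes>\<^bsub>C\<^esub> (b \<otimes>\<^bsub>C\<^esub> c)" "tcod (tiasc C a b c) = (a \<otimes>\<^bsub>C\<^esub> b) \<otimes>\<^bsub>C\<^esub> c"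
  "tdom (tlun C a) = one C \<otimes>\<^bsub>C\<^esub> a" "tcod (tlun C a) = a"
  "tdom (tilun C a) = a" "tcod (tilun C a) = one C \<otimes>\<^bsub>C\<^esub> a"
  "tdom (trun C a) = a \<otimes>\<^bsub>C\<^esub> one C" "tcod (trun C a) = a"
  "tdom (tirun C a) = a" "tcod (tirun C a) = a \<otimes>\<^bsub>C\<^esub> one C"
  by (simp_all add: tdom_def tcod_def tmon_defs)

context monoidal_category
begin

lemmas [simp] = one_obj tob_obj

lemma tarr_ttar [simp]: "\<lbrakk>tarr C F; tarr C G\<rbrakk> \<Longrightarrow> tarr C (F \<odot> G)"
  using tar_in_hom[of "fst F" "snd (snd F)" "fst G" "snd (snd G)" "fst (snd F)" "fst (snd G)"]
  by (simp add: tarr_def ttar_def)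

lemma tiso_structure [simp]:
  "\<lbrakk>a \<in> obj C; b \<in> obj C; c \<in> obj C\<rbrakk> \<Longrightarrow> tiso C (tasc C a b c)"
  "a \<in> obj C \<Longrightarrow> tiso C (tlun C a)" "a \<in> obj C \<Longrightarrow> tiso C (trun C a)"
  "\<lbrakk>a \<in> obj C; b \<in> obj C; c \<in> obj C\<rbrakk> \<Longrightarrow> tiso C (tiasc C a b c)"
  "a \<in> obj C \<Longrightarrow> tiso C (tilun C a)" "a \<in> obj C \<Longrightarrow> tiso C (tirun C a)"
  unfolding tasc_def tlun_def trun_def tiasc_def tilun_def tirun_def iasc_def ilun_def irun_def
  by (intro tiso_triple is_iso_inv_arr asc_iso lun_iso run_iso tob_obj one_obj; simp)+

lemma tarr_structure [simp]:
  "\<lbrakk>a \<in> obj C; b \<in> obj C; c \<in> obj C\<rbrakk> \<Longrightarrow> tarr C (tasc C a b c)"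
  "a \<in> obj C \<Longrightarrow> tarr C (tlun C a)" "a \<in> obj C \<Longrightarrow> tarr C (trun C a)"
  "\<lbrakk>a \<in> obj C; b \<in> obj C; c \<in> obj C\<rbrakk> \<Longrightarrow> tarr C (tiasc C a b c)"
  "a \<in> obj C \<Longrightarrow> tarr C (tilun C a)" "a \<in> obj C \<Longrightarrow> tarr C (tirun C a)"
  by (simp_all del: tarr_triple)

lemma structure_inverse [simp]:
  "\<lbrakk>a \<in> obj C; b \<in> obj C; c \<in> obj C\<rbrakk> \<Longrightarrow> tasc C a b c \<bullet> tiasc C a b c = tid C (a \<otimes> (b \<otimes> c))"
  "\<lbrakk>a \<in> obj C; b \<in> obj C; c \<in> obj C\<rbrakk> \<Longrightarrow> tiasc C a b c \<bullet> tasc C a b c = tid C ((a \<otimes> b) \<otimes> c)"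
  "a \<in> obj C \<Longrightarrow> tlun C a \<bullet> tilun C a = tid C a"
  "a \<in> obj C \<Longrightarrow> tilun C a \<bullet> tlun C a = tid C (one C \<otimes> a)"
  "a \<in> obj C \<Longrightarrow> trun C a \<bullet> tirun C a = tid C a"
  "a \<in> obj C \<Longrightarrow> tirun C a \<bullet> trun C a = tid C (a \<otimes> one C)"
  unfolding tasc_def tlun_def trun_def tiasc_def tilun_def tirun_def iasc_def ilun_def irun_def
  by (rule tcmp_inv_arr inv_arr_tcmp; simp add: asc_iso lun_iso run_iso)+

lemmas structure_inverse_tail [simp] = structure_inverse[THEN tcmp_tail]

lemma ttar_tid [simp]: "\<lbrakk>a \<in> obj C; b \<in> obj C\<rbrakk> \<Longrightarrow> tid C a \<odot> tid C b = tid C (a \<otimes> b)"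
  by (simp add: tmon_defs tar_ide)

lemma tinterchange:
  "\<lbrakk>tarr C F; tarr C F'; tarr C G; tarr C G'; tcod F = tdom F'; tcod G = tdom G'\<rbrakk>
    \<Longrightarrow> (F' \<odot> G') \<bullet> (F \<odot> G) = (F' \<bullet> F) \<odot> (G' \<bullet> G)"
  using interchange[of "fst F" "fst F'" "snd (snd F')" "fst G" "fst G'" "snd (snd G')" "fst (snd F)"
      "fst (snd F')" "fst (snd G)" "fst (snd G')"]
  by (simp add: tmon_defs tarr_def tdom_def tcod_def)

lemmas tinterchange_tail = tinterchange[THEN tcmp_tail]

lemma tasc_natural:
  "\<lbrakk>tarr C F; tarr C G; tarr C H; tcod F = a; tcod G = b; tcod H = c\<rbrakk> \<Longrightarrow>
    tasc C a b c \<bullet> ((F \<odot> G) \<odot> H) = (F \<odot> (G \<odot> H)) \<bullet> tasc C (tdom F) (tdom G) (tdom H)"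
  using asc_natural[of "fst F" "snd (snd F)" "fst G" "snd (snd G)" "fst H" "snd (snd H)" "fst (snd F)"
      "fst (snd G)" "fst (snd H)"]
  by (simp add: tmon_defs tarr_def tdom_def tcod_def)

lemma tasc_natural_right:
  "\<lbrakk>a \<in> obj C; b \<in> obj C; tarr C H; tcod H = c\<rbrakk> \<Longrightarrow>
    tasc C a b c \<bullet> (tid C (a \<otimes> b) \<odot> H) = (tid C a \<odot> (tid C b \<odot> H)) \<bullet> tasc C a b (tdom H)"
  using tasc_natural[of "tid C a" "tid C b" H a b c] by simp

lemma tiasc_natural:
  assumes "tarr C F" "tarr C G" "tarr C H" "tcod F = a" "tcod G = b" "tcod H = c"
  shows "tiasc C a b c \<bullet> (F \<odot> (G \<odot> H)) = ((F \<odot> G) \<odot> H) \<bullet> tiasc C (tdom F) (tdom G) (tdom H)"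
proof (rule tiso_cancel_left[of "tasc C a b c"])
  show "tasc C a b c \<bullet> tiasc C a b c \<bullet> (F \<odot> G \<odot> H)
    = tasc C a b c \<bullet> ((F \<odot> G) \<odot> H) \<bullet> tiasc C (tdom F) (tdom G) (tdom H)"
    using assms by (auto simp: tcmp_tail[OF tasc_natural])
qed (use assms in auto)

lemma tiasc_natural_left:
  "\<lbrakk>tarr C F; b \<in> obj C; c \<in> obj C; tcod F = a\<rbrakk> \<Longrightarrow>
    tiasc C a b c \<bullet> (F \<odot> tid C (b \<otimes> c)) = ((F \<odot> tid C b) \<odot> tid C c) \<bullet> tiasc C (tdom F) b c"
  using tiasc_natural[of F "tid C b" "tid C c" a b c] by simp

lemma tlun_natural: "\<lbrakk>tarr C F; tcod F = a\<rbrakk> \<Longrightarrow> tlun C a \<bullet> (tid C (one C) \<odot> F) = F \<bullet> tlun C (tdom F)"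
  using lun_natural[of "fst F" "snd (snd F)" "fst (snd F)"]
  by (simp add: tmon_defs tarr_def tdom_def tcod_def)

lemma trun_natural: "\<lbrakk>tarr C F; tcod F = a\<rbrakk> \<Longrightarrow> trun C a \<bullet> (F \<odot> tid C (one C)) = F \<bullet> trun C (tdom F)"
  using run_natural[of "fst F" "snd (snd F)" "fst (snd F)"]
  by (simp add: tmon_defs tarr_def tdom_def tcod_def)

lemma tirun_natural:
  assumes "tarr C F" "tcod F = a"
  shows "tirun C a \<bullet> F = (F \<odot> tid C (one C)) \<bullet> tirun C (tdom F)"
  by (rule tiso_cancel_left[of "trun C a"]) (use assms in \<open>auto simp: tcmp_tail[OF trun_natural]\<close>)

lemma tpentagon:
  "\<lbrakk>a \<in> obj C; b \<in> obj C; c \<in> obj C; d \<in> obj C\<rbrakk> \<Longrightarrow>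
    (tid C a \<odot> tasc C b c d) \<bullet> tasc C a (b \<otimes> c) d \<bullet> (tasc C a b c \<odot> tid C d)
      = tasc C a b (c \<otimes> d) \<bullet> tasc C (a \<otimes> b) c d"
  using pentagon[of a b c d]
    cmp_assoc[of "((a \<otimes> b) \<otimes> c) \<otimes> d" "(a \<otimes> b \<otimes> c) \<otimes> d" "a \<otimes> (b \<otimes> c) \<otimes> d" "a \<otimes> b \<otimes> c \<otimes> d"
      "asc C a b c \<boxtimes> ide C d" "asc C a (b \<otimes> c) d" "ide C a \<boxtimes> asc C b c d"]
    tar_in_hom[of "(a \<otimes> b) \<otimes> c" "a \<otimes> b \<otimes> c" d d "asc C a b c" "ide C d"]
    tar_in_hom[of a a "(b \<otimes> c) \<otimes> d" "b \<otimes> c \<otimes> d" "ide C a" "asc C b c d"]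
  by (simp add: tmon_defs asc_iso is_iso_in_hom ide_in_hom)

lemma ttriangle:
  "\<lbrakk>a \<in> obj C; b \<in> obj C\<rbrakk> \<Longrightarrow>
    (tid C a \<odot> tlun C b) \<bullet> tasc C a (one C) b = trun C a \<odot> tid C b"
  by (simp add: tmon_defs triangle)

lemma tiso_ttar:
  assumes F: "tiso C F" and G: "tiso C G"
  shows "tiso C (F \<odot> G)"
proof -
  obtain F' where F': "tarr C F'" "tdom F' = tcod F" "tcod F' = tdom F"
    "F' \<bullet> F = tid C (tdom F)" "F \<bullet> F' = tid C (tcod F)" using tisoE[OF F] .
  obtain G' where G': "tarr C G'" "tdom G' = tcod G" "tcod G' = tdom G"
    "G' \<bullet> G = tid C (tdom G)" "G \<bullet> G' = tid C (tcod G)" using tisoE[OF G] .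
  show ?thesis
    unfolding tiso_def using F' G' F G
    by (intro conjI exI[of _ "F' \<odot> G'"]) (simp_all add: tinterchange)
qed

text \<open>As \<open>lun\<close> is a natural isomorphism, \<open>1 \<otimes> -\<close> is full. This replaces the usual consequences
  of the pentagon and triangle axioms for the unit constraints.\<close>

lemma one_ttar_full:
  assumes "tarr C F" "a \<in> obj C" "b \<in> obj C" "tdom F = one C \<otimes> a" "tcod F = one C \<otimes> b"
  shows "tid C (one C) \<odot> (tlun C b \<bullet> F \<bullet> tilun C a) = F"
  by (rule tiso_cancel_left[of "tlun C b"]) (use assms in \<open>auto simp: tlun_natural\<close>)

end

section \<open>Dualities without coherence theorems\<close>

locale duality = monoidal_category C
  for C :: "('o, 'm::ab_group_add, 'k::field, 'z) moncat_scheme" (structure) +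
  fixes a b :: 'o and e d :: 'm
  assumes duality: "is_duality C a b e d"
begin

definition ev where "ev = (b \<otimes> a, e, one C)"
definition coev where "coev = (one C, d, a \<otimes> b)"

lemma dual_obj [simp]: "a \<in> obj C" "b \<in> obj C"
  using duality by (auto simp: is_duality_def)

lemma ev_coev [simp]:
  "tarr C ev" "tdom ev = b \<otimes> a" "tcod ev = one C"
  "tarr C coev" "tdom coev = one C" "tcod coev = a \<otimes> b"
  using duality by (auto simp: is_duality_def ev_def coev_def)

lemma snake_left: "trun C a \<bullet> (tid C a \<odot> ev) \<bullet> tasc C a b a \<bullet> (coev \<odot> tid C a) = tlun C a"
proof -
  have "((trun C a \<bullet> (tid C a \<odot> ev)) \<bullet> tasc C a b a) \<bullet> (coev \<odot> tid C a) = tlun C a"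
    using duality by (simp add: is_duality_def tmon_defs ev_def coev_def del: tcmp_assoc)
  then show ?thesis by simp
qed

lemma snake_right: "tlun C b \<bullet> (ev \<odot> tid C b) \<bullet> tiasc C b a b \<bullet> (tid C b \<odot> coev) = trun C b"
proof -
  have "((tlun C b \<bullet> (ev \<odot> tid C b)) \<bullet> tiasc C b a b) \<bullet> (tid C b \<odot> coev) = trun C b"
    using duality by (simp add: is_duality_def tmon_defs ev_def coev_def del: tcmp_assoc)
  then show ?thesis by simp
qed

text \<open>Naturality and interchange move \<open>G\<close> to the far left, and the left snake
  identity remains.\<close>

lemma ev_of_coev:
  assumes [simp]: "tarr C G" "tdom G = a" "tcod G = c"
  shows "trun C c \<bullet> (tid C c \<odot> ev) \<bullet> tasc C c b a \<bullet> (((G \<odot> tid C b) \<bullet> coev) \<odot> tid C a)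
    = G \<bullet> tlun C a"
proof -
  have [simp]: "c \<in> obj C" using tarr_obj(2)[of G] by simp
  have 1: "((G \<odot> tid C b) \<bullet> coev) \<odot> tid C a = ((G \<odot> tid C b) \<odot> tid C a) \<bullet> (coev \<odot> tid C a)"
    by (simp add: tinterchange)
  have 2: "(tid C c \<odot> ev) \<bullet> (G \<odot> tid C (b \<otimes> a)) = (G \<odot> tid C (one C)) \<bullet> (tid C a \<odot> ev)"
    by (simp add: tinterchange)
  show ?thesis
    by (simp add: 1 tcmp_tail[OF tasc_natural] tcmp_tail[OF 2] tcmp_tail[OF trun_natural] snake_left)
qed

lemma coev_cancel:
  assumes "tarr C G" "tdom G = a" "tcod G = c" "tarr C G'" "tdom G' = a" "tcod G' = c"
    and "(G \<odot> tid C b) \<bullet> coev = (G' \<odot> tid C b) \<bullet> coev"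
  shows "G = G'"
  by (rule tiso_cancel_right[of "tlun C a"])
    (use assms ev_of_coev[OF assms(1-3)] ev_of_coev[OF assms(4-6)] in simp_all)

text \<open>The right snake identity recovers \<open>F \<bullet> trun C w\<close> from
  \<open>ev \<bullet> (F \<odot> tid C a)\<close> alone.\<close>

lemma ev_cancel:
  assumes G [simp]: "tarr C G" "tdom G = w" "tcod G = b"
    and G' [simp]: "tarr C G'" "tdom G' = w" "tcod G' = b"
    and eq: "ev \<bullet> (G \<odot> tid C a) = ev \<bullet> (G' \<odot> tid C a)"
  shows "G = G'"
proof -
  have [simp]: "w \<in> obj C" using tarr_obj(1)[OF G(1)] by simp
  have *: "F \<bullet> trun C w
      = tlun C b \<bullet> ((ev \<bullet> (F \<odot> tid C a)) \<odot> tid C b) \<bullet> tiasc C w a b \<bullet> (tid C w \<odot> coev)"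
    if [simp]: "tarr C F" "tdom F = w" "tcod F = b" for F
  proof -
    have 1: "(ev \<bullet> (F \<odot> tid C a)) \<odot> tid C b = (ev \<odot> tid C b) \<bullet> ((F \<odot> tid C a) \<odot> tid C b)"
      by (simp add: tinterchange)
    have 2: "((F \<odot> tid C a) \<odot> tid C b) \<bullet> tiasc C w a b = tiasc C b a b \<bullet> (F \<odot> tid C (a \<otimes> b))"
      by (simp add: tiasc_natural_left)
    have 3: "(F \<odot> tid C (a \<otimes> b)) \<bullet> (tid C w \<odot> coev) = (tid C b \<odot> coev) \<bullet> (F \<odot> tid C (one C))"
      by (simp add: tinterchange)
    have "tlun C b \<bullet> ((ev \<bullet> (F \<odot> tid C a)) \<odot> tid C b) \<bullet> tiasc C w a b \<bullet> (tid C w \<odot> coev)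
      = (tlun C b \<bullet> (ev \<odot> tid C b) \<bullet> tiasc C b a b \<bullet> (tid C b \<odot> coev)) \<bullet> (F \<odot> tid C (one C))"
      by (simp add: 1 tcmp_tail[OF 2] 3)
    then show ?thesis by (simp add: snake_right trun_natural)
  qed
  show ?thesis
    by (rule tiso_cancel_right[of "trun C w"]) (simp_all add: * eq)
qed

text \<open>The candidate \<open>G\<close> for a given pairing \<open>E\<close> satisfies \<open>ev \<bullet> (G \<otimes> 1) = \<rho> \<bullet> E \<bullet> \<theta>\<close> with
  automorphisms \<open>\<rho>\<close>, \<open>\<theta>\<close> that do not depend on \<open>E\<close>. They are identities by coherence, but invertibility
  suffices.\<close>

lemma ex_of_pairing:
  assumes w [simp]: "w \<in> obj C" and E0: "tarr C E0" "tdom E0 = w \<otimes> a" "tcod E0 = one C"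
  shows "\<exists>G. tarr C G \<and> tdom G = w \<and> tcod G = b \<and> ev \<bullet> (G \<odot> tid C a) = E0"
proof -
  let ?I = "one C"
  \<comment> \<open>The candidate is the usual transpose of the pairing along
    \<open>coev\<close>.\<close>
  define G where "G E = tlun C b \<bullet> (E \<odot> tid C b) \<bullet> tiasc C w a b \<bullet> (tid C w \<odot> coev) \<bullet> tirun C w" for E
  \<comment> \<open>\<open>Z\<close> is the left snake composite without its last unit constraint,
    hence invertible. \<open>\<Theta>\<close> collects what stays to the right of \<open>E\<close>
    once \<open>E\<close> has been moved to the front; it is invertible because it can be expressed
    through \<open>Z\<close>.\<close>
  define Z where "Z = (tid C a \<odot> ev) \<bullet> tasc C a b a \<bullet> (coev \<odot> tid C a)"
  define \<Theta> where "\<Theta> = (tid C (w \<otimes> a) \<odot> ev) \<bullet> tasc C (w \<otimes> a) b a \<bullet> (tiasc C w a b \<odot> tid C a) \<bullet>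
    ((tid C w \<odot> coev) \<odot> tid C a) \<bullet> ((tirun C w \<bullet> tlun C w) \<odot> tid C a)"
  have Z_arr [simp]: "tarr C Z" "tdom Z = ?I \<otimes> a" "tcod Z = a \<otimes> ?I" by (simp_all add: Z_def)
  have "Z = tirun C a \<bullet> tlun C a"
    by (rule tiso_cancel_left[of "trun C a"]) (simp_all add: Z_def snake_left)
  then have Z_iso: "tiso C Z" by (simp add: tiso_tcmp)
  have Theta_arr [simp]: "tarr C \<Theta>" "tdom \<Theta> = (?I \<otimes> w) \<otimes> a" "tcod \<Theta> = (w \<otimes> a) \<otimes> ?I"
    by (simp_all add: \<Theta>_def)
  \<comment> \<open>The pentagon, solved for the inverse associator.\<close>
  have p: "tasc C w a (b \<otimes> a) \<bullet> tasc C (w \<otimes> a) b a \<bullet> (tiasc C w a b \<odot> tid C a)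
    = (tid C w \<odot> tasc C a b a) \<bullet> tasc C w (a \<otimes> b) a"
  proof -
    have "(tasc C w a b \<odot> tid C a) \<bullet> (tiasc C w a b \<odot> tid C a) = tid C ((w \<otimes> a \<otimes> b) \<otimes> a)"
      by (simp add: tinterchange)
    then have "((tid C w \<odot> tasc C a b a) \<bullet> tasc C w (a \<otimes> b) a \<bullet> (tasc C w a b \<odot> tid C a)) \<bullet>
        (tiasc C w a b \<odot> tid C a) = (tid C w \<odot> tasc C a b a) \<bullet> tasc C w (a \<otimes> b) a"
      by simp
    then show ?thesis by (simp add: tpentagon)
  qed
  have "\<Theta> = tiasc C w a ?I \<bullet> (tid C w \<odot> Z) \<bullet> tasc C w ?I a \<bullet> ((tirun C w \<bullet> tlun C w) \<odot> tid C a)"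
  proof (rule tiso_cancel_left[of "tasc C w a ?I"])
    let ?R = "(tirun C w \<bullet> tlun C w) \<odot> tid C a"
    have q: "tid C w \<odot> Z = (tid C w \<odot> (tid C a \<odot> ev)) \<bullet> (tid C w \<odot> tasc C a b a) \<bullet>
        (tid C w \<odot> (coev \<odot> tid C a))"
      by (simp add: Z_def tinterchange)
    have r: "tasc C w a (b \<otimes> a) \<bullet> tasc C (w \<otimes> a) b a \<bullet> (tiasc C w a b \<odot> tid C a) \<bullet> T
        = (tid C w \<odot> tasc C a b a) \<bullet> tasc C w (a \<otimes> b) a \<bullet> T"
      if "tarr C T" "tcod T = (w \<otimes> (a \<otimes> b)) \<otimes> a" for T
    proof -
      have "(tasc C w a (b \<otimes> a) \<bullet> tasc C (w \<otimes> a) b a \<bullet> (tiasc C w a b \<odot> tid C a)) \<bullet> T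
        = ((tid C w \<odot> tasc C a b a) \<bullet> tasc C w (a \<otimes> b) a) \<bullet> T" by (simp only: p)
      then show ?thesis using that by simp
    qed
    show "tasc C w a ?I \<bullet> \<Theta> = tasc C w a ?I \<bullet> tiasc C w a ?I \<bullet> (tid C w \<odot> Z) \<bullet> tasc C w ?I a \<bullet> ?R"
      by (simp add: \<Theta>_def q r tcmp_tail[OF tasc_natural_right] tcmp_tail[OF tasc_natural])
  qed simp_all
  then have Theta_iso: "tiso C \<Theta>"
    by (simp add: tiso_tcmp tiso_ttar Z_iso tiso_tid)
  define \<rho> where "\<rho> = tlun C ?I \<bullet> tirun C ?I"
  define \<theta> where "\<theta> = trun C (w \<otimes> a) \<bullet> \<Theta> \<bullet> tiasc C ?I w a \<bullet> tilun C (w \<otimes> a)"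
  have rho: "tiso C \<rho>" "tdom \<rho> = ?I" "tcod \<rho> = ?I" by (simp_all add: \<rho>_def tiso_tcmp)
  have theta: "tiso C \<theta>" "tdom \<theta> = w \<otimes> a" "tcod \<theta> = w \<otimes> a"
    by (simp_all add: \<theta>_def tiso_tcmp Theta_iso)
  have main: "ev \<bullet> (G E \<odot> tid C a) = \<rho> \<bullet> E \<bullet> \<theta>" and G_arr: "tarr C (G E)" "tdom (G E) = w" "tcod (G E) = b"
    if E [simp]: "tarr C E" "tdom E = w \<otimes> a" "tcod E = ?I" for E
  proof -
    show GE [simp]: "tarr C (G E)" "tdom (G E) = w" "tcod (G E) = b" by (simp_all add: G_def)
    \<comment> \<open>By fullness, \<open>X\<close> is the unit object tensored with
      \<open>G E\<close>. This removes the leading \<open>tlun C b\<close>, whose compatibility with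
      tensoring by \<open>a\<close> is a unit law that is not among the axioms.\<close>
    define X where "X = (E \<odot> tid C b) \<bullet> tiasc C w a b \<bullet> (tid C w \<odot> coev) \<bullet> tirun C w \<bullet> tlun C w"
    have X [simp]: "tarr C X" "tdom X = ?I \<otimes> w" "tcod X = ?I \<otimes> b" by (simp_all add: X_def)
    have "G E = tlun C b \<bullet> X \<bullet> tilun C w" by (simp add: G_def X_def)
    then have full: "tid C ?I \<odot> G E = X" using one_ttar_full[of X w b] by simp
    have Xa: "X \<odot> tid C a = ((E \<odot> tid C b) \<odot> tid C a) \<bullet> (tiasc C w a b \<odot> tid C a) \<bullet>
        ((tid C w \<odot> coev) \<odot> tid C a) \<bullet> ((tirun C w \<bullet> tlun C w) \<odot> tid C a)"
      by (simp add: X_def tinterchange)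
    have swap: "(tid C ?I \<odot> ev) \<bullet> (E \<odot> tid C (b \<otimes> a)) = (E \<odot> tid C ?I) \<bullet> (tid C (w \<otimes> a) \<odot> ev)"
      by (simp add: tinterchange)
    have "(tid C ?I \<odot> (ev \<bullet> (G E \<odot> tid C a))) \<bullet> tasc C ?I w a
        = (tid C ?I \<odot> ev) \<bullet> (tid C ?I \<odot> (G E \<odot> tid C a)) \<bullet> tasc C ?I w a"
      by (simp add: tinterchange tinterchange_tail)
    also have "\<dots> = (tid C ?I \<odot> ev) \<bullet> tasc C ?I b a \<bullet> (X \<odot> tid C a)"
      using tasc_natural[of "tid C ?I" "G E" "tid C a" ?I b a] by (simp add: full)
    also have "\<dots> = (E \<odot> tid C ?I) \<bullet> \<Theta>"
      by (simp add: Xa \<Theta>_def tcmp_tail[OF tasc_natural] tcmp_tail[OF swap])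
    finally have 1: "(tid C ?I \<odot> (ev \<bullet> (G E \<odot> tid C a))) \<bullet> tasc C ?I w a = (E \<odot> tid C ?I) \<bullet> \<Theta>" .
    have "ev \<bullet> (G E \<odot> tid C a) = (ev \<bullet> (G E \<odot> tid C a)) \<bullet> tlun C (w \<otimes> a) \<bullet> tilun C (w \<otimes> a)"
      by simp
    also have "\<dots> = tlun C ?I \<bullet> (tid C ?I \<odot> (ev \<bullet> (G E \<odot> tid C a))) \<bullet> tilun C (w \<otimes> a)"
      using tcmp_tail[OF tlun_natural[of "ev \<bullet> (G E \<odot> tid C a)" ?I], of "tilun C (w \<otimes> a)"] by simp
    also have "\<dots> = tlun C ?I \<bullet> ((tid C ?I \<odot> (ev \<bullet> (G E \<odot> tid C a))) \<bullet> tasc C ?I w a) \<bullet>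
        tiasc C ?I w a \<bullet> tilun C (w \<otimes> a)"
      by simp
    also have "\<dots> = tlun C ?I \<bullet> ((tirun C ?I \<bullet> trun C ?I) \<bullet> (E \<odot> tid C ?I)) \<bullet> \<Theta> \<bullet> tiasc C ?I w a \<bullet> tilun C (w \<otimes> a)"
      unfolding 1 by simp
    also have "\<dots> = \<rho> \<bullet> E \<bullet> \<theta>"
      by (simp add: \<rho>_def \<theta>_def tcmp_tail[OF trun_natural] del: structure_inverse structure_inverse_tail)
    finally show "ev \<bullet> (G E \<odot> tid C a) = \<rho> \<bullet> E \<bullet> \<theta>" .
  qed
  obtain \<rho>' where \<rho>': "tarr C \<rho>'" "tdom \<rho>' = ?I" "tcod \<rho>' = ?I" "\<rho> \<bullet> \<rho>' = tid C ?I"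
    using tisoE[OF rho(1)] rho by metis
  obtain \<theta>' where \<theta>': "tarr C \<theta>'" "tdom \<theta>' = w \<otimes> a" "tcod \<theta>' = w \<otimes> a" "\<theta>' \<bullet> \<theta> = tid C (w \<otimes> a)"
    using tisoE[OF theta(1)] theta by metis
  \<comment> \<open>The map \<open>E \<mapsto> \<rho> \<bullet> E \<bullet> \<theta>\<close> is
    onto, so the candidate is taken at a preimage of \<open>E0\<close>.\<close>
  let ?E = "\<rho>' \<bullet> E0 \<bullet> \<theta>'"
  have "tarr C ?E" "tdom ?E = w \<otimes> a" "tcod ?E = ?I" using \<rho>' \<theta>' E0 by simp_all
  moreover have "\<rho> \<bullet> ?E \<bullet> \<theta> = E0"
    using \<rho>' \<theta>' E0 rho theta by (simp add: tcmp_tail[OF \<rho>'(4)])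
  ultimately show ?thesis using main[of ?E] G_arr[of ?E] by metis
qed

text \<open>Tensoring the transpose of a morphism \<open>S\<close> from the unit to
  \<open>c \<otimes> b\<close> with \<open>b\<close> and composing with \<open>coev\<close> returns
  \<open>S\<close> followed by isomorphisms. So the transpose determines the morphism.\<close>

lemma coev_ext:
  assumes T [simp]: "tarr C T" "tdom T = one C" "tcod T = c \<otimes> b"
    and T' [simp]: "tarr C T'" "tdom T' = one C" "tcod T' = c \<otimes> b"
    and c [simp]: "c \<in> obj C"
    and eq: "trun C c \<bullet> (tid C c \<odot> ev) \<bullet> tasc C c b a \<bullet> (T \<odot> tid C a)
      = trun C c \<bullet> (tid C c \<odot> ev) \<bullet> tasc C c b a \<bullet> (T' \<odot> tid C a)"
  shows "T = T'"
proof -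
  let ?I = "one C"
  \<comment> \<open>Coherence would identify \<open>M\<close> with the right unit constraint of
    \<open>c \<otimes> b\<close>; invertibility is enough. In this form the right snake identity can
    be substituted for its factor \<open>trun C b\<close>.\<close>
  define M where "M = (tid C c \<odot> trun C b) \<bullet> tasc C c b ?I"
  have M: "tiso C M" "tdom M = (c \<otimes> b) \<otimes> ?I" "tcod M = c \<otimes> b"
    by (simp_all add: M_def tiso_tcmp tiso_ttar tiso_tid)
  have tri: "trun C c \<odot> tid C b = (tid C c \<odot> tlun C b) \<bullet> tasc C c ?I b" by (simp add: ttriangle)
  have pent: "tasc C c (b \<otimes> a) b \<bullet> (tasc C c b a \<odot> tid C b) \<bullet> tiasc C (c \<otimes> b) a b
    = (tid C c \<odot> tiasc C b a b) \<bullet> tasc C c b (a \<otimes> b)"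
  proof (rule tiso_cancel_left[of "tid C c \<odot> tasc C b a b"])
    have 1: "((tid C c \<odot> tasc C b a b) \<bullet> tasc C c (b \<otimes> a) b \<bullet> (tasc C c b a \<odot> tid C b)) \<bullet> tiasc C (c \<otimes> b) a b
      = tasc C c b (a \<otimes> b)" by (subst tpentagon) simp_all
    have 2: "(tid C c \<odot> tasc C b a b) \<bullet> (tid C c \<odot> tiasc C b a b) = tid C (c \<otimes> (b \<otimes> (a \<otimes> b)))"
      by (simp add: tinterchange)
    show "(tid C c \<odot> tasc C b a b) \<bullet> tasc C c (b \<otimes> a) b \<bullet> (tasc C c b a \<odot> tid C b) \<bullet> tiasc C (c \<otimes> b) a b
      = (tid C c \<odot> tasc C b a b) \<bullet> (tid C c \<odot> tiasc C b a b) \<bullet> tasc C c b (a \<otimes> b)"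
      using 1 by (simp add: tcmp_tail[OF 2])
  qed (simp_all add: tiso_ttar tiso_tid)
  have *: "((trun C c \<bullet> (tid C c \<odot> ev) \<bullet> tasc C c b a \<bullet> (S \<odot> tid C a)) \<odot> tid C b) \<bullet>
      tiasc C ?I a b \<bullet> (tid C ?I \<odot> coev) \<bullet> tirun C ?I = M \<bullet> tirun C (c \<otimes> b) \<bullet> S"
    if [simp]: "tarr C S" "tdom S = ?I" "tcod S = c \<otimes> b" for S
  proof -
    have 1: "(trun C c \<bullet> (tid C c \<odot> ev) \<bullet> tasc C c b a \<bullet> (S \<odot> tid C a)) \<odot> tid C b
      = (trun C c \<odot> tid C b) \<bullet> ((tid C c \<odot> ev) \<odot> tid C b) \<bullet> (tasc C c b a \<odot> tid C b) \<bullet>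
        ((S \<odot> tid C a) \<odot> tid C b)"
      by (simp add: tinterchange)
    have 2: "((S \<odot> tid C a) \<odot> tid C b) \<bullet> tiasc C ?I a b = tiasc C (c \<otimes> b) a b \<bullet> (S \<odot> tid C (a \<otimes> b))"
      by (simp add: tiasc_natural_left)
    have 3: "(S \<odot> tid C (a \<otimes> b)) \<bullet> (tid C ?I \<odot> coev) = (tid C (c \<otimes> b) \<odot> coev) \<bullet> (S \<odot> tid C ?I)"
      by (simp add: tinterchange)
    have 4: "(S \<odot> tid C ?I) \<bullet> tirun C ?I = tirun C (c \<otimes> b) \<bullet> S"
      by (simp add: tirun_natural)
    have 5: "tasc C c (b \<otimes> a) b \<bullet> (tasc C c b a \<odot> tid C b) \<bullet> tiasc C (c \<otimes> b) a b \<bullet> U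
      = (tid C c \<odot> tiasc C b a b) \<bullet> tasc C c b (a \<otimes> b) \<bullet> U"
      if "tarr C U" "tcod U = (c \<otimes> b) \<otimes> (a \<otimes> b)" for U
    proof -
      have "(tasc C c (b \<otimes> a) b \<bullet> (tasc C c b a \<odot> tid C b) \<bullet> tiasc C (c \<otimes> b) a b) \<bullet> U
        = ((tid C c \<odot> tiasc C b a b) \<bullet> tasc C c b (a \<otimes> b)) \<bullet> U" by (simp only: pent)
      then show ?thesis using that by simp
    qed
    have 6: "tid C c \<odot> trun C b = (tid C c \<odot> tlun C b) \<bullet> (tid C c \<odot> (ev \<odot> tid C b)) \<bullet>
        (tid C c \<odot> tiasc C b a b) \<bullet> (tid C c \<odot> (tid C b \<odot> coev))"
      by (simp add: tinterchange snake_right)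
    show ?thesis
      by (simp add: 1 tri M_def 6 tcmp_tail[OF tasc_natural] tcmp_tail[OF tasc_natural_right]
          tcmp_tail[OF 2] tcmp_tail[OF 3] 4 5)
  qed
  have "M \<bullet> (tirun C (c \<otimes> b) \<bullet> T) = M \<bullet> (tirun C (c \<otimes> b) \<bullet> T')"
    using *[of T] *[of T'] eq by simp
  then have "tirun C (c \<otimes> b) \<bullet> T = tirun C (c \<otimes> b) \<bullet> T'"
    by (rule tiso_cancel_left[OF M(1), rotated -1]) (simp_all add: M)
  then show ?thesis
    by (rule tiso_cancel_left[of "tirun C (c \<otimes> b)", rotated -1]) simp_all
qed

end

section \<open>Module categories and relative Serre functors\<close>

definition tev :: "('o, 'm, 'k, 'z) rigcat_scheme \<Rightarrow> 'o \<Rightarrow> 'o \<times> 'm \<times> 'o" where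
  "tev C a = (rd C a \<otimes>\<^bsub>C\<^esub> a, rdev C a, one C)"

definition tcoev :: "('o, 'm, 'k, 'z) rigcat_scheme \<Rightarrow> 'o \<Rightarrow> 'o \<times> 'm \<times> 'o" where
  "tcoev C a = (one C, rdco C a, a \<otimes>\<^bsub>C\<^esub> rd C a)"

definition tdual :: "('o, 'm, 'k, 'z) rigcat_scheme \<Rightarrow> 'o \<times> 'm \<times> 'o \<Rightarrow> 'o \<times> 'm \<times> 'o" where
  "tdual C F = (rd C (tcod F), dual_arr C (tdom F) (tcod F) (fst (snd F)), rd C (tdom F))"

lemma tdom_tcod_dual [simp]:
  "tdom (tev C a) = rd C a \<otimes>\<^bsub>C\<^esub> a" "tcod (tev C a) = one C"
  "tdom (tcoev C a) = one C" "tcod (tcoev C a) = a \<otimes>\<^bsub>C\<^esub> rd C a"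
  "tdom (tdual C F) = rd C (tcod F)" "tcod (tdual C F) = rd C (tdom F)"
  by (simp_all add: tev_def tcoev_def tdual_def)

context fusion_category
begin

lemma duality_rd: "a \<in> obj C \<Longrightarrow> duality C a (rd C a) (rdev C a) (rdco C a)"
  by (simp add: duality_def duality_axioms_def monoidal_category_axioms right_dual)

lemma rd_obj [simp]: "a \<in> obj C \<Longrightarrow> rd C a \<in> obj C"
  using right_dual[of a] by (simp add: is_duality_def)

lemma tarr_tev [simp]: "a \<in> obj C \<Longrightarrow> tarr C (tev C a)"
  and tarr_tcoev [simp]: "a \<in> obj C \<Longrightarrow> tarr C (tcoev C a)"
  using right_dual[of a] by (simp_all add: is_duality_def tev_def tcoev_def)

text \<open>\<open>dual_arr\<close> is a definite description: \<open>ex_of_pairing\<close> provides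
  a solution and \<open>ev_cancel\<close> its uniqueness.\<close>

lemma
  assumes F [simp]: "tarr C F"
  shows tarr_tdual [simp]: "tarr C (tdual C F)"
    and tev_tdual: "tev C (tdom F) \<bullet> (tdual C F \<odot> tid C (tdom F)) = tev C (tcod F) \<bullet> (tid C (rd C (tcod F)) \<odot> F)"
proof -
  obtain a f b where Feq: "F = (a, f, b)" by (cases F)
  have ob [simp]: "a \<in> obj C" "b \<in> obj C" and f: "f \<in> hom C a b" using F unfolding Feq by simp_all
  interpret D: duality C a "rd C a" "rdev C a" "rdco C a" by (rule duality_rd) simp
  have ev: "D.ev = tev C a" by (simp add: D.ev_def tev_def)
  define E where "E = tev C b \<bullet> (tid C (rd C b) \<odot> F)"
  have E: "tarr C E" "tdom E = rd C b \<otimes> a" "tcod E = one C" by (simp_all add: E_def Feq f)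
  obtain G where G: "tarr C G" "tdom G = rd C b" "tcod G = rd C a" "tev C a \<bullet> (G \<odot> tid C a) = E"
    using D.ex_of_pairing[OF rd_obj E] unfolding ev by auto
  obtain g where Geq: "G = (rd C b, g, rd C a)" using G(2,3) by (cases G) simp
  have g: "g \<in> hom C (rd C b) (rd C a)" using G(1) unfolding Geq by simp
  have raw: "rdev C a \<cdot> (g \<boxtimes> ide C a) = rdev C b \<cdot> (ide C (rd C b) \<boxtimes> f)"
    using G(4) by (simp add: Geq E_def Feq tev_def tmon_defs)
  have "dual_arr C a b f = g"
    unfolding dual_arr_def to_dual_def
  proof (rule the_equality)
    fix g' assume g': "g' \<in> hom C (rd C b) (rd C a) \<and> rdev C a \<cdot> (g' \<boxtimes> ide C a) = rdev C b \<cdot> (ide C (rd C b) \<boxtimes> f)"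
    have "(rd C b, g', rd C a) = (rd C b, g, rd C a)"
      by (rule D.ev_cancel) (use g g' raw in \<open>simp_all add: ev tev_def tmon_defs\<close>)
    then show "g' = g" by simp
  qed (use g raw in simp)
  then have "tdual C F = G" by (simp add: tdual_def Feq Geq)
  then show "tarr C (tdual C F)"
    "tev C (tdom F) \<bullet> (tdual C F \<odot> tid C (tdom F)) = tev C (tcod F) \<bullet> (tid C (rd C (tcod F)) \<odot> F)"
    using G by (simp_all add: Feq E_def)
qed

text \<open>By \<open>coev_ext\<close> it suffices to compare transposes. Both are
  \<open>F \<bullet> tlun C a\<close>, one by \<open>ev_of_coev\<close>, the other by the defining
  property of the dual morphism and the snake identity of \<open>b\<close>.\<close>

lemma tcoev_dinatural:
  assumes F [simp]: "tarr C F"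
  shows "(F \<odot> tid C (rd C (tdom F))) \<bullet> tcoev C (tdom F) = (tid C (tcod F) \<odot> tdual C F) \<bullet> tcoev C (tcod F)"
proof -
  define a b where "a = tdom F" and "b = tcod F"
  have ab [simp]: "tdom F = a" "tcod F = b" "a \<in> obj C" "b \<in> obj C" by (simp_all add: a_def b_def)
  interpret A: duality C a "rd C a" "rdev C a" "rdco C a" by (rule duality_rd) simp
  interpret B: duality C b "rd C b" "rdev C b" "rdco C b" by (rule duality_rd) simp
  have ev: "A.ev = tev C a" "B.ev = tev C b" by (simp_all add: A.ev_def B.ev_def tev_def)
  have coev: "A.coev = tcoev C a" "B.coev = tcoev C b" by (simp_all add: A.coev_def B.coev_def tcoev_def)
  have "(F \<odot> tid C (rd C a)) \<bullet> tcoev C a = (tid C b \<odot> tdual C F) \<bullet> tcoev C b"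
  proof (rule A.coev_ext[of _ b])
    have 1: "((tid C b \<odot> tdual C F) \<bullet> tcoev C b) \<odot> tid C a
      = ((tid C b \<odot> tdual C F) \<odot> tid C a) \<bullet> (tcoev C b \<odot> tid C a)"
      by (simp add: tinterchange)
    have 2: "(tid C b \<odot> tev C a) \<bullet> (tid C b \<odot> (tdual C F \<odot> tid C a))
      = (tid C b \<odot> tev C b) \<bullet> (tid C b \<odot> (tid C (rd C b) \<odot> F))"
      using tev_tdual[OF F] by (simp add: tinterchange)
    have 3: "(tid C b \<odot> (tid C (rd C b) \<odot> F)) \<bullet> tasc C b (rd C b) a
      = tasc C b (rd C b) b \<bullet> (tid C (b \<otimes> rd C b) \<odot> F)"
      by (simp add: tasc_natural_right)
    have 4: "(tid C (b \<otimes> rd C b) \<odot> F) \<bullet> (tcoev C b \<odot> tid C a)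
      = (tcoev C b \<odot> tid C b) \<bullet> (tid C (one C) \<odot> F)"
      by (simp add: tinterchange)
    have "trun C b \<bullet> (tid C b \<odot> tev C a) \<bullet> tasc C b (rd C a) a \<bullet> (((tid C b \<odot> tdual C F) \<bullet> tcoev C b) \<odot> tid C a)
      = (trun C b \<bullet> (tid C b \<odot> tev C b) \<bullet> tasc C b (rd C b) b \<bullet> (tcoev C b \<odot> tid C b)) \<bullet> (tid C (one C) \<odot> F)"
      by (simp add: 1 tcmp_tail[OF tasc_natural] tcmp_tail[OF 2] tcmp_tail[OF 3] 4)
    also have "\<dots> = F \<bullet> tlun C a"
      using B.snake_left by (simp add: ev coev tlun_natural)
    finally show "trun C b \<bullet> (tid C b \<odot> A.ev) \<bullet> tasc C b (rd C a) a \<bullet> (((F \<odot> tid C (rd C a)) \<bullet> tcoev C a) \<odot> tid C a)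
      = trun C b \<bullet> (tid C b \<odot> A.ev) \<bullet> tasc C b (rd C a) a \<bullet> (((tid C b \<odot> tdual C F) \<bullet> tcoev C b) \<odot> tid C a)"
      using A.ev_of_coev[of F b] by (simp add: ev coev)
  qed simp_all
  then show ?thesis by simp
qed

lemma tcoev_cancel:
  assumes "tarr C G" "tdom G = a" "tcod G = c" "tarr C G'" "tdom G' = a" "tcod G' = c"
    and "(G \<odot> tid C (rd C a)) \<bullet> tcoev C a = (G' \<odot> tid C (rd C a)) \<bullet> tcoev C a"
  shows "G = G'"
proof -
  have a: "a \<in> obj C" using tarr_obj(1)[OF assms(1)] assms by simp
  interpret D: duality C a "rd C a" "rdev C a" "rdco C a" by (rule duality_rd[OF a])
  show ?thesis by (rule D.coev_cancel) (use assms in \<open>simp_all add: D.coev_def tcoev_def\<close>)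
qed

end

section \<open>Actions on typed arrows\<close>

definition tact :: "('o, 'm, 'p, 'n, 'z) action_scheme \<Rightarrow> 'o \<times> 'm \<times> 'o \<Rightarrow> 'p \<times> 'n \<times> 'p \<Rightarrow> 'p \<times> 'n \<times> 'p"
  (infixr "\<rhd>\<index>" 75) where
  "F \<rhd>\<^bsub>A\<^esub> H = (fst F \<triangleright>\<^bsub>A\<^esub> fst H, fst (snd F) \<unrhd>\<^bsub>A\<^esub> fst (snd H), snd (snd F) \<triangleright>\<^bsub>A\<^esub> snd (snd H))"

definition tmasc :: "('o, 'm, 'k, 'x) moncat_scheme \<Rightarrow> ('o, 'm, 'p, 'n, 'z) action_scheme \<Rightarrow>
    'o \<Rightarrow> 'o \<Rightarrow> 'p \<Rightarrow> 'p \<times> 'n \<times> 'p" where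
  "tmasc C A a b x = ((a \<otimes>\<^bsub>C\<^esub> b) \<triangleright>\<^bsub>A\<^esub> x, masc A a b x, a \<triangleright>\<^bsub>A\<^esub> (b \<triangleright>\<^bsub>A\<^esub> x))"

definition tmun :: "('o, 'm, 'k, 'x) moncat_scheme \<Rightarrow> ('o, 'm, 'p, 'n, 'z) action_scheme \<Rightarrow>
    'p \<Rightarrow> 'p \<times> 'n \<times> 'p" where
  "tmun C A x = (one C \<triangleright>\<^bsub>A\<^esub> x, mun A x, x)"

definition timun :: "('o, 'm, 'k, 'x) moncat_scheme \<Rightarrow> ('p, 'n, 'k, 'y) lincat_scheme \<Rightarrow>
    ('o, 'm, 'p, 'n, 'z) action_scheme \<Rightarrow> 'p \<Rightarrow> 'p \<times> 'n \<times> 'p" where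
  "timun C L A x = (x, imun C L A x, one C \<triangleright>\<^bsub>A\<^esub> x)"

lemma tdom_tcod_action [simp]:
  "tdom (F \<rhd>\<^bsub>A\<^esub> H) = tdom F \<triangleright>\<^bsub>A\<^esub> tdom H" "tcod (F \<rhd>\<^bsub>A\<^esub> H) = tcod F \<triangleright>\<^bsub>A\<^esub> tcod H"
  "tdom (tmasc C A a b x) = (a \<otimes>\<^bsub>C\<^esub> b) \<triangleright>\<^bsub>A\<^esub> x" "tcod (tmasc C A a b x) = a \<triangleright>\<^bsub>A\<^esub> (b \<triangleright>\<^bsub>A\<^esub> x)"
  "tdom (tmun C A x) = one C \<triangleright>\<^bsub>A\<^esub> x" "tcod (tmun C A x) = x"
  "tdom (timun C L A x) = x" "tcod (timun C L A x) = one C \<triangleright>\<^bsub>A\<^esub> x"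
  by (simp_all add: tdom_def tcod_def tact_def tmasc_def tmun_def timun_def)

context module_category
begin

abbreviation tcmp_module (infixr "\<star>" 70) where "G \<star> F \<equiv> G \<bullet>\<^bsub>L\<^esub> F"

lemma act_obj [simp]: "\<lbrakk>c \<in> obj C; x \<in> obj L\<rbrakk> \<Longrightarrow> c \<triangleright> x \<in> obj L"
  using act_by_exact[of c] by (simp add: exact_functor_def linear_functor_def act_by_def)

lemma act_ide: "\<lbrakk>c \<in> obj C; x \<in> obj L\<rbrakk> \<Longrightarrow> ide C c \<unrhd> ide L x = ide L (c \<triangleright> x)"
  using act_by_exact[of c] by (simp add: exact_functor_def linear_functor_def act_by_def)

lemma tarr_tact [simp]: "\<lbrakk>tarr C F; tarr L H\<rbrakk> \<Longrightarrow> tarr L (F \<rhd> H)"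
  using action_in_hom[of "fst F" "snd (snd F)" "fst H" "snd (snd H)" "fst (snd F)" "fst (snd H)"]
  by (simp add: tarr_def tact_def)

lemma tact_tid [simp]: "\<lbrakk>c \<in> obj C; x \<in> obj L\<rbrakk> \<Longrightarrow> tid C c \<rhd> tid L x = tid L (c \<triangleright> x)"
  by (simp add: tact_def tid_def act_ide)

lemma tact_interchange:
  "\<lbrakk>tarr C F; tarr C F'; tarr L H; tarr L H'; tcod F = tdom F'; tcod H = tdom H'\<rbrakk>
    \<Longrightarrow> (F' \<rhd> H') \<star> (F \<rhd> H) = (F' \<bullet>\<^bsub>C\<^esub> F) \<rhd> (H' \<star> H)"
  using action_interchange[of "fst F" "fst F'" "snd (snd F')" "fst H" "fst H'" "snd (snd H')" "fst (snd F)"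
      "fst (snd F')" "fst (snd H)" "fst (snd H')"]
  by (simp add: tcmp_def tact_def tarr_def tdom_def tcod_def)

lemma tiso_action [simp]:
  "\<lbrakk>a \<in> obj C; b \<in> obj C; x \<in> obj L\<rbrakk> \<Longrightarrow> tiso L (tmasc C A a b x)"
  "x \<in> obj L \<Longrightarrow> tiso L (tmun C A x)" "x \<in> obj L \<Longrightarrow> tiso L (timun C L A x)"
  unfolding tmasc_def tmun_def timun_def imun_def
  by (rule L.tiso_triple; simp add: masc_iso mun_iso L.is_iso_inv_arr)+

lemma tarr_action [simp]:
  "\<lbrakk>a \<in> obj C; b \<in> obj C; x \<in> obj L\<rbrakk> \<Longrightarrow> tarr L (tmasc C A a b x)"
  "x \<in> obj L \<Longrightarrow> tarr L (tmun C A x)" "x \<in> obj L \<Longrightarrow> tarr L (timun C L A x)"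
  by (simp_all del: tarr_triple)

lemma tmun_inverse [simp]:
  "x \<in> obj L \<Longrightarrow> tmun C A x \<star> timun C L A x = tid L x"
  "x \<in> obj L \<Longrightarrow> timun C L A x \<star> tmun C A x = tid L (one C \<triangleright> x)"
  unfolding tmun_def timun_def imun_def
  by (rule L.tcmp_inv_arr L.inv_arr_tcmp; simp add: mun_iso)+

lemmas tmun_inverse_tail [simp] = tmun_inverse[THEN L.tcmp_tail]

lemma tmasc_natural:
  "\<lbrakk>tarr C F; tarr C G; tarr L H; tcod F = a; tcod G = b; tcod H = x\<rbrakk> \<Longrightarrow>
    tmasc C A a b x \<star> ((F \<odot>\<^bsub>C\<^esub> G) \<rhd> H) = (F \<rhd> (G \<rhd> H)) \<star> tmasc C A (tdom F) (tdom G) (tdom H)"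
  using masc_natural[of "fst F" "snd (snd F)" "fst G" "snd (snd G)" "fst H" "snd (snd H)" "fst (snd F)"
      "fst (snd G)" "fst (snd H)"]
  by (simp add: tcmp_def tact_def ttar_def tmasc_def tarr_def tdom_def tcod_def)

lemma tmun_natural:
  "\<lbrakk>tarr L H; tcod H = x\<rbrakk> \<Longrightarrow> tmun C A x \<star> (tid C (one C) \<rhd> H) = H \<star> tmun C A (tdom H)"
  using mun_natural[of "fst H" "snd (snd H)" "fst (snd H)"]
  by (simp add: tcmp_def tact_def tid_def tmun_def tarr_def tdom_def tcod_def)

lemma timun_natural:
  assumes "tarr L H" "tcod H = x"
  shows "timun C L A x \<star> H = (tid C (one C) \<rhd> H) \<star> timun C L A (tdom H)"
  by (rule L.tiso_cancel_left[of "tmun C A x"]) (use assms in \<open>auto simp: L.tcmp_tail[OF tmun_natural]\<close>)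

lemma taction_triangle:
  "\<lbrakk>a \<in> obj C; x \<in> obj L\<rbrakk> \<Longrightarrow>
    (tid C a \<rhd> tmun C A x) \<star> tmasc C A a (one C) x = trun C a \<rhd> tid L x"
  using action_triangle[of a x]
  by (simp add: tcmp_def tact_def tid_def tmun_def tmasc_def trun_def)

end

section \<open>Internal Homs, the relative Serre functor and its adjunction unit\<close>

definition tiev :: "('o, 'm, 'p, 'n, 'z) serre_action_scheme \<Rightarrow> 'p \<Rightarrow> 'p \<Rightarrow> 'p \<times> 'n \<times> 'p" where
  "tiev A y z = (ih A y z \<triangleright>\<^bsub>A\<^esub> y, iev A y z, z)"

definition tpost :: "('o, 'm, 'k, 'x) moncat_scheme \<Rightarrow> ('p, 'n, 'k, 'y) lincat_scheme \<Rightarrow>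
    ('o, 'm, 'p, 'n, 'z) serre_action_scheme \<Rightarrow> 'p \<Rightarrow> 'p \<times> 'n \<times> 'p \<Rightarrow> 'o \<times> 'm \<times> 'o" where
  "tpost C L A y F = (ih A y (tdom F), ih_post C L A y (tdom F) (tcod F) (fst (snd F)), ih A y (tcod F))"

definition tpre :: "('o, 'm, 'k, 'x) moncat_scheme \<Rightarrow> ('p, 'n, 'k, 'y) lincat_scheme \<Rightarrow>
    ('o, 'm, 'p, 'n, 'z) serre_action_scheme \<Rightarrow> 'p \<times> 'n \<times> 'p \<Rightarrow> 'p \<Rightarrow> 'o \<times> 'm \<times> 'o" where
  "tpre C L A F z = (ih A (tcod F) z, ih_pre C L A (tdom F) (tcod F) z (fst (snd F)), ih A (tdom F) z)"

definition tsphi :: "('o, 'm, 'k, 'x) rigcat_scheme \<Rightarrow> ('o, 'm, 'p, 'n, 'z) serre_action_scheme \<Rightarrow>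
    'p \<Rightarrow> 'p \<Rightarrow> 'o \<times> 'm \<times> 'o" where
  "tsphi C A y z = (rd C (ih A y z), sphi A y z, ih A z (fob (sf A) y))"

definition tfar :: "('o, 'm, 'p, 'n) fctr \<Rightarrow> 'o \<times> 'm \<times> 'o \<Rightarrow> 'p \<times> 'n \<times> 'p" where
  "tfar F f = (fob F (tdom f), far F (fst (snd f)), fob F (tcod f))"

lemma tdom_tcod_serre [simp]:
  "tdom (tiev A y z) = ih A y z \<triangleright>\<^bsub>A\<^esub> y" "tcod (tiev A y z) = z"
  "tdom (tpost C L A y F) = ih A y (tdom F)" "tcod (tpost C L A y F) = ih A y (tcod F)"
  "tdom (tpre C L A F z) = ih A (tcod F) z" "tcod (tpre C L A F z) = ih A (tdom F) z"
  "tdom (tsphi C A y z) = rd C (ih A y z)" "tcod (tsphi C A y z) = ih A z (fob (sf A) y)"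
  "tdom (tfar G F) = fob G (tdom F)" "tcod (tfar G F) = fob G (tcod F)"
  by (simp_all add: tiev_def tpost_def tpre_def tsphi_def tfar_def)

locale serre_module = C: fusion_category C + module_category C L A
  for C :: "('o, 'm::ab_group_add, 'k::field, 'x) rigcat_scheme"
    and L :: "('p, 'n::ab_group_add, 'k, 'y) lincat_scheme"
    and A :: "('o, 'm, 'p, 'n, 'z) serre_action_scheme" (structure) +
  assumes internal_hom: "internal_hom C L A"
    and relative_serre: "relative_serre C L A"
begin

abbreviation S where "S \<equiv> fob (sf A)"

lemma ih_obj [simp]: "\<lbrakk>y \<in> obj L; z \<in> obj L\<rbrakk> \<Longrightarrow> ih A y z \<in> obj C"
  using internal_hom by (simp add: internal_hom_def)

lemma iev_in_hom: "\<lbrakk>y \<in> obj L; z \<in> obj L\<rbrakk> \<Longrightarrow> iev A y z \<in> hom L (ih A y z \<triangleright> y) z"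
  using internal_hom by (simp add: internal_hom_def)

lemma ih_universal:
  "\<lbrakk>y \<in> obj L; z \<in> obj L; c \<in> obj C; f \<in> hom L (c \<triangleright> y) z\<rbrakk> \<Longrightarrow>
    \<exists>!g. g \<in> hom C c (ih A y z) \<and> iev A y z \<cdot>\<^bsub>L\<^esub> (g \<unrhd> ide L y) = f"
  using internal_hom unfolding internal_hom_def by blast

lemma curry_ih:
  assumes "y \<in> obj L" "z \<in> obj L" "c \<in> obj C" "f \<in> hom L (c \<triangleright> y) z"
  shows "curry_ih C L A c y z f \<in> hom C c (ih A y z)"
    and "iev A y z \<cdot>\<^bsub>L\<^esub> (curry_ih C L A c y z f \<unrhd> ide L y) = f"
  using theI'[OF ih_universal[OF assms]] unfolding curry_ih_def by blast+

lemma tarr_tiev [simp]: "\<lbrakk>y \<in> obj L; z \<in> obj L\<rbrakk> \<Longrightarrow> tarr L (tiev A y z)"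
  by (simp add: tiev_def iev_in_hom)

lemma tiev_cancel:
  assumes "y \<in> obj L" "z \<in> obj L" "tarr C F" "tcod F = ih A y z" "tarr C G" "tcod G = ih A y z"
    "tdom F = tdom G" and eq: "tiev A y z \<star> (F \<rhd> tid L y) = tiev A y z \<star> (G \<rhd> tid L y)"
  shows "F = G"
proof -
  obtain c f g where F: "F = (c, f, ih A y z)" and G: "G = (c, g, ih A y z)"
    using assms by (cases F, cases G) auto
  have 1: "c \<in> obj C" "f \<in> hom C c (ih A y z)" "g \<in> hom C c (ih A y z)" using assms unfolding F G by simp_all
  have 2: "iev A y z \<cdot>\<^bsub>L\<^esub> (f \<unrhd> ide L y) = iev A y z \<cdot>\<^bsub>L\<^esub> (g \<unrhd> ide L y)"
    using eq unfolding F G by (simp add: tcmp_def tact_def tiev_def tid_def)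
  have "iev A y z \<cdot>\<^bsub>L\<^esub> (f \<unrhd> ide L y) \<in> hom L (c \<triangleright> y) z"
    using assms(1,2) 1 iev_in_hom action_in_hom[of c "ih A y z" y y f "ide L y"] L.ide_in_hom
      L.cmp_in_hom[of "c \<triangleright> y" "ih A y z \<triangleright> y" z] by simp
  from ih_universal[OF assms(1,2) 1(1) this] have "f = g" using 1 2 by metis
  then show ?thesis by (simp add: F G)
qed

lemma
  assumes y [simp]: "y \<in> obj L" and F [simp]: "tarr L F"
  shows tarr_tpost [simp]: "tarr C (tpost C L A y F)"
    and tiev_tpost: "tiev A y (tcod F) \<star> (tpost C L A y F \<rhd> tid L y) = F \<star> tiev A y (tdom F)"
proof -
  obtain z f z' where Feq: "F = (z, f, z')" by (cases F)
  have ob: "z \<in> obj L" "z' \<in> obj L" "f \<in> hom L z z'" using F unfolding Feq by simp_all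
  have "f \<cdot>\<^bsub>L\<^esub> iev A y z \<in> hom L (ih A y z \<triangleright> y) z'"
    using L.cmp_in_hom[OF _ ob(1,2) iev_in_hom[OF y ob(1)] ob(3)] ob by simp
  note * = curry_ih[OF y ob(2) ih_obj[OF y ob(1)] this]
  show "tarr C (tpost C L A y F)" using * ob by (simp add: tpost_def ih_post_def Feq)
  show "tiev A y (tcod F) \<star> (tpost C L A y F \<rhd> tid L y) = F \<star> tiev A y (tdom F)"
    using * by (simp add: tpost_def ih_post_def Feq tcmp_def tact_def tiev_def tid_def)
qed

lemma
  assumes z [simp]: "z \<in> obj L" and F [simp]: "tarr L F"
  shows tarr_tpre [simp]: "tarr C (tpre C L A F z)"
    and tiev_tpre: "tiev A (tdom F) z \<star> (tpre C L A F z \<rhd> tid L (tdom F))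
      = tiev A (tcod F) z \<star> (tid C (ih A (tcod F) z) \<rhd> F)"
proof -
  obtain y f y' where Feq: "F = (y, f, y')" by (cases F)
  have ob: "y \<in> obj L" "y' \<in> obj L" "f \<in> hom L y y'" using F unfolding Feq by simp_all
  have "ide C (ih A y' z) \<unrhd> f \<in> hom L (ih A y' z \<triangleright> y) (ih A y' z \<triangleright> y')"
    using action_in_hom[of "ih A y' z" "ih A y' z" y y' "ide C (ih A y' z)" f] ob C.ide_in_hom by simp
  then have "iev A y' z \<cdot>\<^bsub>L\<^esub> (ide C (ih A y' z) \<unrhd> f) \<in> hom L (ih A y' z \<triangleright> y) z"
    using L.cmp_in_hom[of "ih A y' z \<triangleright> y" "ih A y' z \<triangleright> y'" z] iev_in_hom ob by simp
  note * = curry_ih[OF ob(1) z ih_obj[OF ob(2) z] this]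
  show "tarr C (tpre C L A F z)" using * ob by (simp add: tpre_def ih_pre_def Feq)
  show "tiev A (tdom F) z \<star> (tpre C L A F z \<rhd> tid L (tdom F))
      = tiev A (tcod F) z \<star> (tid C (ih A (tcod F) z) \<rhd> F)"
    using * by (simp add: tpre_def ih_pre_def Feq tcmp_def tact_def tiev_def tid_def)
qed

lemma sf_linear: "linear_functor L L (sf A)"
  by (rule relative_serre[unfolded relative_serre_def, THEN conjunct1])

lemma sf_obj [simp]: "x \<in> obj L \<Longrightarrow> S x \<in> obj L"
  using sf_linear by (simp add: linear_functor_def)

lemma tarr_tfar_sf [simp]: "tarr L F \<Longrightarrow> tarr L (tfar (sf A) F)"
  using sf_linear by (simp add: linear_functor_def tarr_def tfar_def tdom_def tcod_def)

lemma tiso_tsphi [simp]: "\<lbrakk>y \<in> obj L; z \<in> obj L\<rbrakk> \<Longrightarrow> tiso C (tsphi C A y z)"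
  unfolding tsphi_def
  by (rule C.tiso_triple)
    (simp_all add: relative_serre[unfolded relative_serre_def, THEN conjunct2, THEN conjunct1, THEN bspec, THEN bspec])

lemma tarr_tsphi [simp]: "\<lbrakk>y \<in> obj L; z \<in> obj L\<rbrakk> \<Longrightarrow> tarr C (tsphi C A y z)"
  using tiso_tsphi C.tiso_tarr by blast

lemma tsphi_tpost:
  assumes "y \<in> obj L" "tarr L F"
  shows "tsphi C A y (tdom F) \<bullet>\<^bsub>C\<^esub> tdual C (tpost C L A y F) = tpre C L A F (S y) \<bullet>\<^bsub>C\<^esub> tsphi C A y (tcod F)"
proof -
  obtain z f z' where F: "F = (z, f, z')" by (cases F)
  show ?thesis
    using relative_serre[unfolded relative_serre_def, THEN conjunct2, THEN conjunct2, THEN conjunct1,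
        THEN bspec, THEN bspec, THEN bspec, THEN bspec, of y z z' f] assms
    by (simp add: F tcmp_def tsphi_def tdual_def tpost_def tpre_def)
qed

lemma tsphi_tpre:
  assumes "z \<in> obj L" "tarr L F"
  shows "tsphi C A (tcod F) z \<bullet>\<^bsub>C\<^esub> tdual C (tpre C L A F z) = tpost C L A z (tfar (sf A) F) \<bullet>\<^bsub>C\<^esub> tsphi C A (tdom F) z"
proof -
  obtain y f y' where F: "F = (y, f, y')" by (cases F)
  show ?thesis
    using relative_serre[unfolded relative_serre_def, THEN conjunct2, THEN conjunct2, THEN conjunct2, THEN conjunct1,
        THEN bspec, THEN bspec, THEN bspec, THEN bspec, of y y' z f] assms
    by (simp add: F tcmp_def tsphi_def tdual_def tpost_def tpre_def tfar_def)
qed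

text \<open>The image of \<open>T : 1 \<rightarrow> c \<otimes> ih z y\<close> under \<open>Hom(1, c \<otimes> ih z y) \<cong> Hom(1, ih z (c \<triangleright> y)) \<cong> Hom(z, c \<triangleright> y)\<close>.\<close>

definition uncurry where
  "uncurry c z y T = (tid C c \<rhd> tiev A z y) \<star> tmasc C A c (ih A z y) z \<star> (T \<rhd> tid L z) \<star> timun C L A z"

lemma tdom_tcod_uncurry [simp]: "tdom (uncurry c z y T) = z" "tcod (uncurry c z y T) = c \<triangleright> y"
  by (simp_all add: uncurry_def)

lemma tarr_uncurry [simp]:
  "\<lbrakk>c \<in> obj C; z \<in> obj L; y \<in> obj L; tarr C T; tdom T = one C; tcod T = c \<otimes>\<^bsub>C\<^esub> ih A z y\<rbrakk>
    \<Longrightarrow> tarr L (uncurry c z y T)"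
  by (simp add: uncurry_def)

text \<open>This and the next two lemmas are naturality in \<open>c\<close>, \<open>y\<close> and
  \<open>z\<close>. They reduce identities between morphisms of \<open>L\<close> to identities
  between the arrows \<open>T\<close> of \<open>C\<close>.\<close>

lemma tact_uncurry:
  assumes [simp]: "tarr C G" "tdom G = c" "tcod G = c'" "z \<in> obj L" "y \<in> obj L"
    "tarr C T" "tdom T = one C" "tcod T = c \<otimes>\<^bsub>C\<^esub> ih A z y"
  shows "(G \<rhd> tid L y) \<star> uncurry c z y T = uncurry c' z y ((G \<odot>\<^bsub>C\<^esub> tid C (ih A z y)) \<bullet>\<^bsub>C\<^esub> T)"
proof -
  let ?h = "ih A z y"
  have [simp]: "c \<in> obj C" "c' \<in> obj C" using C.tarr_obj[of G] by simp_all
  have 1: "(G \<rhd> tid L y) \<star> (tid C c \<rhd> tiev A z y) = (tid C c' \<rhd> tiev A z y) \<star> (G \<rhd> tid L (?h \<triangleright> z))"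
    by (simp add: tact_interchange)
  have 2: "(G \<rhd> tid L (?h \<triangleright> z)) \<star> tmasc C A c ?h z = tmasc C A c' ?h z \<star> ((G \<odot>\<^bsub>C\<^esub> tid C ?h) \<rhd> tid L z)"
    by (simp add: tmasc_natural)
  have 3: "((G \<odot>\<^bsub>C\<^esub> tid C ?h) \<bullet>\<^bsub>C\<^esub> T) \<rhd> tid L z = ((G \<odot>\<^bsub>C\<^esub> tid C ?h) \<rhd> tid L z) \<star> (T \<rhd> tid L z)"
    by (simp add: tact_interchange)
  show ?thesis
    unfolding uncurry_def by (simp add: L.tcmp_tail[OF 1] L.tcmp_tail[OF 2] 3)
qed

lemma uncurry_post:
  assumes [simp]: "tarr L F" "tdom F = y" "tcod F = y'" "z \<in> obj L" "c \<in> obj C"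
    "tarr C T" "tdom T = one C" "tcod T = c \<otimes>\<^bsub>C\<^esub> ih A z y"
  shows "(tid C c \<rhd> F) \<star> uncurry c z y T = uncurry c z y' ((tid C c \<odot>\<^bsub>C\<^esub> tpost C L A z F) \<bullet>\<^bsub>C\<^esub> T)"
proof -
  have [simp]: "y \<in> obj L" "y' \<in> obj L" using L.tarr_obj[of F] by simp_all
  let ?P = "tpost C L A z F"
  have 1: "(tid C c \<rhd> F) \<star> (tid C c \<rhd> tiev A z y)
      = (tid C c \<rhd> tiev A z y') \<star> (tid C c \<rhd> (?P \<rhd> tid L z))"
    using tiev_tpost[of z F] by (simp add: tact_interchange)
  have 2: "(tid C c \<rhd> (?P \<rhd> tid L z)) \<star> tmasc C A c (ih A z y) z
      = tmasc C A c (ih A z y') z \<star> ((tid C c \<odot>\<^bsub>C\<^esub> ?P) \<rhd> tid L z)"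
    by (simp add: tmasc_natural)
  have 3: "((tid C c \<odot>\<^bsub>C\<^esub> ?P) \<bullet>\<^bsub>C\<^esub> T) \<rhd> tid L z = ((tid C c \<odot>\<^bsub>C\<^esub> ?P) \<rhd> tid L z) \<star> (T \<rhd> tid L z)"
    by (simp add: tact_interchange)
  show ?thesis
    unfolding uncurry_def by (simp add: L.tcmp_tail[OF 1] L.tcmp_tail[OF 2] 3)
qed

lemma uncurry_pre:
  assumes [simp]: "tarr L F" "tdom F = z" "tcod F = z'" "y \<in> obj L" "c \<in> obj C"
    "tarr C T" "tdom T = one C" "tcod T = c \<otimes>\<^bsub>C\<^esub> ih A z' y"
  shows "uncurry c z' y T \<star> F = uncurry c z y ((tid C c \<odot>\<^bsub>C\<^esub> tpre C L A F y) \<bullet>\<^bsub>C\<^esub> T)"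
proof -
  have [simp]: "z \<in> obj L" "z' \<in> obj L" using L.tarr_obj[of F] by simp_all
  let ?P = "tpre C L A F y" and ?h = "ih A z y" and ?h' = "ih A z' y"
  have 1: "(T \<rhd> tid L z') \<star> (tid C (one C) \<rhd> F)
      = ((tid C c \<odot>\<^bsub>C\<^esub> tid C ?h') \<rhd> F) \<star> (T \<rhd> tid L z)"
    by (simp add: tact_interchange)
  have 2: "tmasc C A c ?h' z' \<star> ((tid C c \<odot>\<^bsub>C\<^esub> tid C ?h') \<rhd> F)
      = (tid C c \<rhd> (tid C ?h' \<rhd> F)) \<star> tmasc C A c ?h' z"
    using tmasc_natural[of "tid C c" "tid C ?h'" F c ?h' z'] by simp
  have 3: "(tid C c \<rhd> tiev A z' y) \<star> (tid C c \<rhd> (tid C ?h' \<rhd> F))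
      = (tid C c \<rhd> tiev A z y) \<star> (tid C c \<rhd> (?P \<rhd> tid L z))"
    using tiev_tpre[of y F] by (simp add: tact_interchange)
  have 4: "(tid C c \<rhd> (?P \<rhd> tid L z)) \<star> tmasc C A c ?h' z
      = tmasc C A c ?h z \<star> ((tid C c \<odot>\<^bsub>C\<^esub> ?P) \<rhd> tid L z)"
    by (simp add: tmasc_natural)
  have 5: "((tid C c \<odot>\<^bsub>C\<^esub> ?P) \<bullet>\<^bsub>C\<^esub> T) \<rhd> tid L z = ((tid C c \<odot>\<^bsub>C\<^esub> ?P) \<rhd> tid L z) \<star> (T \<rhd> tid L z)"
    by (simp add: tact_interchange)
  have 6: "timun C L A z' \<star> F = (tid C (one C) \<rhd> F) \<star> timun C L A z"
    by (simp add: timun_natural)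
  note rules = 6 L.tcmp_tail[OF 1] L.tcmp_tail[OF 2] L.tcmp_tail[OF 3] L.tcmp_tail[OF 4] 5
  show ?thesis
    unfolding uncurry_def using rules by (simp del: C.ttar_tid)
qed

text \<open>For \<open>c = 1\<close> write \<open>T \<bullet> run = 1 \<otimes> T\<^sub>1\<close>; the triangle axiom then identifies \<open>uncurry 1 z y T\<close> with
  \<open>iev \<bullet> (T\<^sub>1 \<triangleright> z)\<close> up to unit constraints.\<close>

lemma uncurry_one_cancel:
  assumes [simp]: "z \<in> obj L" "y \<in> obj L"
    and T: "tarr C T" "tdom T = one C" "tcod T = one C \<otimes>\<^bsub>C\<^esub> ih A z y"
    and T': "tarr C T'" "tdom T' = one C" "tcod T' = one C \<otimes>\<^bsub>C\<^esub> ih A z y"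
    and eq: "uncurry (one C) z y T = uncurry (one C) z y T'"
  shows "T = T'"
proof -
  let ?I = "one C" and ?h = "ih A z y"
  define U where "U R = tlun C ?h \<bullet>\<^bsub>C\<^esub> (R \<bullet>\<^bsub>C\<^esub> trun C ?I) \<bullet>\<^bsub>C\<^esub> tilun C ?I" for R
  have *: "uncurry ?I z y R = timun C L A y \<star> tiev A z y \<star> (U R \<rhd> tid L z) \<star> timun C L A z"
    and U: "tarr C (U R)" "tdom (U R) = ?I" "tcod (U R) = ?h" "tid C ?I \<odot>\<^bsub>C\<^esub> U R = R \<bullet>\<^bsub>C\<^esub> trun C ?I"
    if [simp]: "tarr C R" "tdom R = ?I" "tcod R = ?I \<otimes>\<^bsub>C\<^esub> ?h" for R
  proof -
    show U [simp]: "tarr C (U R)" "tdom (U R) = ?I" "tcod (U R) = ?h" by (simp_all add: U_def)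
    show full: "tid C ?I \<odot>\<^bsub>C\<^esub> U R = R \<bullet>\<^bsub>C\<^esub> trun C ?I"
      unfolding U_def by (rule C.one_ttar_full) simp_all
    have R: "R = (tid C ?I \<odot>\<^bsub>C\<^esub> U R) \<bullet>\<^bsub>C\<^esub> tirun C ?I" by (simp add: full)
    have 1: "R \<rhd> tid L z = ((tid C ?I \<odot>\<^bsub>C\<^esub> U R) \<rhd> tid L z) \<star> (tirun C ?I \<rhd> tid L z)"
      by (subst R) (simp add: tact_interchange)
    have 2: "tmasc C A ?I ?I z \<star> (tirun C ?I \<rhd> tid L z) = tid C ?I \<rhd> timun C L A z"
    proof (rule L.tiso_cancel_left[of "tid C ?I \<rhd> tmun C A z"])
      show "tiso L (tid C ?I \<rhd> tmun C A z)"
        unfolding tiso_def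
        by (intro conjI exI[of _ "tid C ?I \<rhd> timun C L A z"]) (simp_all add: tact_interchange)
      show "(tid C ?I \<rhd> tmun C A z) \<star> tmasc C A ?I ?I z \<star> (tirun C ?I \<rhd> tid L z)
        = (tid C ?I \<rhd> tmun C A z) \<star> (tid C ?I \<rhd> timun C L A z)"
        by (simp add: L.tcmp_tail[OF taction_triangle] tact_interchange)
    qed simp_all
    have 3: "(tid C ?I \<rhd> tiev A z y) \<star> (tid C ?I \<rhd> (U R \<rhd> tid L z)) \<star> (tid C ?I \<rhd> timun C L A z)
      = tid C ?I \<rhd> (tiev A z y \<star> (U R \<rhd> tid L z) \<star> timun C L A z)"
      by (simp add: tact_interchange)
    have "uncurry ?I z y R = ((tid C ?I \<rhd> tiev A z y) \<star> (tid C ?I \<rhd> (U R \<rhd> tid L z)) \<star>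
        (tid C ?I \<rhd> timun C L A z)) \<star> timun C L A z"
      unfolding uncurry_def 1 by (simp add: L.tcmp_tail[OF tmasc_natural] L.tcmp_tail[OF 2])
    also have "\<dots> = timun C L A y \<star> tiev A z y \<star> (U R \<rhd> tid L z) \<star> timun C L A z"
      unfolding 3 by (simp add: timun_natural)
    finally show "uncurry ?I z y R
      = timun C L A y \<star> tiev A z y \<star> (U R \<rhd> tid L z) \<star> timun C L A z" .
  qed
  note UT [simp] = U[OF T] and UT' [simp] = U[OF T']
  have "timun C L A y \<star> (tiev A z y \<star> (U T \<rhd> tid L z) \<star> timun C L A z)
    = timun C L A y \<star> (tiev A z y \<star> (U T' \<rhd> tid L z) \<star> timun C L A z)"
    using eq *[OF T] *[OF T'] by simp
  then have "tiev A z y \<star> (U T \<rhd> tid L z) \<star> timun C L A z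
    = tiev A z y \<star> (U T' \<rhd> tid L z) \<star> timun C L A z"
    by (rule L.tiso_cancel_left[of "timun C L A y", rotated -1]) simp_all
  then have "(tiev A z y \<star> (U T \<rhd> tid L z)) \<star> timun C L A z
    = (tiev A z y \<star> (U T' \<rhd> tid L z)) \<star> timun C L A z" by simp
  then have "tiev A z y \<star> (U T \<rhd> tid L z) = tiev A z y \<star> (U T' \<rhd> tid L z)"
    by (rule L.tiso_cancel_right[of "timun C L A z", rotated -1]) simp_all
  then have "U T = U T'" by (rule tiev_cancel[rotated -1]) simp_all
  then have "T \<bullet>\<^bsub>C\<^esub> trun C ?I = T' \<bullet>\<^bsub>C\<^esub> trun C ?I" using UT(4) UT'(4) by simp
  then show ?thesis by (rule C.tiso_cancel_right[of "trun C ?I", rotated -1]) (simp_all add: T T')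
qed

text \<open>The unit, at \<open>z\<close>, of the adjunction between \<open>ih A x\<close> and
  acting on \<open>S x\<close>: the coevaluation of \<open>ih A x z\<close>, with the dual replaced
  by \<open>ih A z (S x)\<close> along \<open>sphi\<close>. It is the unit that enters
  \<open>nak_serre\<close>.\<close>

definition eta where
  "eta x z = uncurry (ih A x z) z (S x) ((tid C (ih A x z) \<odot>\<^bsub>C\<^esub> tsphi C A x z) \<bullet>\<^bsub>C\<^esub> tcoev C (ih A x z))"

lemma eta_arr [simp]:
  "tdom (eta x z) = z" "tcod (eta x z) = ih A x z \<triangleright> S x"
  "\<lbrakk>x \<in> obj L; z \<in> obj L\<rbrakk> \<Longrightarrow> tarr L (eta x z)"
  by (simp_all add: eta_def)

text \<open>Checked in \<open>C\<close>: naturality of \<open>sphi\<close> trades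
  \<open>tpre\<close> for the dual of \<open>tpost\<close>, and dinaturality of the coevaluation
  moves that dual to the other tensor factor.\<close>

lemma eta_natural:
  assumes x [simp]: "x \<in> obj L" and F [simp]: "tarr L F"
  shows "eta x (tcod F) \<star> F = (tpost C L A x F \<rhd> tid L (S x)) \<star> eta x (tdom F)"
proof -
  let ?h = "ih A x (tdom F)" and ?h' = "ih A x (tcod F)" and ?P = "tpost C L A x F"
  have "(tid C ?h' \<odot>\<^bsub>C\<^esub> tpre C L A F (S x)) \<bullet>\<^bsub>C\<^esub> (tid C ?h' \<odot>\<^bsub>C\<^esub> tsphi C A x (tcod F)) \<bullet>\<^bsub>C\<^esub> tcoev C ?h'
    = (tid C ?h' \<odot>\<^bsub>C\<^esub> tsphi C A x (tdom F)) \<bullet>\<^bsub>C\<^esub> (tid C ?h' \<odot>\<^bsub>C\<^esub> tdual C ?P) \<bullet>\<^bsub>C\<^esub> tcoev C ?h'"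
    using tsphi_tpost[OF x F] by (simp add: C.tinterchange_tail)
  also have "\<dots> = (tid C ?h' \<odot>\<^bsub>C\<^esub> tsphi C A x (tdom F)) \<bullet>\<^bsub>C\<^esub> (?P \<odot>\<^bsub>C\<^esub> tid C (rd C ?h)) \<bullet>\<^bsub>C\<^esub> tcoev C ?h"
    using C.tcoev_dinatural[of ?P] by simp
  also have "\<dots> = (?P \<odot>\<^bsub>C\<^esub> tid C (ih A (tdom F) (S x))) \<bullet>\<^bsub>C\<^esub> (tid C ?h \<odot>\<^bsub>C\<^esub> tsphi C A x (tdom F)) \<bullet>\<^bsub>C\<^esub> tcoev C ?h"
    by (simp add: C.tinterchange_tail)
  finally show ?thesis
    unfolding eta_def by (simp add: uncurry_pre tact_uncurry)
qed

text \<open>The same two kinds of naturality as in \<open>eta_natural\<close>, in the opposite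
  order; the one for \<open>sphi\<close> is now in the variable on which \<open>S\<close>
  depends.\<close>

lemma eta_dinatural:
  assumes z [simp]: "z \<in> obj L" and F [simp]: "tarr L F"
  shows "(tpre C L A F z \<rhd> tid L (S (tcod F))) \<star> eta (tcod F) z
    = (tid C (ih A (tdom F) z) \<rhd> tfar (sf A) F) \<star> eta (tdom F) z"
proof -
  let ?h = "ih A (tdom F) z" and ?h' = "ih A (tcod F) z" and ?P = "tpre C L A F z"
  have "(?P \<odot>\<^bsub>C\<^esub> tid C (ih A z (S (tcod F)))) \<bullet>\<^bsub>C\<^esub> (tid C ?h' \<odot>\<^bsub>C\<^esub> tsphi C A (tcod F) z) \<bullet>\<^bsub>C\<^esub> tcoev C ?h'
    = (tid C ?h \<odot>\<^bsub>C\<^esub> tsphi C A (tcod F) z) \<bullet>\<^bsub>C\<^esub> (?P \<odot>\<^bsub>C\<^esub> tid C (rd C ?h')) \<bullet>\<^bsub>C\<^esub> tcoev C ?h'"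
    by (simp add: C.tinterchange_tail)
  also have "\<dots> = (tid C ?h \<odot>\<^bsub>C\<^esub> tsphi C A (tcod F) z) \<bullet>\<^bsub>C\<^esub> (tid C ?h \<odot>\<^bsub>C\<^esub> tdual C ?P) \<bullet>\<^bsub>C\<^esub> tcoev C ?h"
    using C.tcoev_dinatural[of ?P] by simp
  also have "\<dots> = (tid C ?h \<odot>\<^bsub>C\<^esub> tpost C L A z (tfar (sf A) F)) \<bullet>\<^bsub>C\<^esub> (tid C ?h \<odot>\<^bsub>C\<^esub> tsphi C A (tdom F) z) \<bullet>\<^bsub>C\<^esub> tcoev C ?h"
    using tsphi_tpre[OF z F] by (simp add: C.tinterchange_tail)
  finally show ?thesis
    unfolding eta_def by (simp add: uncurry_post tact_uncurry)
qed

text \<open>Three injective steps are undone: \<open>uncurry\<close> at the unit object, composition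
  with the invertible \<open>sphi\<close>, and transposition along the coevaluation.\<close>

lemma eta_cancel:
  assumes [simp]: "x \<in> obj L" "z \<in> obj L"
    and G: "tarr C G" "tdom G = ih A x z" "tcod G = one C"
    and G': "tarr C G'" "tdom G' = ih A x z" "tcod G' = one C"
    and eq: "(G \<rhd> tid L (S x)) \<star> eta x z = (G' \<rhd> tid L (S x)) \<star> eta x z"
  shows "G = G'"
proof -
  let ?h = "ih A x z" and ?k = "ih A z (S x)" and ?I = "one C"
  have slide: "(R \<odot>\<^bsub>C\<^esub> tid C ?k) \<bullet>\<^bsub>C\<^esub> (tid C ?h \<odot>\<^bsub>C\<^esub> tsphi C A x z) \<bullet>\<^bsub>C\<^esub> tcoev C ?h
    = (tid C ?I \<odot>\<^bsub>C\<^esub> tsphi C A x z) \<bullet>\<^bsub>C\<^esub> (R \<odot>\<^bsub>C\<^esub> tid C (rd C ?h)) \<bullet>\<^bsub>C\<^esub> tcoev C ?h"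
    if "tarr C R" "tdom R = ?h" "tcod R = ?I" for R
    using that by (simp add: C.tinterchange_tail)
  have "(G \<odot>\<^bsub>C\<^esub> tid C ?k) \<bullet>\<^bsub>C\<^esub> (tid C ?h \<odot>\<^bsub>C\<^esub> tsphi C A x z) \<bullet>\<^bsub>C\<^esub> tcoev C ?h
    = (G' \<odot>\<^bsub>C\<^esub> tid C ?k) \<bullet>\<^bsub>C\<^esub> (tid C ?h \<odot>\<^bsub>C\<^esub> tsphi C A x z) \<bullet>\<^bsub>C\<^esub> tcoev C ?h"
    by (rule uncurry_one_cancel[of z "S x"])
      (use eq in \<open>simp_all add: G G' eta_def tact_uncurry[OF G] tact_uncurry[OF G']\<close>)
  then have "(tid C ?I \<odot>\<^bsub>C\<^esub> tsphi C A x z) \<bullet>\<^bsub>C\<^esub> ((G \<odot>\<^bsub>C\<^esub> tid C (rd C ?h)) \<bullet>\<^bsub>C\<^esub> tcoev C ?h)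
    = (tid C ?I \<odot>\<^bsub>C\<^esub> tsphi C A x z) \<bullet>\<^bsub>C\<^esub> ((G' \<odot>\<^bsub>C\<^esub> tid C (rd C ?h)) \<bullet>\<^bsub>C\<^esub> tcoev C ?h)"
    by (simp add: slide[OF G] slide[OF G'])
  then have "(G \<odot>\<^bsub>C\<^esub> tid C (rd C ?h)) \<bullet>\<^bsub>C\<^esub> tcoev C ?h = (G' \<odot>\<^bsub>C\<^esub> tid C (rd C ?h)) \<bullet>\<^bsub>C\<^esub> tcoev C ?h"
    by (rule C.tiso_cancel_left[of "tid C ?I \<odot>\<^bsub>C\<^esub> tsphi C A x z", rotated -1])
      (simp_all add: C.tiso_ttar C.tiso_tid G G')
  then show ?thesis by (rule C.tcoev_cancel[OF G G'])
qed

end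

section \<open>The Nakayama functor of a module category\<close>

lemma (in linear_category) linear_functor_tfar:
  assumes "linear_functor X X F"
  shows "tarr X f \<Longrightarrow> tarr X (tfar F f)"
    and "x \<in> obj X \<Longrightarrow> tfar F (tid X x) = tid X (fob F x)"
    and "\<lbrakk>tarr X f; tarr X g; tcod f = tdom g\<rbrakk> \<Longrightarrow> tfar F (g \<bullet> f) = tfar F g \<bullet> tfar F f"
  using assms
  by (auto simp: linear_functor_def tarr_def tfar_def tdom_def tcod_def tid_def tcmp_def)

lemma (in linear_category) tiso_tfar:
  assumes F: "linear_functor X X F" and f: "tiso X f"
  shows "tiso X (tfar F f)"
proof -
  obtain g where g: "tarr X g" "tdom g = tcod f" "tcod g = tdom f"
    "g \<bullet> f = tid X (tdom f)" "f \<bullet> g = tid X (tcod f)" using tisoE[OF f] .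
  show ?thesis
    unfolding tiso_def using g f
    by (intro conjI exI[of _ "tfar F g"])
      (simp_all add: linear_functor_tfar(1)[OF F] linear_functor_tfar(3)[OF F, symmetric]
        linear_functor_tfar(2)[OF F])
qed

lemma (in linear_category) tiso_is_iso: "tiso X (x, f, y) \<Longrightarrow> is_iso X x y f"
  unfolding tiso_def is_iso_def by (auto simp: tcmp_def tid_def tdom_def tcod_def)

lemma (in module_category) tiso_tact:
  assumes F: "tiso C F" and G: "tiso L G"
  shows "tiso L (F \<rhd> G)"
proof -
  obtain F' where F': "tarr C F'" "tdom F' = tcod F" "tcod F' = tdom F"
    "F' \<bullet>\<^bsub>C\<^esub> F = tid C (tdom F)" "F \<bullet>\<^bsub>C\<^esub> F' = tid C (tcod F)" using C.tisoE[OF F] .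
  obtain G' where G': "tarr L G'" "tdom G' = tcod G" "tcod G' = tdom G"
    "G' \<star> G = tid L (tdom G)" "G \<star> G' = tid L (tcod G)" using L.tisoE[OF G] .
  show ?thesis
    unfolding tiso_def using F' G' F G
    by (intro conjI exI[of _ "F' \<rhd> G'"]) (simp_all add: tact_interchange)
qed

lemma (in module_category)
  assumes "x \<in> obj L" "c \<in> obj C" "c' \<in> obj C" "f \<in> hom C c c'"
  shows act_ide_add: "f' \<in> hom C c c' \<Longrightarrow> (f + f') \<unrhd> ide L x = f \<unrhd> ide L x + f' \<unrhd> ide L x"
    and act_ide_scl: "scl C a f \<unrhd> ide L x = scl L a (f \<unrhd> ide L x)"
  using act_on_exact[OF assms(1)] assms(2-4)
  by (simp_all add: exact_functor_def linear_functor_def act_on_def)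

text \<open>Instantiated once for the action of \<open>C\<close> and once for that of
  \<open>reverse D\<close>. Besides trivializing the Serre functor, \<open>t\<close> supplies the
  isomorphism S x \<cong> x for the dimension count.\<close>

locale serre_nakayama = serre_module C L A + NC: nakayama_category C NC + NL: nakayama_category L NL
  for C :: "('o, 'm::ab_group_add, 'k::field, 'x) rigcat_scheme"
    and L :: "('p, 'n::ab_group_add, 'k, 'y) lincat_scheme"
    and A :: "('o, 'm, 'p, 'n, 'z) serre_action_scheme" (structure)
    and NC :: "('o, 'm, 'k) nak" and NL :: "('p, 'n, 'k) nak" +
  fixes t :: "'p \<Rightarrow> 'n"
  assumes t_iso: "x \<in> obj L \<Longrightarrow> is_iso L x (S x) (t x)"
    and t_natural: "\<lbrakk>x \<in> obj L; y \<in> obj L; f \<in> hom L x y\<rbrakk> \<Longrightarrow> far (sf A) f \<cdot>\<^bsub>L\<^esub> t x = t y \<cdot>\<^bsub>L\<^esub> f"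
begin

abbreviation D where "D \<equiv> fob (nfn NC) (one C)"
abbreviation N where "N \<equiv> fob (nfn NL)"

lemma D_obj [simp]: "D \<in> obj C"
  by (rule NC.nfn_obj) simp

lemma N_obj [simp]: "x \<in> obj L \<Longrightarrow> N x \<in> obj L"
  by (rule NL.nfn_obj)

definition eta_arr_of where "eta_arr_of x z = fst (snd (eta x z))"

lemma eta_triple: "eta x z = (z, eta_arr_of x z, ih A x z \<triangleright> S x)"
  by (metis eta_arr_of_def eta_arr(1,2) prod.collapse tdom_def tcod_def)

lemma eta_arr_of_in_hom: "\<lbrakk>x \<in> obj L; z \<in> obj L\<rbrakk> \<Longrightarrow> eta_arr_of x z \<in> hom L z (ih A x z \<triangleright> S x)"
  using eta_arr(3)[of x z] unfolding eta_triple by simp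

text \<open>Links the raw expression in \<open>nak_serre\<close> to \<open>eta\<close>, for which
  naturality and cancellation are available.\<close>

lemma eta_arr_of_eq:
  assumes [simp]: "x \<in> obj L" "z \<in> obj L"
  shows "(ide C (ih A x z) \<unrhd> iev A z (S x)) \<cdot>\<^bsub>L\<^esub> masc A (ih A x z) (ih A z (S x)) z \<cdot>\<^bsub>L\<^esub>
    (((ide C (ih A x z) \<boxtimes>\<^bsub>C\<^esub> sphi A x z) \<cdot>\<^bsub>C\<^esub> rdco C (ih A x z)) \<unrhd> ide L z) \<cdot>\<^bsub>L\<^esub> imun C L A z
    = eta_arr_of x z"
proof -
  let ?h = "ih A x z" and ?k = "ih A z (S x)"
  \<comment> \<open>Bracketed to the left, because untyped composition associates that way.\<close>
  have "eta x z = (((tid C ?h \<rhd> tiev A z (S x)) \<star> tmasc C A ?h ?k z) \<star>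
      (((tid C ?h \<odot>\<^bsub>C\<^esub> tsphi C A x z) \<bullet>\<^bsub>C\<^esub> tcoev C ?h) \<rhd> tid L z)) \<star> timun C L A z"
    by (simp add: eta_def uncurry_def)
  then show ?thesis
    unfolding eta_arr_of_def
    by (simp add: tcmp_def tact_def ttar_def tid_def tiev_def tmasc_def tsphi_def tcoev_def timun_def
        del: L.tcmp_assoc)
qed

text \<open>A functional on Hom(1 \<triangleright> x, z), carried along the adjunction isomorphism
  to Hom(1, ih x z).\<close>

definition transpose where
  "transpose x z \<psi> = (\<lambda>g. \<psi> (iev A x z \<cdot>\<^bsub>L\<^esub> (g \<unrhd> ide L x)))"

text \<open>The restriction of the canonical isomorphism \<open>N (1 \<triangleright> x) \<rightarrow> D \<triangleright> S x\<close> to the components of the coend.\<close>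

definition comparison where
  "comparison x z \<psi> = (nin NC (one C) (ih A x z) (transpose x z \<psi>) \<unrhd> ide L (S x)) \<cdot>\<^bsub>L\<^esub> eta_arr_of x z"

lemma transpose_functional:
  assumes x: "x \<in> obj L" and z: "z \<in> obj L" and \<psi>: "functional L (hom L (one C \<triangleright> x) z) \<psi>"
  shows "functional C (hom C (one C) (ih A x z)) (transpose x z \<psi>)"
proof -
  let ?I = "one C" and ?h = "ih A x z"
  have h: "?h \<in> obj C" and I: "?I \<in> obj C" and hx: "?h \<triangleright> x \<in> obj L" and Ix: "?I \<triangleright> x \<in> obj L"
    using x z by simp_all
  note ev = iev_in_hom[OF x z]
  have g: "g \<unrhd> ide L x \<in> hom L (?I \<triangleright> x) (?h \<triangleright> x)" if "g \<in> hom C ?I ?h" for g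
    by (rule action_in_hom[OF I h x x that L.ide_in_hom[OF x]])
  have eg: "iev A x z \<cdot>\<^bsub>L\<^esub> (g \<unrhd> ide L x) \<in> hom L (?I \<triangleright> x) z" if "g \<in> hom C ?I ?h" for g
    by (rule L.cmp_in_hom[OF Ix hx z g[OF that] ev])
  show ?thesis
    unfolding functional_def transpose_def
  proof (intro conjI ballI allI)
    fix u v assume uv: "u \<in> hom C ?I ?h" "v \<in> hom C ?I ?h"
    show "\<psi> (iev A x z \<cdot>\<^bsub>L\<^esub> ((u + v) \<unrhd> ide L x))
      = \<psi> (iev A x z \<cdot>\<^bsub>L\<^esub> (u \<unrhd> ide L x)) + \<psi> (iev A x z \<cdot>\<^bsub>L\<^esub> (v \<unrhd> ide L x))"
      unfolding act_ide_add[OF x I h uv] L.cmp_add_right[OF Ix hx z g[OF uv(1)] g[OF uv(2)] ev]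
      by (rule L.functionalD_add[OF \<psi> eg[OF uv(1)] eg[OF uv(2)]])
  next
    fix a v assume v: "v \<in> hom C ?I ?h"
    show "\<psi> (iev A x z \<cdot>\<^bsub>L\<^esub> (scl C a v \<unrhd> ide L x)) = a * \<psi> (iev A x z \<cdot>\<^bsub>L\<^esub> (v \<unrhd> ide L x))"
      unfolding act_ide_scl[OF x I h v] L.cmp_scl_right[OF Ix hx z g[OF v] ev]
      by (rule L.functionalD_scl[OF \<psi> eg[OF v]])
  qed
qed

lemma comparison_in_hom:
  assumes x: "x \<in> obj L" and z: "z \<in> obj L" and \<psi>: "functional L (hom L (one C \<triangleright> x) z) \<psi>"
  shows "comparison x z \<psi> \<in> hom L z (D \<triangleright> S x)"
proof -
  have Sx: "S x \<in> obj L" and h: "ih A x z \<in> obj C" and I: "one C \<in> obj C" using x z by simp_all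
  have "nin NC (one C) (ih A x z) (transpose x z \<psi>) \<unrhd> ide L (S x) \<in> hom L (ih A x z \<triangleright> S x) (D \<triangleright> S x)"
    by (rule action_in_hom[OF h D_obj Sx Sx NC.nin_in_hom[OF I h transpose_functional[OF assms]] L.ide_in_hom[OF Sx]])
  then show ?thesis
    unfolding comparison_def
    by (rule L.cmp_in_hom[OF z act_obj[OF h Sx] act_obj[OF D_obj Sx] eta_arr_of_in_hom[OF x z]])
qed

lemma comparison_triple:
  assumes x: "x \<in> obj L" and z: "z \<in> obj L"
  shows "(z, comparison x z \<psi>, D \<triangleright> S x)
    = ((ih A x z, nin NC (one C) (ih A x z) (transpose x z \<psi>), D) \<rhd> tid L (S x)) \<star> eta x z"
  unfolding eta_triple by (simp add: comparison_def tcmp_def tact_def tid_def)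

text \<open>Naturality of \<open>eta\<close> trades \<open>f\<close> for the induced morphism
  \<open>P\<close> of internal Homs, and dinaturality of the structure morphisms of
  \<open>NC\<close> moves \<open>P\<close> into the functional.\<close>

lemma comparison_post:
  assumes x: "x \<in> obj L" and z: "z \<in> obj L" "z' \<in> obj L" and f: "f \<in> hom L z z'"
    and \<psi>: "functional L (hom L (one C \<triangleright> x) z') \<psi>"
  shows "comparison x z' \<psi> \<cdot>\<^bsub>L\<^esub> f = comparison x z (\<lambda>v. \<psi> (f \<cdot>\<^bsub>L\<^esub> v))"
proof -
  let ?I = "one C" and ?h = "ih A x z" and ?h' = "ih A x z'"
  let ?F = "(z, f, z')"
  have h: "?h \<in> obj C" "?h' \<in> obj C" and I: "?I \<in> obj C" and Ix: "?I \<triangleright> x \<in> obj L" using x z by simp_all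
  have F [simp]: "tarr L ?F" using z f by simp
  define P where "P = ih_post C L A x z z' f"
  have PF: "tpost C L A x ?F = (?h, P, ?h')" by (simp add: tpost_def P_def)
  have P: "P \<in> hom C ?h ?h'" using tarr_tpost[OF x F] by (simp add: PF)
  let ?u' = "nin NC ?I ?h' (transpose x z' \<psi>)"
  have u': "?u' \<in> hom C ?h' D" by (rule NC.nin_in_hom[OF I h(2) transpose_functional[OF x z(2) \<psi>]])
  have "transpose x z' \<psi> (P \<cdot>\<^bsub>C\<^esub> g) = transpose x z (\<lambda>v. \<psi> (f \<cdot>\<^bsub>L\<^esub> v)) g" if g: "g \<in> hom C ?I ?h" for g
  proof -
    let ?G = "(?I, g, ?h)"
    have G: "tarr C ?G" using h I g by simp
    have 1: "(tpost C L A x ?F \<bullet>\<^bsub>C\<^esub> ?G) \<rhd> tid L x = (tpost C L A x ?F \<rhd> tid L x) \<star> (?G \<rhd> tid L x)"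
      using G x by (simp add: tact_interchange PF h P)
    have "tiev A x z' \<star> ((tpost C L A x ?F \<bullet>\<^bsub>C\<^esub> ?G) \<rhd> tid L x) = ?F \<star> (tiev A x z \<star> (?G \<rhd> tid L x))"
    proof -
      have "tiev A x z' \<star> ((?h, P, ?h') \<rhd> tid L x) = ?F \<star> tiev A x z"
        using tiev_tpost[OF x F] by (simp add: PF)
      from L.tcmp_tail[OF this, of "?G \<rhd> tid L x"] show ?thesis
        unfolding PF 1[unfolded PF] using x z h I g P f by simp
    qed
    then show ?thesis
      by (simp add: transpose_def PF tcmp_def tact_def tid_def tiev_def)
  qed
  then have "nin NC ?I ?h (\<lambda>g. transpose x z' \<psi> (P \<cdot>\<^bsub>C\<^esub> g)) = nin NC ?I ?h (transpose x z (\<lambda>v. \<psi> (f \<cdot>\<^bsub>L\<^esub> v)))"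
    by (intro NC.nin_cong[OF I h(1)] C.functional_postcompose[OF transpose_functional[OF x z(2) \<psi>] P I h(1,2)]
        transpose_functional[OF x z(1)] L.functional_postcompose[OF \<psi> f Ix z(1,2)])
  then have uP: "?u' \<cdot>\<^bsub>C\<^esub> P = nin NC ?I ?h (transpose x z (\<lambda>v. \<psi> (f \<cdot>\<^bsub>L\<^esub> v)))"
    using NC.nin_cmp[OF I h P transpose_functional[OF x z(2) \<psi>]] by simp
  have "(z', comparison x z' \<psi>, D \<triangleright> S x) \<star> ?F
    = ((?h', ?u', D) \<rhd> tid L (S x)) \<star> (eta x z' \<star> ?F)"
    unfolding comparison_triple[OF x z(2)] using x z f h u' by simp
  also have "\<dots> = (((?h', ?u', D) \<bullet>\<^bsub>C\<^esub> (?h, P, ?h')) \<rhd> tid L (S x)) \<star> eta x z"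
  proof -
    have 1: "((?h', ?u', D) \<bullet>\<^bsub>C\<^esub> (?h, P, ?h')) \<rhd> tid L (S x)
        = ((?h', ?u', D) \<rhd> tid L (S x)) \<star> ((?h, P, ?h') \<rhd> tid L (S x))"
      using x h u' P by (simp add: tact_interchange)
    show ?thesis
      unfolding 1 using eta_natural[OF x F] x z h u' P by (simp add: PF)
  qed
  also have "(?h', ?u', D) \<bullet>\<^bsub>C\<^esub> (?h, P, ?h') = (?h, nin NC ?I ?h (transpose x z (\<lambda>v. \<psi> (f \<cdot>\<^bsub>L\<^esub> v))), D)"
    using uP by (simp add: tcmp_def)
  finally show ?thesis
    unfolding comparison_triple[OF x z(1), symmetric] by (simp add: tcmp_def)
qed

lemma comparison_dinatural:
  assumes x: "x \<in> obj L"
  shows "dinatural_family L (one C \<triangleright> x) (D \<triangleright> S x) (comparison x)"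
  unfolding dinatural_family_def
proof (intro conjI ballI allI impI)
  have Sx: "S x \<in> obj L" and I: "one C \<in> obj C" using x by simp_all
  fix z \<psi> assume z: "z \<in> obj L" and \<psi>: "functional L (hom L (one C \<triangleright> x) z) \<psi>"
  have h: "ih A x z \<in> obj C" using x z by simp
  have hS: "ih A x z \<triangleright> S x \<in> obj L" and DS: "D \<triangleright> S x \<in> obj L" using h Sx by simp_all
  note e = eta_arr_of_in_hom[OF x z]
  note T = transpose_functional[OF x z \<psi>]
  note u = NC.nin_in_hom[OF I h T]
  have act: "v \<unrhd> ide L (S x) \<in> hom L (ih A x z \<triangleright> S x) (D \<triangleright> S x)" if "v \<in> hom C (ih A x z) D" for v
    by (rule action_in_hom[OF h D_obj Sx Sx that L.ide_in_hom[OF Sx]])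
  show "comparison x z \<psi> \<in> hom L z (D \<triangleright> S x)" by (rule comparison_in_hom[OF x z \<psi>])
  show "comparison x z (\<lambda>v. a * \<psi> v) = scl L a (comparison x z \<psi>)" for a
  proof -
    have "transpose x z (\<lambda>v. a * \<psi> v) = (\<lambda>g. a * transpose x z \<psi> g)" by (simp add: transpose_def)
    then show ?thesis
      unfolding comparison_def
      using NC.nin_scl[OF I h T] act_ide_scl[OF Sx h D_obj u] L.cmp_scl_left[OF z hS DS e act[OF u]] by simp
  qed
  fix \<psi>' assume \<psi>': "functional L (hom L (one C \<triangleright> x) z) \<psi>'"
  note T' = transpose_functional[OF x z \<psi>']
  note u' = NC.nin_in_hom[OF I h T']
  show "comparison x z (\<lambda>v. \<psi> v + \<psi>' v) = comparison x z \<psi> + comparison x z \<psi>'"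
  proof -
    have "transpose x z (\<lambda>v. \<psi> v + \<psi>' v) = (\<lambda>g. transpose x z \<psi> g + transpose x z \<psi>' g)"
      by (simp add: transpose_def)
    then show ?thesis
      unfolding comparison_def
      using NC.nin_add[OF I h T T'] act_ide_add[OF Sx h D_obj u u']
        L.cmp_add_left[OF z hS DS e act[OF u] act[OF u']] by simp
  qed
  assume eq: "\<forall>v\<in>hom L (one C \<triangleright> x) z. \<psi> v = \<psi>' v"
  have "transpose x z \<psi> g = transpose x z \<psi>' g" if g: "g \<in> hom C (one C) (ih A x z)" for g
  proof -
    have "iev A x z \<cdot>\<^bsub>L\<^esub> (g \<unrhd> ide L x) \<in> hom L (one C \<triangleright> x) z"
      using L.cmp_in_hom[of "one C \<triangleright> x" "ih A x z \<triangleright> x" z "g \<unrhd> ide L x" "iev A x z"] iev_in_hom[OF x z]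
        action_in_hom[OF I h x x g L.ide_in_hom[OF x]] x z h by simp
    then show ?thesis using eq by (simp add: transpose_def)
  qed
  then show "comparison x z \<psi> = comparison x z \<psi>'"
    unfolding comparison_def using NC.nin_cong[OF I h T T'] by simp
next
  fix z z' f \<psi> assume "z \<in> obj L" "z' \<in> obj L" "f \<in> hom L z z'" "functional L (hom L (one C \<triangleright> x) z') \<psi>"
  then show "comparison x z' \<psi> \<cdot>\<^bsub>L\<^esub> f = comparison x z (\<lambda>v. \<psi> (f \<cdot>\<^bsub>L\<^esub> v))"
    by (rule comparison_post[OF x])
qed

text \<open>The part of \<open>nak_serre\<close> that remains without the identification N x \<cong>
  N (1 \<triangleright> x).\<close>

definition nakl where
  "nakl x = nak_rra C NC L NL (act_on L A x) (ih A x) (act_on L A (S x)) (iev A x)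
     (\<lambda>z. (ide C (ih A x z) \<unrhd> iev A z (S x)) \<cdot>\<^bsub>L\<^esub> masc A (ih A x z) (ih A z (S x)) z \<cdot>\<^bsub>L\<^esub>
        (((ide C (ih A x z) \<boxtimes>\<^bsub>C\<^esub> sphi A x z) \<cdot>\<^bsub>C\<^esub> rdco C (ih A x z)) \<unrhd> ide L z) \<cdot>\<^bsub>L\<^esub> imun C L A z) (one C)"

lemma nak_serre_eq: "nak_serre C NC L NL A x = nakl x \<cdot>\<^bsub>L\<^esub> far (nfn NL) (imun C L A x)"
  by (simp add: nak_serre_def nakl_def)

text \<open>The description in \<open>nak_rra\<close> is well defined: \<open>comparison x\<close>
  is a dinatural family and N (1 \<triangleright> x) is universal.\<close>

lemma
  assumes x: "x \<in> obj L"
  shows nakl_in_hom: "nakl x \<in> hom L (N (one C \<triangleright> x)) (D \<triangleright> S x)"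
    and nakl_nin: "\<lbrakk>z \<in> obj L; functional L (hom L (one C \<triangleright> x) z) \<psi>\<rbrakk> \<Longrightarrow>
      nakl x \<cdot>\<^bsub>L\<^esub> nin NL (one C \<triangleright> x) z \<psi> = comparison x z \<psi>"
proof -
  let ?P = "\<lambda>l. l \<in> hom L (N (one C \<triangleright> x)) (D \<triangleright> S x) \<and>
    (\<forall>z\<in>obj L. \<forall>\<psi>. functional L (hom L (one C \<triangleright> x) z) \<psi> \<longrightarrow>
      l \<cdot>\<^bsub>L\<^esub> nin NL (one C \<triangleright> x) z \<psi> = comparison x z \<psi>)"
  have "nakl x = (THE l. ?P l)"
    unfolding nakl_def nak_rra_def act_on_def
    by (intro arg_cong[where f = The] ext)
      (auto simp: eta_arr_of_eq[OF x] comparison_def transpose_def)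
  moreover have "\<exists>!l. ?P l"
    by (rule NL.nin_universal) (use x comparison_dinatural in simp_all)
  ultimately have "?P (nakl x)" using theI'[of ?P] by simp
  then show "nakl x \<in> hom L (N (one C \<triangleright> x)) (D \<triangleright> S x)"
    "\<lbrakk>z \<in> obj L; functional L (hom L (one C \<triangleright> x) z) \<psi>\<rbrakk> \<Longrightarrow>
      nakl x \<cdot>\<^bsub>L\<^esub> nin NL (one C \<triangleright> x) z \<psi> = comparison x z \<psi>"
    by blast+
qed

text \<open>Only injectivity of \<open>g \<mapsto> (g \<triangleright> S x) \<cdot> \<eta>\<close> is available, and only for targets isomorphic to \<open>1\<close> such as
  \<open>D\<close>; dimension counting replaces surjectivity.\<close>

lemma nakl_is_iso:
  assumes x: "x \<in> obj L"
  shows "is_iso L (N (one C \<triangleright> x)) (D \<triangleright> S x) (nakl x)"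
proof -
  let ?I = "one C"
  have ob [simp]: "?I \<triangleright> x \<in> obj L" "S x \<in> obj L" "D \<triangleright> S x \<in> obj L" using x by simp_all
  obtain s where s: "is_iso C ?I D s" using NC.ex_iso_nfn[of ?I] by auto
  obtain k where k: "is_iso L (?I \<triangleright> x) (N (?I \<triangleright> x)) k" using NL.ex_iso_nfn[of "?I \<triangleright> x"] by auto
  define s' where "s' = inv_arr C ?I D s"
  have s': "is_iso C D ?I s'" unfolding s'_def by (rule C.is_iso_inv_arr[OF _ _ s]) simp_all
  \<comment> \<open>Some isomorphism between the two objects, unrelated to \<open>nakl x\<close>: D
    \<cong> 1 and 1 \<triangleright> x \<cong> N (1 \<triangleright> x) come from representability
    of dual hom spaces, S x \<cong> x comes from \<open>t\<close>.\<close>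
  define H where "H = (?I \<triangleright> x, k, N (?I \<triangleright> x)) \<star> timun C L A x \<star>
    (S x, inv_arr L x (S x) (t x), x) \<star> tmun C A (S x) \<star> ((D, s', ?I) \<rhd> tid L (S x))"
  have "tiso L H"
    unfolding H_def
    by (intro L.tiso_tcmp tiso_tact L.tiso_triple C.tiso_triple L.tiso_tid k s' L.is_iso_inv_arr t_iso tiso_action)
      (use x in simp_all)
  moreover have "H = (D \<triangleright> S x, fst (snd H), N (?I \<triangleright> x))"
    by (simp add: H_def tcmp_def tact_def tid_def)
  ultimately have hiso: "is_iso L (D \<triangleright> S x) (N (?I \<triangleright> x)) (fst (snd H))"
    using L.tiso_is_iso by metis
  show ?thesis
  proof (rule L.mono_isomorphic_is_iso[OF _ _ nakl_in_hom[OF x] hiso])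
    fix v assume v: "v \<in> hom L (D \<triangleright> S x) (N (?I \<triangleright> x))" and 0: "nakl x \<cdot>\<^bsub>L\<^esub> v = 0"
    let ?w = "D \<triangleright> S x"
    let ?h = "ih A x ?w"
    have h [simp]: "?h \<in> obj C" using x by simp
    have I: "?I \<in> obj C" by simp
    \<comment> \<open>Surjectivity of \<open>nin\<close> replaces \<open>v\<close> by a functional.
      The rest traces the vanishing of its comparison back to the vanishing of
      \<open>\<psi>\<close>.\<close>
    obtain \<psi> where \<psi>: "functional L (hom L (?I \<triangleright> x) ?w) \<psi>" "nin NL (?I \<triangleright> x) ?w \<psi> = v"
      using NL.nin_surj[OF ob(1,3) v] .
    define u where "u = nin NC ?I ?h (transpose x ?w \<psi>)"
    note T = transpose_functional[OF x ob(3) \<psi>(1)]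
    have u: "u \<in> hom C ?h D" unfolding u_def by (rule NC.nin_in_hom[OF I h T])
    have c0: "comparison x ?w \<psi> = 0" using nakl_nin[OF x ob(3) \<psi>(1)] \<psi>(2) 0 by simp
    have e: "eta_arr_of x ?w \<in> hom L ?w (?h \<triangleright> S x)" by (rule eta_arr_of_in_hom[OF x ob(3)])
    have s'h: "s' \<in> hom C D ?I" by (rule C.is_iso_in_hom[OF s'])
    \<comment> \<open>\<open>s'\<close> moves the target from D to the unit object, where
      \<open>eta_cancel\<close> applies.\<close>
    have "(?h, s' \<cdot>\<^bsub>C\<^esub> u, ?I) = (?h, 0, ?I)"
    proof (rule eta_cancel[OF x ob(3)])
      show "tarr C (?h, s' \<cdot>\<^bsub>C\<^esub> u, ?I)" using C.cmp_in_hom[OF h D_obj I u s'h] by simp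
      show "tarr C (?h, 0, ?I)" using C.hom_zero[OF h I] by simp
      have 1: "((?h, s' \<cdot>\<^bsub>C\<^esub> u, ?I) \<rhd> tid L (S x)) = ((D, s', ?I) \<rhd> tid L (S x)) \<star> ((?h, u, D) \<rhd> tid L (S x))"
      proof -
        have "(?h, s' \<cdot>\<^bsub>C\<^esub> u, ?I) = (D, s', ?I) \<bullet>\<^bsub>C\<^esub> (?h, u, D)" by (simp add: tcmp_def)
        then show ?thesis using u s'h by (simp add: tact_interchange)
      qed
      have "((?h, s' \<cdot>\<^bsub>C\<^esub> u, ?I) \<rhd> tid L (S x)) \<star> eta x ?w
        = ((D, s', ?I) \<rhd> tid L (S x)) \<star> (?w, comparison x ?w \<psi>, ?w)"
        unfolding 1 comparison_triple[OF x ob(3)] u_def[symmetric] using u s'h x by simp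
      also have "\<dots> = (?w, 0, ?I \<triangleright> S x)"
        unfolding c0 using L.cmp_zero_right[OF ob(3,3) act_obj[OF I ob(2)], of "s' \<unrhd> ide L (S x)"]
          action_in_hom[OF D_obj I ob(2,2) s'h L.ide_in_hom[OF ob(2)]]
        by (simp add: tcmp_def tact_def tid_def)
      also have "\<dots> = ((?h, 0, ?I) \<rhd> tid L (S x)) \<star> eta x ?w"
        unfolding eta_triple
        using act_ide_scl[OF ob(2) h I C.hom_zero[OF h I], of 0]
          L.cmp_zero_left[OF ob(3) act_obj[OF h ob(2)] act_obj[OF I ob(2)] e]
        by (simp add: tcmp_def tact_def tid_def)
      finally show "((?h, s' \<cdot>\<^bsub>C\<^esub> u, ?I) \<rhd> tid L (S x)) \<star> eta x ?w
        = ((?h, 0, ?I) \<rhd> tid L (S x)) \<star> eta x ?w" .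
    qed simp_all
    then have "s' \<cdot>\<^bsub>C\<^esub> u = s' \<cdot>\<^bsub>C\<^esub> 0" using C.cmp_zero_right[OF h D_obj I s'h] by simp
    then have u0: "u = 0" using C.iso_cancel_left[OF h D_obj I s' u C.hom_zero[OF h D_obj]] by blast
    have T0: "transpose x ?w \<psi> g = 0" if g: "g \<in> hom C ?I ?h" for g
    proof -
      have "functional C (hom C ?I ?h) (\<lambda>g. 0 * transpose x ?w \<psi> g)" by (simp add: functional_def)
      moreover have "nin NC ?I ?h (transpose x ?w \<psi>) = nin NC ?I ?h (\<lambda>g. 0 * transpose x ?w \<psi> g)"
        using NC.nin_scl[OF I h T, of 0] u0 by (simp add: u_def)
      ultimately show ?thesis using NC.nin_inj[OF I h T _ _ g] by fastforce
    qed
    \<comment> \<open>Every \<open>f\<close> comes from some \<open>g\<close> by uncurrying, so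
      \<open>\<psi>\<close> vanishes together with its transpose.\<close>
    have "\<psi> f = 0 * \<psi> f" if f: "f \<in> hom L (?I \<triangleright> x) ?w" for f
      using T0[OF curry_ih(1)[OF x ob(3) I f]] curry_ih(2)[OF x ob(3) I f] by (simp add: transpose_def)
    then have "nin NL (?I \<triangleright> x) ?w \<psi> = nin NL (?I \<triangleright> x) ?w (\<lambda>f. 0 * \<psi> f)"
      by (intro NL.nin_cong[OF ob(1,3) \<psi>(1)]) (simp_all add: functional_def)
    then show "v = 0" using NL.nin_scl[OF ob(1,3) \<psi>(1), of 0] \<psi>(2) by simp
  qed (use x in simp_all)
qed

text \<open>Dinaturality of \<open>NC\<close> turns precomposition with \<open>f\<close> into the
  induced morphism \<open>P\<close> of internal Homs; \<open>eta_dinatural\<close> exchanges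
  \<open>P\<close> for the action of S on \<open>f\<close>.\<close>

lemma comparison_pre:
  assumes x: "x \<in> obj L" "x' \<in> obj L" and f: "f \<in> hom L x x'" and z: "z \<in> obj L"
    and \<psi>: "functional L (hom L (one C \<triangleright> x) z) \<psi>"
  shows "comparison x' z (\<lambda>v. \<psi> (v \<cdot>\<^bsub>L\<^esub> (ide C (one C) \<unrhd> f)))
    = (ide C D \<unrhd> far (sf A) f) \<cdot>\<^bsub>L\<^esub> comparison x z \<psi>"
proof -
  let ?I = "one C" and ?h = "ih A x z" and ?h' = "ih A x' z"
  let ?F = "(x, f, x')"
  have h: "?h \<in> obj C" "?h' \<in> obj C" and I: "?I \<in> obj C" and Ix: "?I \<triangleright> x \<in> obj L" "?I \<triangleright> x' \<in> obj L"
    using x z by simp_all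
  have F [simp]: "tarr L ?F" using x f by simp
  have If: "ide C ?I \<unrhd> f \<in> hom L (?I \<triangleright> x) (?I \<triangleright> x')"
    by (rule action_in_hom[OF I I x C.ide_in_hom[OF I] f])
  define P where "P = ih_pre C L A x x' z f"
  have PF: "tpre C L A ?F z = (?h', P, ?h)" by (simp add: tpre_def P_def)
  have P: "P \<in> hom C ?h' ?h" using tarr_tpre[OF z F] by (simp add: PF)
  note T = transpose_functional[OF x(1) z \<psi>]
  let ?u = "nin NC ?I ?h (transpose x z \<psi>)" and ?\<psi>' = "\<lambda>v. \<psi> (v \<cdot>\<^bsub>L\<^esub> (ide C ?I \<unrhd> f))"
  have u: "?u \<in> hom C ?h D" by (rule NC.nin_in_hom[OF I h(1) T])
  have \<psi>': "functional L (hom L (?I \<triangleright> x') z) ?\<psi>'"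
    by (rule L.functional_precompose[OF \<psi> If Ix z])
  have "transpose x' z ?\<psi>' g = transpose x z \<psi> (P \<cdot>\<^bsub>C\<^esub> g)" if g: "g \<in> hom C ?I ?h'" for g
  proof -
    let ?G = "(?I, g, ?h')"
    have G: "tarr C ?G" using h I g by simp
    have 1: "(tpre C L A ?F z \<bullet>\<^bsub>C\<^esub> ?G) \<rhd> tid L x = (tpre C L A ?F z \<rhd> tid L x) \<star> (?G \<rhd> tid L x)"
      using G x by (simp add: tact_interchange PF h P)
    have 2: "(?G \<rhd> tid L x') \<star> (tid C ?I \<rhd> ?F) = (tid C ?h' \<rhd> ?F) \<star> (?G \<rhd> tid L x)"
      using G x f h I g by (simp add: tact_interchange)
    have 3: "tiev A x z \<star> (tpre C L A ?F z \<rhd> tid L x) = tiev A x' z \<star> (tid C ?h' \<rhd> ?F)"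
      using tiev_tpre[OF z F] by simp
    have "(tiev A x' z \<star> (?G \<rhd> tid L x')) \<star> (tid C ?I \<rhd> ?F)
      = (tiev A x' z \<star> (tid C ?h' \<rhd> ?F)) \<star> (?G \<rhd> tid L x)"
      using x z f g h I by (simp add: 2)
    also have "\<dots> = tiev A x z \<star> ((tpre C L A ?F z \<bullet>\<^bsub>C\<^esub> ?G) \<rhd> tid L x)"
      unfolding 1 3[symmetric] using x z f g h I P by (simp add: PF)
    finally show ?thesis
      by (simp add: transpose_def PF tcmp_def tact_def tid_def tiev_def)
  qed
  then have "nin NC ?I ?h' (transpose x' z ?\<psi>') = nin NC ?I ?h' (\<lambda>g. transpose x z \<psi> (P \<cdot>\<^bsub>C\<^esub> g))"
    by (intro NC.nin_cong[OF I h(2)] C.functional_postcompose[OF T P I h(2,1)]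
        transpose_functional[OF x(2) z \<psi>'])
  then have uP: "nin NC ?I ?h' (transpose x' z ?\<psi>') = ?u \<cdot>\<^bsub>C\<^esub> P"
    using NC.nin_cmp[OF I h(2,1) P T] by simp
  have 1: "((?h', ?u \<cdot>\<^bsub>C\<^esub> P, D) \<rhd> tid L (S x'))
      = ((?h, ?u, D) \<rhd> tid L (S x')) \<star> ((?h', P, ?h) \<rhd> tid L (S x'))"
  proof -
    have "(?h', ?u \<cdot>\<^bsub>C\<^esub> P, D) = (?h, ?u, D) \<bullet>\<^bsub>C\<^esub> (?h', P, ?h)" by (simp add: tcmp_def)
    then show ?thesis using x h u P by (simp add: tact_interchange)
  qed
  have 2: "((?h', P, ?h) \<rhd> tid L (S x')) \<star> eta x' z = (tid C ?h \<rhd> tfar (sf A) ?F) \<star> eta x z"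
    using eta_dinatural[OF z F] by (simp add: PF)
  have 3: "((?h, ?u, D) \<rhd> tid L (S x')) \<star> (tid C ?h \<rhd> tfar (sf A) ?F)
      = (tid C D \<rhd> tfar (sf A) ?F) \<star> ((?h, ?u, D) \<rhd> tid L (S x))"
    using x h u tarr_tfar_sf[OF F] by (simp add: tact_interchange)
  have "(z, comparison x' z ?\<psi>', D \<triangleright> S x')
    = ((?h, ?u, D) \<rhd> tid L (S x')) \<star> ((?h', P, ?h) \<rhd> tid L (S x')) \<star> eta x' z"
    unfolding comparison_triple[OF x(2) z] uP 1 using x z h u P by simp
  also have "\<dots> = (((?h, ?u, D) \<rhd> tid L (S x')) \<star> (tid C ?h \<rhd> tfar (sf A) ?F)) \<star> eta x z"
    unfolding 2 using x z h u F tarr_tfar_sf[OF F] by simp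
  also have "\<dots> = (tid C D \<rhd> tfar (sf A) ?F) \<star> (z, comparison x z \<psi>, D \<triangleright> S x)"
    unfolding 3 comparison_triple[OF x(1) z] using x z h u tarr_tfar_sf[OF F] by simp
  finally show ?thesis by (simp add: tcmp_def tact_def tfar_def tid_def)
qed

lemma nakl_natural:
  assumes x: "x \<in> obj L" "x' \<in> obj L" and f: "f \<in> hom L x x'"
  shows "nakl x' \<cdot>\<^bsub>L\<^esub> far (nfn NL) (ide C (one C) \<unrhd> f) = (ide C D \<unrhd> far (sf A) f) \<cdot>\<^bsub>L\<^esub> nakl x"
proof -
  let ?I = "one C"
  let ?y = "?I \<triangleright> x" and ?y' = "?I \<triangleright> x'"
  have y: "?y \<in> obj L" "?y' \<in> obj L" "N ?y \<in> obj L" "N ?y' \<in> obj L" and I: "?I \<in> obj C"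
    and S: "S x \<in> obj L" "S x' \<in> obj L" "D \<triangleright> S x \<in> obj L" "D \<triangleright> S x' \<in> obj L" using x by simp_all
  have If: "ide C ?I \<unrhd> f \<in> hom L ?y ?y'"
    by (rule action_in_hom[OF I I x C.ide_in_hom[OF I] f])
  have NIf: "far (nfn NL) (ide C ?I \<unrhd> f) \<in> hom L (N ?y) (N ?y')" by (rule NL.nfn_in_hom[OF y(1,2) If])
  have Sf: "far (sf A) f \<in> hom L (S x) (S x')" using sf_linear x f by (simp add: linear_functor_def)
  have DSf: "ide C D \<unrhd> far (sf A) f \<in> hom L (D \<triangleright> S x) (D \<triangleright> S x')"
    by (rule action_in_hom[OF D_obj D_obj S(1,2) C.ide_in_hom[OF D_obj] Sf])
  \<comment> \<open>As \<open>nin\<close> is onto, the identity of N (1 \<triangleright> x) is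
    itself a structure morphism, so this one component of the coend decides the equality.\<close>
  obtain \<psi> where \<psi>: "functional L (hom L ?y (N ?y)) \<psi>" "nin NL ?y (N ?y) \<psi> = ide L (N ?y)"
    using NL.nin_surj[OF y(1,3) L.ide_in_hom[OF y(3)]] .
  note n = NL.nin_in_hom[OF y(1,3) \<psi>(1)]
  have "(nakl x' \<cdot>\<^bsub>L\<^esub> far (nfn NL) (ide C ?I \<unrhd> f)) \<cdot>\<^bsub>L\<^esub> nin NL ?y (N ?y) \<psi>
    = nakl x' \<cdot>\<^bsub>L\<^esub> nin NL ?y' (N ?y) (\<lambda>v. \<psi> (v \<cdot>\<^bsub>L\<^esub> (ide C ?I \<unrhd> f)))"
    unfolding L.cmp_assoc[OF y(3,3,4) S(4) n NIf nakl_in_hom[OF x(2)]] NL.nfn_nin[OF y(1,2) If y(3) \<psi>(1)] ..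
  also have "\<dots> = (ide C D \<unrhd> far (sf A) f) \<cdot>\<^bsub>L\<^esub> comparison x (N ?y) \<psi>"
    unfolding nakl_nin[OF x(2) y(3) L.functional_precompose[OF \<psi>(1) If y(1,2,3)]]
    by (rule comparison_pre[OF x f y(3) \<psi>(1)])
  also have "\<dots> = ((ide C D \<unrhd> far (sf A) f) \<cdot>\<^bsub>L\<^esub> nakl x) \<cdot>\<^bsub>L\<^esub> nin NL ?y (N ?y) \<psi>"
    unfolding nakl_nin[OF x(1) y(3) \<psi>(1), symmetric]
      L.cmp_assoc[OF y(3,3) S(3,4) n nakl_in_hom[OF x(1)] DSf] ..
  finally show ?thesis
    unfolding \<psi>(2) L.cmp_ide[OF y(3) S(4) L.cmp_in_hom[OF y(3,4) S(4) NIf nakl_in_hom[OF x(2)]]]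
      L.cmp_ide[OF y(3) S(4) L.cmp_in_hom[OF y(3) S(3,4) nakl_in_hom[OF x(1)] DSf]] .
qed

section \<open>Trivializations of the Nakayama functor\<close>

definition tnak where "tnak x = (N x, nak_serre C NC L NL A x, D \<triangleright> S x)"

lemma tnak_eq: "tnak x = (N (one C \<triangleright> x), nakl x, D \<triangleright> S x) \<star> tfar (nfn NL) (timun C L A x)"
  by (simp add: tnak_def nak_serre_eq tcmp_def tfar_def timun_def)

lemma tnak_dom_cod [simp]: "tdom (tnak x) = N x" "tcod (tnak x) = D \<triangleright> S x"
  by (simp_all add: tnak_def)

lemma tiso_tnak [simp]: "x \<in> obj L \<Longrightarrow> tiso L (tnak x)"
  unfolding tnak_eq
  by (intro L.tiso_tcmp L.tiso_tfar[OF NL.nfn_linear] L.tiso_triple nakl_is_iso tiso_action) simp_all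

lemma nak_serre_is_iso: "x \<in> obj L \<Longrightarrow> is_iso L (N x) (D \<triangleright> S x) (nak_serre C NC L NL A x)"
  using tiso_tnak[of x] unfolding tnak_def by (rule L.tiso_is_iso)

lemma tarr_tnak [simp]: "x \<in> obj L \<Longrightarrow> tarr L (tnak x)"
  by (simp del: tarr_triple)

lemma tnak_natural:
  assumes F [simp]: "tarr L F"
  shows "tnak (tcod F) \<star> tfar (nfn NL) F = (tid C D \<rhd> tfar (sf A) F) \<star> tnak (tdom F)"
proof -
  obtain x f x' where Feq: "F = (x, f, x')" by (cases F)
  have x [simp]: "x \<in> obj L" "x' \<in> obj L" and f: "f \<in> hom L x x'" using F unfolding Feq by simp_all
  let ?l = "\<lambda>x. (N (one C \<triangleright> x), nakl x, D \<triangleright> S x)" and ?u = "timun C L A"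
  note Nf = L.linear_functor_tfar[OF NL.nfn_linear]
  have l [simp]: "tarr L (?l x)" if "x \<in> obj L" for x using that nakl_in_hom by simp
  have u: "?u x' \<star> F = (tid C (one C) \<rhd> F) \<star> ?u x" using timun_natural[OF F] by (simp add: Feq)
  have nat: "?l x' \<star> tfar (nfn NL) (tid C (one C) \<rhd> F) = (tid C D \<rhd> tfar (sf A) F) \<star> ?l x"
    using nakl_natural[OF x f] by (simp add: Feq tcmp_def tact_def tfar_def tid_def)
  have xF [simp]: "tdom F = x" "tcod F = x'" by (simp_all add: Feq)
  have "tnak x' \<star> tfar (nfn NL) F = ?l x' \<star> (tfar (nfn NL) (?u x') \<star> tfar (nfn NL) F)"
    unfolding tnak_eq by (rule L.tcmp_assoc) (simp_all add: Nf(1) del: tarr_triple)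
  also have "tfar (nfn NL) (?u x') \<star> tfar (nfn NL) F = tfar (nfn NL) (tid C (one C) \<rhd> F) \<star> tfar (nfn NL) (?u x)"
    by (simp add: Nf(3)[symmetric] u del: tarr_triple)
  also have "?l x' \<star> \<dots> = (tid C D \<rhd> tfar (sf A) F) \<star> (?l x \<star> tfar (nfn NL) (?u x))"
    using L.tcmp_tail[OF nat, of "tfar (nfn NL) (?u x)"] by (simp add: Nf(1) del: tarr_triple)
  finally show ?thesis by (simp add: tnak_eq)
qed

lemma inak_serre_tcmp:
  assumes "x \<in> obj L"
  shows "tnak x \<star> (D \<triangleright> S x, inak_serre C NC L NL A x, N x) = tid L (D \<triangleright> S x)"
    and "tiso L (D \<triangleright> S x, inak_serre C NC L NL A x, N x)"
  unfolding tnak_def inak_serre_def dist_obj_def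
  by (rule L.tcmp_inv_arr L.tiso_triple L.is_iso_inv_arr nak_serre_is_iso; use assms nak_serre_is_iso L.is_iso_inv_arr in simp)+

context
  fixes s assumes s_iso: "is_iso C (one C) D s"
begin

text \<open>The \<Phi> of \<open>calabi_yau_twisted_trace\<close>, for an arbitrary isomorphism
  \<open>s\<close>. With the standard trivialization as \<open>s\<close> it is the morphism inside
  the left and the right trace.\<close>

definition trivialization where
  "trivialization x = inak_serre C NC L NL A x \<cdot>\<^bsub>L\<^esub> (s \<unrhd> t x) \<cdot>\<^bsub>L\<^esub> imun C L A x"

lemma trivialization_triple:
  assumes x: "x \<in> obj L"
  shows "(x, trivialization x, N x) = (D \<triangleright> S x, inak_serre C NC L NL A x, N x) \<star>
    ((one C, s, D) \<rhd> (x, t x, S x)) \<star> timun C L A x"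
proof -
  have "((D \<triangleright> S x, inak_serre C NC L NL A x, N x) \<star> ((one C, s, D) \<rhd> (x, t x, S x))) \<star> timun C L A x
    = (x, trivialization x, N x)"
    by (simp add: trivialization_def tcmp_def tact_def timun_def del: L.tcmp_assoc)
  then show ?thesis
    using x inak_serre_tcmp(2)[OF x] C.is_iso_in_hom[OF s_iso] L.is_iso_in_hom[OF t_iso[OF x]]
      L.tiso_tarr[OF inak_serre_tcmp(2)[OF x]] by simp
qed

lemma trivialization_is_iso: "x \<in> obj L \<Longrightarrow> is_iso L x (N x) (trivialization x)"
  by (rule L.tiso_is_iso, unfold trivialization_triple)
    (intro L.tiso_tcmp tiso_tact C.tiso_triple L.tiso_triple inak_serre_tcmp(2) s_iso t_iso tiso_action; simp)

text \<open>Checked after composing with the isomorphism \<open>tnak y\<close>, which cancels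
  \<open>inak_serre\<close>; naturality of \<open>tnak\<close>, of \<open>t\<close> and of the unit
  constraint remains.\<close>

lemma trivialization_natural:
  assumes x: "x \<in> obj L" "y \<in> obj L" and f: "f \<in> hom L x y"
  shows "far (nfn NL) f \<cdot>\<^bsub>L\<^esub> trivialization x = trivialization y \<cdot>\<^bsub>L\<^esub> f"
proof -
  let ?F = "(x, f, y)" and ?T = "\<lambda>x. (x, trivialization x, N x)"
  let ?st = "\<lambda>x. (one C, s, D) \<rhd> (x, t x, S x)"
  have F [simp]: "tarr L ?F" using x f by simp
  have sh: "s \<in> hom C (one C) D" by (rule C.is_iso_in_hom[OF s_iso])
  have th: "t x \<in> hom L x (S x)" if "x \<in> obj L" for x by (rule L.is_iso_in_hom[OF t_iso[OF that]])
  have T [simp]: "tarr L (?T x)" if "x \<in> obj L" for x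
    using L.is_iso_in_hom[OF trivialization_is_iso[OF that]] that by simp
  have st [simp]: "tarr L (?st x)" if "x \<in> obj L" for x using that sh th by simp
  note NF = L.linear_functor_tfar(1)[OF NL.nfn_linear F]
  have nakT: "tnak z \<star> ?T z = ?st z \<star> timun C L A z" if z: "z \<in> obj L" for z
    unfolding trivialization_triple[OF z]
    using L.tcmp_tail[OF inak_serre_tcmp(1)[OF z], of "?st z \<star> timun C L A z"] z st[OF z]
      L.tiso_tarr[OF inak_serre_tcmp(2)[OF z]] by simp
  have tnat: "(tid C D \<rhd> tfar (sf A) ?F) \<star> ?st x = ?st y \<star> (tid C (one C) \<rhd> ?F)"
  proof -
    have "tfar (sf A) ?F \<star> (x, t x, S x) = (y, t y, S y) \<star> ?F"
      using t_natural[OF x f] by (simp add: tcmp_def tfar_def)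
    then show ?thesis
      using x sh th[OF x(1)] th[OF x(2)] f tarr_tfar_sf[OF F] by (simp add: tact_interchange)
  qed
  have "tnak y \<star> (tfar (nfn NL) ?F \<star> ?T x) = (tid C D \<rhd> tfar (sf A) ?F) \<star> (tnak x \<star> ?T x)"
    using L.tcmp_tail[OF tnak_natural[OF F], of "?T x"] x NF T[OF x(1)] tarr_tfar_sf[OF F] by simp
  also have "\<dots> = ?st y \<star> ((tid C (one C) \<rhd> ?F) \<star> timun C L A x)"
    unfolding nakT[OF x(1)]
    using L.tcmp_tail[OF tnat, of "timun C L A x"] x st[OF x(1)] st[OF x(2)] f tarr_tfar_sf[OF F] by simp
  also have "\<dots> = (?st y \<star> timun C L A y) \<star> ?F"
    using timun_natural[OF F] x st[OF x(2)] f by simp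
  also have "\<dots> = tnak y \<star> (?T y \<star> ?F)"
    unfolding nakT[OF x(2), symmetric] using x T[OF x(2)] f by simp
  finally have "tfar (nfn NL) ?F \<star> ?T x = ?T y \<star> ?F"
    by (rule L.tiso_cancel_left[of "tnak y", rotated -1]) (use x NF T[OF x(1)] T[OF x(2)] f in simp_all)
  then show ?thesis by (simp add: tcmp_def tfar_def)
qed

text \<open>Interchange separates \<open>t\<close> from \<open>s\<close> and lets \<open>t\<close>
  act first. This is the order of the factors in the sphericality condition.\<close>

lemma trivialization_split:
  assumes x [simp]: "x \<in> obj L"
  shows "(x, trivialization x, N x) = (D \<triangleright> S x, inak_serre C NC L NL A x, N x) \<star>
    ((one C, s, D) \<rhd> tid L (S x)) \<star> timun C L A (S x) \<star> (x, t x, S x)"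
proof -
  note st = C.is_iso_in_hom[OF s_iso] L.is_iso_in_hom[OF t_iso[OF x]]
  have "timun C L A (S x) \<star> (x, t x, S x) = (tid C (one C) \<rhd> (x, t x, S x)) \<star> timun C L A x"
    using timun_natural[of "(x, t x, S x)"] st by simp
  moreover have "(one C, s, D) \<rhd> (x, t x, S x)
    = ((one C, s, D) \<rhd> tid L (S x)) \<star> (tid C (one C) \<rhd> (x, t x, S x))"
    using st by (simp add: tact_interchange)
  ultimately show ?thesis
    unfolding trivialization_triple[OF x] using st by simp
qed

text \<open>All morphisms applied after \<open>T\<close> in the assumption are invertible, so
  \<open>t x\<close> determines \<open>T\<close>. The assumption has the shape of sphericality, with
  \<open>T\<close> coming from the other action.\<close>

lemma trivialization_unique:
  assumes x [simp]: "x \<in> obj L" and T: "tarr L T" "tdom T = x" "tcod T = N x"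
    and eq: "(x, t x, S x) = tmun C A (S x) \<star>
      ((D, inv_arr C (one C) D s, one C) \<rhd> tid L (S x)) \<star> tnak x \<star> T"
  shows "(x, trivialization x, N x) = T"
proof -
  let ?i = "(D \<triangleright> S x, inak_serre C NC L NL A x, N x)"
  have i: "tarr L ?i" by (rule L.tiso_tarr[OF inak_serre_tcmp(2)[OF x]])
  note st = C.is_iso_in_hom[OF s_iso] C.inv_arr_in_hom[OF _ D_obj s_iso]
  have 1: "((one C, s, D) \<rhd> tid L (S x)) \<star> ((D, inv_arr C (one C) D s, one C) \<rhd> tid L (S x))
    = tid L (D \<triangleright> S x)"
    using st C.tcmp_inv_arr[OF _ D_obj s_iso] by (simp add: tact_interchange)
  have "tnak x \<star> (x, trivialization x, N x) = ((one C, s, D) \<rhd> tid L (S x)) \<star> timun C L A (S x) \<star> (x, t x, S x)"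
    unfolding trivialization_split[OF x]
    using L.tcmp_tail[OF inak_serre_tcmp(1)[OF x], of "((one C, s, D) \<rhd> tid L (S x)) \<star> timun C L A (S x) \<star> (x, t x, S x)"]
      i st L.is_iso_in_hom[OF t_iso[OF x]] by simp
  also have "\<dots> = tnak x \<star> T"
    unfolding eq using T st L.tcmp_tail[OF 1, of "tnak x \<star> T"] by simp
  finally show ?thesis
    by (rule L.tiso_cancel_left[of "tnak x", rotated -1])
      (use T L.is_iso_in_hom[OF trivialization_is_iso[OF x]] in simp_all)
qed

lemma calabi_yau_trivialization:
  "calabi_yau L (\<lambda>x f. twisted_trace L NL x (trivialization x \<cdot>\<^bsub>L\<^esub> f))"
  by (rule NL.calabi_yau_twisted_trace[of trivialization])
    (simp_all add: trivialization_is_iso trivialization_natural)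

end

end

section \<open>The two trace structures of a bimodule category\<close>

lemma reverse_simps [simp]:
  "obj (reverse C) = obj C" "hom (reverse C) = hom C" "ide (reverse C) = ide C" "cmp (reverse C) = cmp C"
  "scl (reverse C) = scl C" "one (reverse C) = one C" "tob (reverse C) a b = tob C b a"
  "tar (reverse C) f g = tar C g f" "asc (reverse C) a b c = iasc C c b a" "lun (reverse C) = run C"
  "run (reverse C) = lun C" "rd (reverse C) = ld C" "rdev (reverse C) = ldev C" "rdco (reverse C) = ldco C"
  "ld (reverse C) = rd C" "ldev (reverse C) = rdev C" "ldco (reverse C) = rdco C"
  by (simp_all add: reverse_def)

lemma reverse_arrows [simp]:
  "is_iso (reverse C) = is_iso C" "inv_arr (reverse C) = inv_arr C"
  "is_mono (reverse C) = is_mono C" "is_epi (reverse C) = is_epi C"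
  by (intro ext; simp add: is_iso_def inv_arr_def is_mono_def is_epi_def)+

lemma reverse_abelian [simp]:
  "is_zero (reverse C) = is_zero C" "is_biproduct (reverse C) = is_biproduct C"
  "is_kernel (reverse C) = is_kernel C" "is_cokernel (reverse C) = is_cokernel C"
  by (intro ext; simp add: is_zero_def is_biproduct_def is_kernel_def is_cokernel_def)+

lemma reverse_objects [simp]:
  "short_exact (reverse C) = short_exact C" "is_projective (reverse C) = is_projective C"
  "is_simple (reverse C) = is_simple C"
  by (intro ext; simp add: short_exact_def is_projective_def is_simple_def)+

text \<open>The predicate is inductive with the whole record as a parameter, so its independence of
  the tensor product needs an induction rather than an unfolding.\<close>

lemma finite_length_reverse: "finite_length C x \<Longrightarrow> finite_length (reverse C) x"
proof (induction rule: finite_length.induct)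
  case (zero z)
  then show ?case by (intro finite_length.zero) simp
next
  case (extension a b c f g)
  then show ?case by (intro finite_length.extension[of "reverse C" a b c f g]) simp_all
qed

lemma semisimple_obj_reverse: "semisimple_obj C x \<Longrightarrow> semisimple_obj (reverse C) x"
proof (induction rule: semisimple_obj.induct)
  case (zero z)
  then show ?case by (intro semisimple_obj.zero) simp
next
  case (sum a s b)
  then show ?case by (intro semisimple_obj.sum[of "reverse C" a s b]) simp_all
qed

lemma reverse_nakayama [simp]:
  "functional (reverse C) = functional C" "dinatural_family (reverse C) = dinatural_family C"
  "nakayama (reverse C) = nakayama C" "twisted_trace (reverse C) = twisted_trace C"
proof -
  show fn: "functional (reverse C) = functional C"
    by (intro ext) (simp only: functional_def reverse_simps)
  show df: "dinatural_family (reverse C) = dinatural_family C"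
    by (intro ext) (simp only: dinatural_family_def fn reverse_simps)
  show "nakayama (reverse C) = nakayama C"
    by (intro ext) (simp only: nakayama_def linear_functor_def fn df reverse_simps)
  show "twisted_trace (reverse C) = twisted_trace C"
    by (intro ext) (simp only: twisted_trace_def nak_pairing_def fn reverse_simps)
qed

lemma std_triv_reverse [simp]:
  "dist_obj (reverse C) N = dist_obj C N" "std_triv (reverse C) N = std_triv C N"
  by (simp_all add: dist_obj_def std_triv_def)

text \<open>The linear structure is that of \<open>D\<close>, and left and right duals change
  places. The monoidal axioms are a hypothesis because a module category over
  \<open>reverse D\<close> brings them along.\<close>

lemma fusion_category_reverse:
  assumes D: "fusion_category D" and "monoidal_category (reverse D)"
  shows "fusion_category (reverse D)"
proof -
  interpret D: fusion_category D by fact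
  interpret R: monoidal_category "reverse D" by fact
  have "abelian_category_axioms (reverse D)"
    using D.abelian_category_axioms unfolding abelian_category_def abelian_category_axioms_def by simp
  moreover have "finite_category_axioms (reverse D)"
    using D.finite_category_axioms finite_length_reverse[of D]
    unfolding finite_category_def finite_category_axioms_def by simp
  moreover have "is_duality (reverse D) a (ld D a) (ldev D a) (ldco D a)"
    and "is_duality (reverse D) (rd D a) a (rdev D a) (rdco D a)" if a: "a \<in> obj D" for a
  proof -
    \<comment> \<open>The associator of \<open>reverse D\<close> is an inverse associator of
      \<open>D\<close>, so inverting it leads back to \<open>asc D\<close>. This exchanges the two
      snake identities.\<close>
    have iasc: "iasc (reverse D) a b c = asc D c b a"
      if "a \<in> obj D" "b \<in> obj D" "c \<in> obj D" for a b c
      using that D.inv_arr_inv_arr[OF _ _ D.asc_iso, of c b a] by (simp add: iasc_def[of "reverse D"] iasc_def[of D])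
    have dual: "is_duality (reverse D) b a e d" if "is_duality D a b e d" for a b e d
      using that iasc unfolding is_duality_def by simp
    show "is_duality (reverse D) a (ld D a) (ldev D a) (ldco D a)"
      and "is_duality (reverse D) (rd D a) a (rdev D a) (rdco D a)"
      using dual D.left_dual[OF a] D.right_dual[OF a] by blast+
  qed
  moreover have "semisimple_category (reverse D)"
    using D.semisimple semisimple_obj_reverse[of D] by (simp add: semisimple_category_def)
  ultimately show ?thesis
    unfolding fusion_category_def fusion_category_axioms_def finite_category_def abelian_category_def
    using R.monoidal_category_axioms R.linear_category_axioms D.simple_one by simp
qed

text \<open>The unit object is simple, hence projective in a fusion category; exactness makes 1
  \<triangleright> x projective, and x is a retract of it. With all objects projective, every
  composition series splits.\<close>

lemma exact_module_semisimple:
  assumes "fusion_category C" and ex: "exact_module C L A"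
  shows "semisimple_category L"
proof -
  interpret C: fusion_category C by fact
  interpret module_category C L A using ex by (simp add: exact_module_def)
  have one: "is_projective C (one C)"
    by (rule C.simple_is_projective[OF C.semisimple C.simple_one])
  have "is_projective L x" if x: "x \<in> obj L" for x
  proof (rule L.is_projective_retract)
    show "is_projective L (one C \<triangleright>\<^bsub>A\<^esub> x)" using ex one x by (simp add: exact_module_def)
    note m = mun_iso[OF x]
    have o: "one C \<triangleright>\<^bsub>A\<^esub> x \<in> obj L" using x by simp
    show "x \<in> obj L" by fact
    show "imun C L A x \<in> hom L x (one C \<triangleright>\<^bsub>A\<^esub> x)" "mun A x \<in> hom L (one C \<triangleright>\<^bsub>A\<^esub> x) x"
      "mun A x \<cdot>\<^bsub>L\<^esub> imun C L A x = ide L x"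
      unfolding imun_def using L.inv_arr_in_hom[OF o x m] L.is_iso_in_hom[OF m] L.cmp_inv_arr[OF o x m] .
  qed
  then show ?thesis
    unfolding semisimple_category_def using L.semisimple_obj_if_projective L.finite_length by blast
qed

lemma nakayama_category_semisimple:
  fixes X :: "('o, 'm::ab_group_add, 'k::alg_closed_field, 'z) lincat_scheme"
  assumes "finite_category X" "semisimple_category X" "nakayama X N"
  shows "nakayama_category X N"
proof -
  interpret finite_category X by fact
  show ?thesis
    by unfold_locales (rule assms(3), rule semisimple_represents_dual[OF assms(1,2)])
qed

text \<open>Endomorphisms of the simple unit object are scalars, so the description of
  \<open>std_triv\<close> has exactly one solution.\<close>

lemma std_triv_is_iso:
  fixes C :: "('o, 'm::ab_group_add, 'k::alg_closed_field, 'z) rigcat_scheme"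
  assumes C: "fusion_category C" and N: "nakayama C N"
  shows "is_iso C (one C) (dist_obj C N) (std_triv C N)"
proof -
  interpret C: fusion_category C by fact
  have fin: "finite_category C" by (rule C.finite_category_axioms)
  interpret N: nakayama_category C N
    by (rule nakayama_category_semisimple[OF fin C.semisimple N])
  have "ide C (one C) \<noteq> 0"
    using C.ide_zero_imp_is_zero[OF C.one_obj] C.simple_one by (auto simp: is_simple_def)
  then have "\<exists>!s. is_iso C (one C) (fob (nfn N) (one C)) s \<and> twisted_trace C N (one C) s = 1"
    by (intro N.unique_normalized_trivialization C.one_obj simple_endomorphism_scalar[OF fin C.simple_one])
  from theI'[OF this] show ?thesis by (simp add: std_triv_def dist_obj_def)
qed

text \<open>Both \<open>C\<close> and, by exactness, \<open>L\<close> are semisimple, which yields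
  the representing functionals for the two Nakayama functors.\<close>

lemma serre_nakayamaI:
  fixes C :: "('o, 'm::ab_group_add, 'k::alg_closed_field, 'x) rigcat_scheme"
  assumes C: "fusion_category C" "nakayama C NC" "nakayama L NL"
    and A: "exact_module C L A" "internal_hom C L A" "relative_serre C L A"
    and t: "bimodule_trivialization C p E l L A B mid t"
  shows "serre_nakayama C L A NC NL t"
proof -
  interpret C: fusion_category C by fact
  interpret module_category C L A using A by (simp add: exact_module_def)
  have "serre_module C L A"
    by unfold_locales (use A in auto)
  moreover have "nakayama_category C NC"
    by (rule nakayama_category_semisimple[OF C.finite_category_axioms C.semisimple C(2)])
  moreover have "nakayama_category L NL"
    by (rule nakayama_category_semisimple[OF L.finite_category_axioms exact_module_semisimple[OF C(1) A(1)] C(3)])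
  moreover have "serre_nakayama_axioms L A t"
    using t unfolding serre_nakayama_axioms_def bimodule_trivialization_def by blast
  ultimately show ?thesis by (simp add: serre_nakayama_def)
qed

text \<open>In \<open>eq\<close>, the factors to the right of \<open>nak_serre R NR L NL B x\<close>
  are the trivialization for \<open>A\<close> in the form of \<open>trivialization_split\<close>.
  Uniqueness on the side of \<open>B\<close> identifies it with the trivialization for
  \<open>B\<close>.\<close>

lemma trivialized_radford_imp_trivialization_eq:
  assumes "serre_nakayama C L A NC NL p" "serre_nakayama R L B NR NL q"
    and s: "is_iso C (one C) (fob (nfn NC) (one C)) s" and r: "is_iso R (one R) (fob (nfn NR) (one R)) r"
    and x: "x \<in> obj L"
    and eq: "mun B (fob (sf B) x) \<cdot>\<^bsub>L\<^esub> (inv_arr R (one R) (fob (nfn NR) (one R)) r \<unrhd>\<^bsub>B\<^esub> ide L (fob (sf B) x)) \<cdot>\<^bsub>L\<^esub>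
      (nak_serre R NR L NL B x \<cdot>\<^bsub>L\<^esub> inak_serre C NC L NL A x) \<cdot>\<^bsub>L\<^esub>
      (s \<unrhd>\<^bsub>A\<^esub> ide L (fob (sf A) x)) \<cdot>\<^bsub>L\<^esub> imun C L A (fob (sf A) x) \<cdot>\<^bsub>L\<^esub> p x = q x"
  shows "serre_nakayama.trivialization C L A NC NL p s x = serre_nakayama.trivialization R L B NR NL q r x"
proof -
  interpret A: serre_nakayama C L A NC NL p by fact
  interpret B: serre_nakayama R L B NR NL q by fact
  define a where "a = inv_arr R (one R) B.D r"
  have a: "a \<in> hom R B.D (one R)" unfolding a_def by (rule B.C.inv_arr_in_hom[OF _ _ r]) simp_all
  let ?m = "tmun R B (B.S x)" and ?a = "(B.D, a, one R) \<rhd>\<^bsub>B\<^esub> tid L (B.S x)"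
    and ?i = "(A.D \<triangleright>\<^bsub>A\<^esub> A.S x, inak_serre C NC L NL A x, A.N x)"
    and ?s = "(one C, s, A.D) \<rhd>\<^bsub>A\<^esub> tid L (A.S x)" and ?u = "timun C L A (A.S x)" and ?p = "(x, p x, A.S x)"
  let ?T = "(x, A.trivialization s x, A.N x)"
  have arr [simp]: "tarr L ?m" "tarr L ?a" "tarr L (B.tnak x)" "tarr L ?i" "tarr L ?s" "tarr L ?u" "tarr L ?p"
    using x a A.C.is_iso_in_hom[OF s] A.L.is_iso_in_hom[OF A.t_iso[OF x]]
      A.L.tiso_tarr[OF A.inak_serre_tcmp(2)[OF x]] by simp_all
  have T: "tarr L ?T"
    using A.L.is_iso_in_hom[OF A.trivialization_is_iso[OF s x]] x by simp
  have "(x, q x, B.S x) = ((((?m \<bullet>\<^bsub>L\<^esub> ?a) \<bullet>\<^bsub>L\<^esub> (B.tnak x \<bullet>\<^bsub>L\<^esub> ?i)) \<bullet>\<^bsub>L\<^esub> ?s) \<bullet>\<^bsub>L\<^esub> ?u) \<bullet>\<^bsub>L\<^esub> ?p"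
    using eq unfolding a_def
    by (simp add: tcmp_def tact_def tmun_def timun_def tid_def B.tnak_def del: A.L.tcmp_assoc)
  also have "\<dots> = ?m \<bullet>\<^bsub>L\<^esub> ?a \<bullet>\<^bsub>L\<^esub> B.tnak x \<bullet>\<^bsub>L\<^esub> (?i \<bullet>\<^bsub>L\<^esub> ?s \<bullet>\<^bsub>L\<^esub> ?u \<bullet>\<^bsub>L\<^esub> ?p)"
    using arr x by (simp del: tarr_triple)
  also have "?i \<bullet>\<^bsub>L\<^esub> ?s \<bullet>\<^bsub>L\<^esub> ?u \<bullet>\<^bsub>L\<^esub> ?p = ?T"
    by (rule A.trivialization_split[OF s x, symmetric])
  finally have "(x, B.trivialization r x, A.N x) = ?T"
    by (intro B.trivialization_unique[OF r x T]) (simp_all add: a_def)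
  then show ?thesis by simp
qed

theorem theorem3p19:
  fixes C :: "('o, 'm::ab_group_add, 'k::alg_closed_field) rigcat"
    and D :: "('q, 'r::ab_group_add, 'k) rigcat"
    and L :: "('p, 'n::ab_group_add, 'k) lincat"
    and NC :: "('o, 'm, 'k) nak" and ND :: "('q, 'r, 'k) nak" and NL :: "('p, 'n, 'k) nak"
    and A :: "('o, 'm, 'p, 'n) serre_action" and B :: "('q, 'r, 'p, 'n) serre_action"
    and mid :: "'o \<Rightarrow> 'p \<Rightarrow> 'q \<Rightarrow> 'n"
    and pC :: "'o \<Rightarrow> 'm" and pD :: "'q \<Rightarrow> 'r" and p q :: "'p \<Rightarrow> 'n"
  assumes "pivotal_fusion C pC" and "pivotal_fusion D pD"
    and "nakayama C NC" and "nakayama D ND" and "nakayama L NL"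
    and "pivotal_bimodule C pC D pD L A B mid p q"
  shows "(semisimple_category L
       \<and> calabi_yau L (left_trace C NC L NL A p)
       \<and> calabi_yau L (right_trace D ND L NL B q))
    \<and> (spherical_fusion C NC pC \<and> spherical_fusion D ND pD
         \<and> spherical_bimodule C pC NC D pD ND L NL A B mid p q
       \<longrightarrow> (\<forall>x\<in>obj L. \<forall>f\<in>hom L x x.
             left_trace C NC L NL A p x f = right_trace D ND L NL B q x f))"
proof -
  note pb = assms(6)[unfolded pivotal_bimodule_def]
  have C: "fusion_category C" and D: "fusion_category D"
    using assms(1,2) by (simp_all add: pivotal_fusion_def)
  \<comment> \<open>The module category contains the monoidal axioms of
    \<open>reverse D\<close>.\<close>
  have "module_category (reverse D) L B" using pb by (simp add: exact_module_def)
  then have R: "fusion_category (reverse D)"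
    by (intro fusion_category_reverse[OF D]) (rule module_category.axioms)
  have NR: "nakayama (reverse D) ND" using assms(4) by simp
  interpret A: serre_nakayama C L A NC NL p
    by (rule serre_nakayamaI[OF C assms(3,5)]) (use pb in blast)+
  interpret B: serre_nakayama "reverse D" L B ND NL q
    by (rule serre_nakayamaI[OF R NR assms(5)]) (use pb in blast)+
  define s r where "s = std_triv C NC" and "r = std_triv D ND"
  have s: "is_iso C (one C) (fob (nfn NC) (one C)) s"
    using std_triv_is_iso[OF C assms(3)] by (simp add: s_def dist_obj_def)
  have r: "is_iso (reverse D) (one (reverse D)) (fob (nfn ND) (one (reverse D))) r"
    using std_triv_is_iso[OF R NR] by (simp add: r_def dist_obj_def)
  have left: "left_trace C NC L NL A p = (\<lambda>x f. twisted_trace L NL x (A.trivialization s x \<cdot>\<^bsub>L\<^esub> f))"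
    by (intro ext) (simp only: left_trace_def A.trivialization_def[OF s], simp only: s_def)
  have right: "right_trace D ND L NL B q = (\<lambda>x f. twisted_trace L NL x (B.trivialization r x \<cdot>\<^bsub>L\<^esub> f))"
    by (intro ext) (simp only: right_trace_def B.trivialization_def[OF r], simp only: r_def)
  \<comment> \<open>Under sphericality both traces are the twisted trace composed with one and the
    same trivialization.\<close>
  have "A.trivialization s x = B.trivialization r x"
    if "spherical_bimodule C pC NC D pD ND L NL A B mid p q" and x: "x \<in> obj L" for x
    using that
    by (intro trivialized_radford_imp_trivialization_eq[OF A.serre_nakayama_axioms B.serre_nakayama_axioms s r x])
      (simp add: spherical_bimodule_def trivialized_radford_def radford_def istd_triv_def dist_obj_def s_def r_def)
  moreover have "semisimple_category L"
    by (rule exact_module_semisimple[OF C]) (use pb in blast)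
  moreover have "calabi_yau L (left_trace C NC L NL A p)" "calabi_yau L (right_trace D ND L NL B q)"
    unfolding left right by (rule A.calabi_yau_trivialization[OF s] B.calabi_yau_trivialization[OF r])+
  ultimately show ?thesis unfolding left right by simp
qed

end
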